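(* Let $H_1$ be a separable Hilbert space and $H_2$ an arbitrary Hilbert space. Let $\{e_i\}_{i\in I}$ be an orthonormal basis of $H_1$, where $I=\mathbb{N}$ or $I=\{1,2,\ldots,N\}$ for some $N\in\mathbb{N}$, and set $\mathcal{H}:=L^2(H_1\otimes H_2,H_2)$. Let $\Phi:L^1(H_1)\to L^1(H_2)$ be an FP-map. Then: (i) $\Phi$ is a CPCB-map if and only if there is a bounded operator $V_\Phi:H_1\to\mathcal{H}$ with $\Phi=\Psi_{H_1,H_2}\circ\mathrm{Ad}_{V_\Phi}$; (ii) $\Phi$ is a CPCC-map if and only if there is a contraction $V_\Phi:H_1\to\mathcal{H}$ with $\Phi=\Psi_{H_1,H_2}\circ\mathrm{Ad}_{V_\Phi}$; (iii) $\Phi$ is a CPTP-map if and only if there is an isometry $V_\Phi:H_1\to\mathcal{H}$ with $\Phi=\Psi_{H_1,H_2}\circ\mathrm{Ad}_{V_\Phi}$.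
   Context: All Hilbert spaces are complex, with inner product linear in the second argument. $\mathfrak{L}(H,K)$ denotes the bounded operators $H\to K$, $\mathfrak{L}(H)=\mathfrak{L}(H,H)$, $L^1(H)$ the trace-class operators on $H$ with the trace norm, $L^2(H,K)$ the Hilbert space of Hilbert–Schmidt operators $H\to K$ with inner product $\langle a,b\rangle=\mathrm{tr}(a^*b)$, and $\mathfrak{L}_0(H)$ the finite rank operators on $H$. "Positive" for operators means positive semi-definite. A linear map $\Phi:L^1(H_1)\to L^1(H_2)$ is: completely positive (CP) if $\mathrm{id}_n\otimes\Phi:L^1(\mathbb{C}^n\otimes H_1)\to L^1(\mathbb{C}^n\otimes H_2)$ maps positive operators to positive operators for every $n\in\mathbb{N}$; trace-preserving (TP) if $\mathrm{tr}(\Phi(s))=\mathrm{tr}(s)$ for all $s$; completely bounded (CB) if $\|\Phi\|_{\mathrm{cb}}:=\sup_{n}\|\mathrm{id}_n\otimes\Phi\|<\infty$ (operator norms with respect to the $L^1$-norms); completely contractive (CC) if $\|\Phi\|_{\mathrm{cb}}\le 1$; finite rank preserving (an FP-map) if $\Phi(\mathfrak{L}_0(H_1))\subseteq\mathfrak{L}_0(H_2)$. CPCB, CPCC, CPTP mean CP together with CB, CC, TP respectively. For $V\in\mathfrak{L}(H_1,\mathcal{H})$, $\mathrm{Ad}_V:L^1(H_1)\to L^1(\mathcal{H})$ is $\mathrm{Ad}_V(s)=V s V^*$. The map $\Psi_{H_1,H_2}:L^1(\mathcal{H})\to L^1(H_2)$ is defined as follows. Identify the dual $H^*$ of a Hilbert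 space $H$ with $\{\langle x| : x\in H\}$, with inner product $\langle\, \langle y|,\langle x|\,\rangle=\langle x,y\rangle$. Let $\theta:\mathcal{H}\to H_2\otimes H_1^*\otimes H_2^*$ be the unitary with $\theta^*(z\otimes\langle x|\otimes\langle y|)=\langle x|\otimes|z\rangle\langle y|$, i.e. the operator $\xi\otimes\eta\mapsto\langle x,\xi\rangle\langle y,\eta\rangle z$, for $x\in H_1$, $y,z\in H_2$. Let $\mathrm{tr}_{2,3}:L^1(H_2\otimes H_1^*\otimes H_2^* )\to L^1(H_2)$ be the partial trace over the second and third factors, i.e. $\mathrm{tr}(\mathrm{tr}_{2,3}(s)a)=\mathrm{tr}(s(a\otimes\mathbf{1}))$ for all $a\in\mathfrak{L}(H_2)$. Then $\Psi_{H_1,H_2}:=\mathrm{tr}_{2,3}\circ\mathrm{Ad}_\theta$. (Equivalently, $\Psi_{H_1,H_2}$ is the unique $L^1$-continuous linear map with $\Psi_{H_1,H_2}(|w_1\rangle\langle w_2|)=w_1w_2^*$ for all $w_1,w_2\in\mathcal{H}$.) *)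

theory Defs
  imports "HOL-Analysis.Analysis"
begin

section \<open>Complex Hilbert spaces\<close>

text \<open>A complex inner product space is a complex vector space with a sesquilinear form, linear in
  the second argument. Its real part is the library's real inner product, so the norm and the
  topology are those of the class \<^class>\<open>real_inner\<close>.\<close>

class complex_inner = real_inner +
  fixes scaleC :: "complex \<Rightarrow> 'a \<Rightarrow> 'a" (infixr \<open>*\<^sub>C\<close> 75)
    and cinner :: "'a \<Rightarrow> 'a \<Rightarrow> complex"
  assumes scaleC_add_right: "c *\<^sub>C (x + y) = c *\<^sub>C x + c *\<^sub>C y"
    and scaleC_add_left: "(c + d) *\<^sub>C x = c *\<^sub>C x + d *\<^sub>C x"
    and scaleC_scaleC: "c *\<^sub>C d *\<^sub>C x = (c * d) *\<^sub>C x"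
    and scaleC_of_real: "complex_of_real r *\<^sub>C x = r *\<^sub>R x"
    and cinner_commute: "cinner x y = cnj (cinner y x)"
    and cinner_add_right: "cinner x (y + z) = cinner x y + cinner x z"
    and cinner_scaleC_right: "cinner x (c *\<^sub>C y) = c * cinner x y"
    and Re_cinner: "Re (cinner x y) = inner x y"

class chilbert_space = complex_inner + complete_space

instance chilbert_space \<subseteq> banach ..

lemma scaleC_one [simp]: "1 *\<^sub>C (x::'a::complex_inner) = x"
  using scaleC_of_real[of 1 x] by simp

global_interpretation cvec: vector_space "scaleC :: complex \<Rightarrow> 'a \<Rightarrow> 'a::complex_inner"
  defines cspan = cvec.span
  by unfold_locales (simp_all add: scaleC_add_right scaleC_add_left scaleC_scaleC)

lemma cinner_add_left: "cinner (x + y) z = cinner x z + cinner y (z::'a::complex_inner)"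
  by (metis cinner_add_right cinner_commute complex_cnj_add)

lemma cinner_scaleC_left: "cinner (c *\<^sub>C x) y = cnj c * cinner x (y::'a::complex_inner)"
  by (metis cinner_scaleC_right cinner_commute complex_cnj_mult)

lemma scaleR_scaleC: "r *\<^sub>R x = complex_of_real r *\<^sub>C (x::'a::complex_inner)"
  by (simp add: scaleC_of_real)

lemma cinner_self: "cinner x (x::'a::complex_inner) = complex_of_real ((norm x)\<^sup>2)"
proof -
  have "Im (cinner x x) = 0"
    using cinner_commute[of x x] by (metis Reals_cnj_iff complex_is_Real_iff)
  moreover have "Re (cinner x x) = (norm x)\<^sup>2"
    by (simp add: Re_cinner power2_norm_eq_inner)
  ultimately show ?thesis by (simp add: complex_eq_iff)
qed

lemma of_real_cmod_power2: "(complex_of_real (cmod c))\<^sup>2 = c * cnj c"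
  using complex_norm_square[of c] by simp

lemma norm_scaleC: "norm (c *\<^sub>C (x::'a::complex_inner)) = cmod c * norm x"
proof -
  have "cinner (c *\<^sub>C x) (c *\<^sub>C x) = (c * cnj c) * cinner x x"
    by (simp only: cinner_scaleC_left cinner_scaleC_right) (simp add: mult_ac)
  then have "complex_of_real ((norm (c *\<^sub>C x))\<^sup>2) = complex_of_real ((cmod c * norm x)\<^sup>2)"
    unfolding cinner_self by (simp add: power_mult_distrib of_real_cmod_power2)
  then show ?thesis
    by (metis abs_norm_cancel abs_mult norm_ge_zero of_real_eq_iff power2_eq_iff_nonneg zero_le_mult_iff)
qed

lemma cinner_bound: "cmod (cinner x y) \<le> norm x * norm (y::'a::complex_inner)"
proof -
  obtain c where c: "cmod c = 1" "cmod (cinner x y) = Re (c * cinner x y)"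
  proof (cases "cinner x y = 0")
    case True then show ?thesis by (intro that[of 1]) auto
  next
    case False
    show ?thesis
    proof (rule that[of "cnj (cinner x y) / cmod (cinner x y)"])
      show "cmod (cnj (cinner x y) / complex_of_real (cmod (cinner x y))) = 1"
        using False by (simp add: norm_divide)
      have "cnj (cinner x y) * cinner x y = complex_of_real ((cmod (cinner x y))\<^sup>2)"
        by (simp add: of_real_cmod_power2 mult.commute)
      then show "cmod (cinner x y) = Re (cnj (cinner x y) / complex_of_real (cmod (cinner x y)) * cinner x y)"
        using False by (simp add: power2_eq_square)
    qed
  qed
  have "cmod (cinner x y) = inner x (c *\<^sub>C y)"
    using c by (simp add: cinner_scaleC_right flip: Re_cinner)
  also have "\<dots> \<le> norm x * norm (c *\<^sub>C y)" by (rule norm_cauchy_schwarz)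
  finally show ?thesis using c by (simp add: norm_scaleC)
qed

lemma bounded_linear_cinner_right: "bounded_linear (cinner (x::'a::complex_inner))"
  by (rule bounded_linear_intro[where K="norm x"])
    (auto simp: cinner_add_right scaleR_scaleC cinner_scaleC_right scaleR_conv_of_real
        mult.commute[of _ "norm x"] intro: cinner_bound)

lemma bounded_linear_cinner_left: "bounded_linear (\<lambda>x. cinner x (y::'a::complex_inner))"
proof (rule bounded_linear_intro[where K="norm y"])
  show "cmod (cinner x y) \<le> norm x * norm y" for x by (rule cinner_bound)
qed (auto simp: cinner_add_left scaleR_scaleC cinner_scaleC_left scaleR_conv_of_real)

lemma bounded_linear_scaleC_right: "bounded_linear (\<lambda>x::'a::complex_inner. c *\<^sub>C x)"
  by (rule bounded_linear_intro[where K="cmod c"])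
    (auto simp: scaleC_add_right scaleR_scaleC scaleC_scaleC norm_scaleC mult.commute)

lemma bounded_linear_scaleC_left: "bounded_linear (\<lambda>c. c *\<^sub>C (x::'a::complex_inner))"
  by (rule bounded_linear_intro[where K="norm x"])
    (auto simp: scaleC_add_left scaleR_scaleC scaleC_scaleC norm_scaleC scaleR_conv_of_real)

lemma cinner_zero_right [simp]: "cinner x (0::'a::complex_inner) = 0"
  and cinner_zero_left [simp]: "cinner (0::'a::complex_inner) y = 0"
  by (rule linear_0[OF bounded_linear.linear[OF bounded_linear_cinner_right]],
      rule linear_0[OF bounded_linear.linear[OF bounded_linear_cinner_left]])

lemma cinner_sum_right: "cinner x (sum f A) = (\<Sum>i\<in>A. cinner x (f i :: 'a::complex_inner))"
  by (rule linear_sum[OF bounded_linear.linear[OF bounded_linear_cinner_right]])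

lemma cinner_sum_left: "cinner (sum f A) x = (\<Sum>i\<in>A. cinner (f i :: 'a::complex_inner) x)"
  by (rule linear_sum[OF bounded_linear.linear[OF bounded_linear_cinner_left]])

lemma cinner_diff_right: "cinner x (y - z) = cinner x y - cinner x (z::'a::complex_inner)"
  using cinner_add_right[of x "y - z" z] by simp

lemma cinner_diff_left: "cinner (y - z) x = cinner y x - cinner z (x::'a::complex_inner)"
  using cinner_add_left[of "y - z" z x] by simp

lemma cinner_eq_zero_iff [simp]: "cinner x x = 0 \<longleftrightarrow> x = (0::'a::complex_inner)"
  by (simp add: cinner_self)

lemma cinner_zeroI: "(\<And>y. cinner y x = 0) \<Longrightarrow> x = (0::'a::complex_inner)"
  using cinner_eq_zero_iff by blast

section \<open>Orthonormal bases\<close>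

definition orthonormal :: "'a::complex_inner set \<Rightarrow> bool"
  where "orthonormal B \<longleftrightarrow> (\<forall>e\<in>B. \<forall>f\<in>B. cinner e f = (if e = f then 1 else 0))"

definition is_onb :: "'a::complex_inner set \<Rightarrow> bool"
  where "is_onb B \<longleftrightarrow> orthonormal B \<and> closure (cspan B) = UNIV"

definition some_onb :: "'a::complex_inner set"
  where "some_onb = (SOME B. is_onb B)"

lemma orthonormal_norm: "orthonormal B \<Longrightarrow> e \<in> B \<Longrightarrow> norm e = 1"
  by (metis cinner_self norm_ge_zero norm_one of_real_1 of_real_eq_iff orthonormal_def power2_eq_1_iff
      real_sqrt_abs real_sqrt_unique abs_norm_cancel power_one)

lemma orthonormal_cinner_sum:
  assumes "orthonormal B" "finite F" "F \<subseteq> B" "e \<in> B"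
  shows "cinner e (\<Sum>f\<in>F. c f *\<^sub>C f) = (if e \<in> F then c e else 0)"
proof -
  have "cinner e (\<Sum>f\<in>F. c f *\<^sub>C f) = (\<Sum>f\<in>F. if e = f then c f else 0)"
    unfolding cinner_sum_right
    by (rule sum.cong) (use assms in \<open>auto simp: cinner_scaleC_right orthonormal_def\<close>)
  then show ?thesis using assms(2) by simp
qed

lemma orthonormal_norm_sum:
  assumes "orthonormal B" "finite F" "F \<subseteq> B"
  shows "(norm (\<Sum>f\<in>F. c f *\<^sub>C f))\<^sup>2 = (\<Sum>f\<in>F. (cmod (c f))\<^sup>2)"
proof -
  have "complex_of_real ((norm (\<Sum>f\<in>F. c f *\<^sub>C f))\<^sup>2) = (\<Sum>f\<in>F. cnj (c f) * c f)"
    unfolding cinner_self[symmetric] cinner_sum_left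
    by (rule sum.cong) (use assms orthonormal_cinner_sum[OF assms] in \<open>auto simp: cinner_scaleC_left\<close>)
  also have "\<dots> = complex_of_real (\<Sum>f\<in>F. (cmod (c f))\<^sup>2)"
    by (simp add: of_real_cmod_power2 mult.commute)
  finally show ?thesis using of_real_eq_iff by blast
qed

lemma norm_pythagoras:
  assumes "cinner x y = (0::complex)"
  shows "(norm (x + y))\<^sup>2 = (norm x)\<^sup>2 + (norm (y::'a::complex_inner))\<^sup>2"
  using Re_cinner[of x y] assms by (simp add: power2_norm_eq_inner inner_add inner_commute)

lemma orthonormal_residual:
  assumes "orthonormal B" "finite F" "F \<subseteq> B" "e \<in> F"
  shows "cinner e (x - (\<Sum>f\<in>F. cinner f x *\<^sub>C f)) = 0"
  using orthonormal_cinner_sum[OF assms(1-3), of e "\<lambda>f. cinner f x"] assms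
  by (auto simp: cinner_diff_right)

lemma bessel:
  assumes "orthonormal B" "finite F" "F \<subseteq> B"
  shows "(\<Sum>f\<in>F. (cmod (cinner f x))\<^sup>2) \<le> (norm x)\<^sup>2"
proof -
  let ?s = "\<Sum>f\<in>F. cinner f x *\<^sub>C f"
  have "cinner ?s (x - ?s) = 0"
    unfolding cinner_sum_left using orthonormal_residual[OF assms]
    by (auto simp: cinner_scaleC_left intro!: sum.neutral)
  from norm_pythagoras[OF this] have "(norm x)\<^sup>2 = (norm ?s)\<^sup>2 + (norm (x - ?s))\<^sup>2" by simp
  then show ?thesis using orthonormal_norm_sum[OF assms, of "\<lambda>f. cinner f x"] by simp
qed

lemma best_approximation:
  assumes "orthonormal B" "finite F" "F \<subseteq> B"
  shows "norm (x - (\<Sum>f\<in>F. cinner f x *\<^sub>C f)) \<le> norm (x - (\<Sum>f\<in>F. c f *\<^sub>C f))"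
proof -
  let ?s = "\<Sum>f\<in>F. cinner f x *\<^sub>C f" and ?u = "\<Sum>f\<in>F. c f *\<^sub>C f"
  have su: "?s - ?u = (\<Sum>f\<in>F. (cinner f x - c f) *\<^sub>C f)"
    by (simp add: cvec.scale_left_diff_distrib sum_subtractf)
  have "cinner (?s - ?u) (x - ?s) = 0"
    unfolding su cinner_sum_left using orthonormal_residual[OF assms]
    by (auto simp: cinner_scaleC_left intro!: sum.neutral)
  from norm_pythagoras[OF this] have "(norm (x - ?u))\<^sup>2 = (norm (?s - ?u))\<^sup>2 + (norm (x - ?s))\<^sup>2"
    by simp
  then show ?thesis by (simp add: power2_le_imp_le)
qed

lemma bessel_summable:
  assumes "orthonormal B"
  shows "(\<lambda>e. (cmod (cinner e x))\<^sup>2) summable_on B"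
  by (rule nonneg_bdd_above_summable_on)
    (auto intro!: bdd_aboveI2[where M="(norm x)\<^sup>2"] bessel[OF assms])

lemma onb_has_sum:
  assumes "is_onb B"
  shows "((\<lambda>e. cinner e x *\<^sub>C e) has_sum x) B"
  unfolding has_sum_def tendsto_iff
proof (intro allI impI)
  fix \<epsilon> :: real assume "\<epsilon> > 0"
  have ortho: "orthonormal B" using assms by (simp add: is_onb_def)
  have "x \<in> closure (cspan B)" using assms by (simp add: is_onb_def)
  then obtain u where u: "u \<in> cspan B" "dist u x < \<epsilon>"
    using \<open>\<epsilon> > 0\<close> closure_approachable by blast
  then obtain F c where F: "finite F" "F \<subseteq> B" "u = (\<Sum>f\<in>F. c f *\<^sub>C f)"
    unfolding cvec.span_explicit by blast
  show "\<forall>\<^sub>F G in finite_subsets_at_top B. dist (\<Sum>e\<in>G. cinner e x *\<^sub>C e) x < \<epsilon>"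
    unfolding eventually_finite_subsets_at_top
  proof (intro exI[of _ F] conjI allI impI)
    fix G assume G: "finite G \<and> F \<subseteq> G \<and> G \<subseteq> B"
    define d where "d f = (if f \<in> F then c f else 0)" for f
    have "u = (\<Sum>f\<in>G. d f *\<^sub>C f)"
      unfolding F(3) d_def using G by (intro sum.mono_neutral_cong_left) auto
    then have "norm (x - (\<Sum>f\<in>G. cinner f x *\<^sub>C f)) \<le> norm (x - u)"
      using best_approximation[OF ortho, of G x d] G by simp
    then show "dist (\<Sum>e\<in>G. cinner e x *\<^sub>C e) x < \<epsilon>"
      using u(2) by (simp add: dist_norm norm_minus_commute)
  qed (use F in auto)
qed

lemma onb_cinner_has_sum:
  assumes "is_onb B"
  shows "((\<lambda>e. cinner x e * cinner e y) has_sum cinner x y) B"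
  using has_sum_bounded_linear[OF bounded_linear_cinner_right onb_has_sum[OF assms], of x y]
  by (simp add: cinner_scaleC_right mult.commute)

lemma parseval:
  assumes "is_onb B"
  shows "((\<lambda>e. (cmod (cinner e x))\<^sup>2) has_sum (norm x)\<^sup>2) B"
proof -
  have "cinner x e * cinner e x = complex_of_real ((cmod (cinner e x))\<^sup>2)" for e
    by (metis cinner_commute complex_norm_square mult.commute)
  with onb_cinner_has_sum[OF assms, of x x] show ?thesis
    by (simp add: cinner_self has_sum_of_real_iff flip: of_real_power)
qed

lemma orthonormal_summable:
  fixes B :: "'a::chilbert_space set"
  assumes B: "orthonormal B" and c: "(\<lambda>e. (cmod (c e))\<^sup>2) summable_on B"
  shows "(\<lambda>e. c e *\<^sub>C e) summable_on B"
proof -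
  let ?f = "\<lambda>e. c e *\<^sub>C e" and ?g = "\<lambda>e. (cmod (c e))\<^sup>2"
  have "\<exists>P. eventually P (finite_subsets_at_top B) \<and>
              (\<forall>F F'. P F \<and> P F' \<longrightarrow> dist (sum ?f F) (sum ?f F') < \<epsilon>)" if \<epsilon>: "\<epsilon> > 0" for \<epsilon>
  proof -
    have "\<epsilon>\<^sup>2 / 4 > 0" using \<epsilon> by simp
    then have "\<exists>F0. finite F0 \<and> F0 \<subseteq> B \<and> dist (sum ?g F0) (infsum ?g B) \<le> \<epsilon>\<^sup>2 / 8"
      by (intro infsum_finite_approximation[OF c]) simp
    then obtain F0 where F0: "finite F0" "F0 \<subseteq> B" "dist (sum ?g F0) (infsum ?g B) \<le> \<epsilon>\<^sup>2 / 8"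
      by blast
    have small: "dist (sum ?f F) (sum ?f F0) < \<epsilon> / 2" if F: "finite F" "F0 \<subseteq> F" "F \<subseteq> B" for F
    proof -
      have "sum ?g F \<le> infsum ?g B" by (rule finite_sum_le_infsum) (use c F in auto)
      moreover have "infsum ?g B - sum ?g F0 \<le> \<epsilon>\<^sup>2 / 8"
        using F0(3) unfolding dist_real_def by linarith
      moreover have "sum ?g (F - F0) = sum ?g F - sum ?g F0"
        using F by (simp add: sum_diff F0(1))
      ultimately have *: "sum ?g (F - F0) \<le> \<epsilon>\<^sup>2 / 8" by linarith
      have "dist (sum ?f F) (sum ?f F0) = norm (sum ?f (F - F0))"
        using F F0 by (simp add: dist_norm sum_diff)
      moreover have "(norm (sum ?f (F - F0)))\<^sup>2 \<le> \<epsilon>\<^sup>2 / 8"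
        using orthonormal_norm_sum[OF B, of "F - F0" c] F * by (simp add: le_diff_eq subset_iff)
      moreover have "\<epsilon>\<^sup>2 / 8 < (\<epsilon> / 2)\<^sup>2" using \<epsilon> by (simp add: power_divide)
      ultimately show ?thesis using \<epsilon> by (smt (verit) power2_le_imp_le divide_pos_pos power_mono)
    qed
    show ?thesis
    proof (intro exI[of _ "\<lambda>F. finite F \<and> F0 \<subseteq> F \<and> F \<subseteq> B"] conjI allI impI)
      show "\<forall>\<^sub>F F in finite_subsets_at_top B. finite F \<and> F0 \<subseteq> F \<and> F \<subseteq> B"
        using F0 by (auto simp: eventually_finite_subsets_at_top)
      fix F F' assume "(finite F \<and> F0 \<subseteq> F \<and> F \<subseteq> B) \<and> finite F' \<and> F0 \<subseteq> F' \<and> F' \<subseteq> B"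
      then show "dist (sum ?f F) (sum ?f F') < \<epsilon>"
        using small[of F] small[of F'] dist_triangle_half_l by blast
    qed
  qed
  then have "cauchy_filter (filtermap (sum ?f) (finite_subsets_at_top B))"
    by (simp add: cauchy_filter_metric_filtermap)
  moreover have "complete (UNIV::'a set)"
    by (meson Cauchy_convergent UNIV_I complete_def convergent_def)
  ultimately obtain L where "(sum ?f \<longlongrightarrow> L) (finite_subsets_at_top B)"
    using complete_uniform[where S=UNIV] by (force simp add: filterlim_def)
  then show ?thesis using summable_on_def has_sum_def by blast
qed

lemma onb_exists: "\<exists>B::'a::chilbert_space set. is_onb B"
proof -
  have "\<exists>M\<in>{B::'a set. orthonormal B}. \<forall>X\<in>{B. orthonormal B}. M \<subseteq> X \<longrightarrow> X = M"
  proof (rule subset_Zorn')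
    fix C :: "'a set set" assume C: "subset.chain {B. orthonormal B} C"
    show "\<Union>C \<in> {B. orthonormal B}"
      unfolding orthonormal_def
    proof (safe)
      fix e f X Y assume "e \<in> X" "X \<in> C" "f \<in> Y" "Y \<in> C"
      then obtain Z where "Z \<in> C" "e \<in> Z" "f \<in> Z"
        using C unfolding subset_chain_def by blast
      then show "cinner e f = (if e = f then 1 else 0)"
        using C unfolding subset_chain_def orthonormal_def by blast
    qed
  qed
  then obtain M :: "'a set" where M: "orthonormal M" and max: "\<And>X. orthonormal X \<Longrightarrow> M \<subseteq> X \<Longrightarrow> X = M"
    by blast
  have "x \<in> closure (cspan M)" for x
  proof -
    obtain y where y: "((\<lambda>e. cinner e x *\<^sub>C e) has_sum y) M"
      using orthonormal_summable[OF M bessel_summable[OF M]] by (auto simp: summable_on_def)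
    have perp: "cinner e (x - y) = 0" if "e \<in> M" for e
    proof -
      have "((\<lambda>f. cinner f x * cinner e f) has_sum cinner e y) M"
        using has_sum_bounded_linear[OF bounded_linear_cinner_right y, of e]
        by (simp add: cinner_scaleC_right)
      moreover have "((\<lambda>f. cinner f x * cinner e f) has_sum cinner e x) M"
        by (rule has_sum_finite_neutralI[where B="{e}"])
          (use that M in \<open>auto simp: orthonormal_def\<close>)
      ultimately show ?thesis using has_sum_unique by (fastforce simp: cinner_diff_right)
    qed
    have "x - y = 0"
    proof (rule ccontr)
      assume nz: "x - y \<noteq> 0"
      define u where "u = (1 / norm (x - y)) *\<^sub>R (x - y)"
      have nu: "cinner u u = 1"
        using nz by (simp add: cinner_self u_def)
      have pu: "cinner e u = 0" "cinner u e = 0" if "e \<in> M" for e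
        using perp[OF that] cinner_commute[of u e] by (auto simp: u_def scaleR_scaleC cinner_scaleC_right)
      have "orthonormal (insert u M)"
        using M nu pu unfolding orthonormal_def by auto
      then have "u \<in> M" using max[of "insert u M"] by auto
      then show False using nu pu[of u] by simp
    qed
    moreover have "y \<in> closure (cspan M)"
      unfolding closure_approachable
    proof (intro allI impI)
      fix \<epsilon> :: real assume "\<epsilon> > 0"
      from has_sum_finite_approximation[OF y, of "\<epsilon> / 2"] this
      obtain F where F: "finite F" "F \<subseteq> M" "dist (\<Sum>e\<in>F. cinner e x *\<^sub>C e) y \<le> \<epsilon> / 2" by auto
      moreover have "(\<Sum>e\<in>F. cinner e x *\<^sub>C e) \<in> cspan M"
        using F by (auto intro!: cvec.span_sum cvec.span_scale intro: cvec.span_base)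
      ultimately show "\<exists>z\<in>cspan M. dist z y < \<epsilon>" using \<open>\<epsilon> > 0\<close> by force
    qed
    ultimately show ?thesis by simp
  qed
  then show ?thesis using M unfolding is_onb_def by blast
qed

lemma some_onb_is_onb: "is_onb (some_onb :: 'a::chilbert_space set)"
  unfolding some_onb_def by (rule someI_ex[OF onb_exists])

section \<open>Bounded operators and adjoints\<close>

definition bounded_clinear :: "('a::complex_inner \<Rightarrow> 'b::complex_inner) \<Rightarrow> bool"
  where "bounded_clinear T \<longleftrightarrow> bounded_linear T \<and> (\<forall>c x. T (c *\<^sub>C x) = c *\<^sub>C T x)"

definition adj :: "('a::chilbert_space \<Rightarrow> 'b::chilbert_space) \<Rightarrow> ('b \<Rightarrow> 'a)"
  where "adj T = (THE S. bounded_clinear S \<and> (\<forall>x y. cinner (S y) x = cinner y (T x)))"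

lemma bounded_clinear_intro:
  assumes "\<And>x y. T (x + y) = T x + T y" "\<And>c x. T (c *\<^sub>C x) = c *\<^sub>C T x"
    and "\<And>x. norm (T x) \<le> norm x * K"
  shows "bounded_clinear T"
  unfolding bounded_clinear_def
  by (auto intro!: bounded_linear_intro[where K=K] simp: assms scaleR_scaleC)

lemma bounded_clinear_add: "bounded_clinear T \<Longrightarrow> T (x + y) = T x + T y"
  by (simp add: bounded_clinear_def linear_add bounded_linear.linear)

lemma bounded_clinear_diff: "bounded_clinear T \<Longrightarrow> T (x - y) = T x - T y"
  by (simp add: bounded_clinear_def linear_diff bounded_linear.linear)

lemma bounded_clinear_scaleC: "bounded_clinear T \<Longrightarrow> T (c *\<^sub>C x) = c *\<^sub>C T x"
  by (simp add: bounded_clinear_def)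

lemma bounded_clinear_zero: "bounded_clinear T \<Longrightarrow> T 0 = 0"
  by (simp add: bounded_clinear_def linear_0 bounded_linear.linear)

lemma bounded_clinear_bounded_linear: "bounded_clinear T \<Longrightarrow> bounded_linear T"
  by (simp add: bounded_clinear_def)

lemma riesz_representation:
  fixes f :: "'a::chilbert_space \<Rightarrow> complex"
  assumes f: "bounded_linear f" and fc: "\<And>c x. f (c *\<^sub>C x) = c * f x"
  shows "\<exists>v. \<forall>x. f x = cinner v x"
proof -
  define B where "B = (some_onb :: 'a set)"
  have B: "is_onb B" unfolding B_def by (rule some_onb_is_onb)
  then have ortho: "orthonormal B" by (simp add: is_onb_def)
  obtain K where K: "K \<ge> 0" "\<And>x. norm (f x) \<le> norm x * K"
    using bounded_linear.nonneg_bounded[OF f] by blast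
  let ?g = "\<lambda>e. (cmod (cnj (f e)))\<^sup>2"
  have "sum ?g F \<le> K\<^sup>2" if F: "finite F" "F \<subseteq> B" for F
  proof -
    define u where "u = (\<Sum>e\<in>F. cnj (f e) *\<^sub>C e)"
    have nu: "(norm u)\<^sup>2 = sum ?g F"
      unfolding u_def by (rule orthonormal_norm_sum[OF ortho F])
    have "f u = (\<Sum>e\<in>F. cnj (f e) * f e)"
      unfolding u_def by (simp add: linear_sum[OF bounded_linear.linear[OF f]] fc)
    also have "\<dots> = complex_of_real ((norm u)\<^sup>2)"
      unfolding nu by (simp add: of_real_cmod_power2 mult.commute)
    finally have "cmod (f u) = (norm u)\<^sup>2" by (simp del: of_real_power)
    then have "(norm u)\<^sup>2 \<le> norm u * K" using K(2)[of u] by simp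
    then have "norm u \<le> K"
      using K(1) by (cases "norm u = 0") (auto simp: power2_eq_square mult_le_cancel_left)
    then have "(norm u)\<^sup>2 \<le> K\<^sup>2" by (rule power_mono) simp
    then show ?thesis by (simp only: nu)
  qed
  then have "?g summable_on B"
    by (intro nonneg_bdd_above_summable_on bdd_aboveI2[where M="K\<^sup>2"]) auto
  then obtain v where v: "((\<lambda>e. cnj (f e) *\<^sub>C e) has_sum v) B"
    using orthonormal_summable[OF ortho, of "\<lambda>e. cnj (f e)"] unfolding summable_on_def by blast
  have "f x = cinner v x" for x
  proof -
    have "((\<lambda>e. cinner e x * f e) has_sum f x) B"
      using has_sum_bounded_linear[OF f onb_has_sum[OF B, of x]] by (simp add: fc)
    moreover have "((\<lambda>e. cinner e x * f e) has_sum cinner v x) B"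
      using has_sum_bounded_linear[OF bounded_linear_cinner_left v, of x]
      by (simp add: cinner_scaleC_left mult.commute)
    ultimately show ?thesis by (rule has_sum_unique)
  qed
  then show ?thesis by blast
qed

lemma adjoint_exists:
  fixes T :: "'a::chilbert_space \<Rightarrow> 'b::chilbert_space"
  assumes T: "bounded_clinear T"
  shows "\<exists>!S. bounded_clinear S \<and> (\<forall>x y. cinner (S y) x = cinner y (T x))"
proof -
  have bl: "bounded_linear T" using T by (simp add: bounded_clinear_def)
  have "\<forall>y. \<exists>v. \<forall>x. cinner y (T x) = cinner v x"
  proof
    fix y
    show "\<exists>v. \<forall>x. cinner y (T x) = cinner v x"
      by (rule riesz_representation, rule bounded_linear_compose[OF bounded_linear_cinner_right bl])
        (simp add: bounded_clinear_scaleC[OF T] cinner_scaleC_right)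
  qed
  then obtain S where S: "\<And>x y. cinner (S y) x = cinner y (T x)" by metis
  have eqI: "u = v" if "\<And>x. cinner u x = cinner v x" for u v :: 'a
    using that[of "u - v"] cinner_eq_zero_iff[of "u - v"] by (simp add: cinner_diff_left)
  obtain K where K: "K \<ge> 0" "\<And>x. norm (T x) \<le> norm x * K"
    using bounded_linear.nonneg_bounded[OF bl] by blast
  have "bounded_clinear S"
  proof (rule bounded_clinear_intro[where K=K])
    show "S (x + y) = S x + S y" for x y by (rule eqI) (simp only: S cinner_add_left)
    show "S (c *\<^sub>C x) = c *\<^sub>C S x" for c x by (rule eqI) (simp only: S cinner_scaleC_left)
    fix y
    have "cinner y (T (S y)) = complex_of_real ((norm (S y))\<^sup>2)"
      unfolding cinner_self[symmetric] S ..
    then have "(norm (S y))\<^sup>2 = cmod (cinner y (T (S y)))" by (simp del: of_real_power)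
    also have "\<dots> \<le> norm y * norm (T (S y))" by (rule cinner_bound)
    also have "\<dots> \<le> norm y * (norm (S y) * K)" by (intro mult_left_mono K) simp
    finally have "norm (S y) * norm (S y) \<le> norm (S y) * (norm y * K)"
      by (simp add: power2_eq_square mult_ac)
    then show "norm (S y) \<le> norm y * K"
      using K(1) by (cases "norm (S y) = 0") (auto simp: mult_le_cancel_left)
  qed
  moreover have "S' = S" if "\<forall>x y. cinner (S' y) x = cinner y (T x)" for S'
  proof
    fix y show "S' y = S y" by (rule eqI) (simp only: that S)
  qed
  ultimately show ?thesis using S by (intro ex1I[of _ S]) blast+
qed

lemma adj_bounded_clinear: "bounded_clinear T \<Longrightarrow> bounded_clinear (adj T)"
  and cinner_adj_left: "bounded_clinear T \<Longrightarrow> cinner (adj T y) x = cinner y (T x)"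
  unfolding adj_def using theI'[OF adjoint_exists[of T]] by blast+

lemma cinner_adj_right: "bounded_clinear T \<Longrightarrow> cinner x (adj T y) = cinner (T x) y"
  by (metis cinner_adj_left cinner_commute)

lemma adj_adj: assumes "bounded_clinear T" shows "adj (adj T) = T"
  unfolding adj_def[of "adj T"]
  by (rule the1_equality[OF adjoint_exists[OF adj_bounded_clinear[OF assms]]])
    (simp add: assms cinner_adj_right)

section \<open>Trace, trace-class operators and the trace norm\<close>

definition positive_op :: "('a::complex_inner \<Rightarrow> 'a) \<Rightarrow> bool"
  where "positive_op P \<longleftrightarrow> bounded_clinear P \<and> (\<forall>x. cinner x (P x) \<in> \<real>\<^sub>\<ge>\<^sub>0)"

definition abs_op :: "('a::chilbert_space \<Rightarrow> 'a) \<Rightarrow> ('a \<Rightarrow> 'a)"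
  where "abs_op T = (THE P. positive_op P \<and> P \<circ> P = adj T \<circ> T)"

definition trace :: "('a::chilbert_space \<Rightarrow> 'a) \<Rightarrow> complex"
  where "trace T = (\<Sum>\<^sub>\<infinity>e\<in>some_onb. cinner e (T e))"

definition trace_class :: "('a::chilbert_space \<Rightarrow> 'a) \<Rightarrow> bool"
  where "trace_class T \<longleftrightarrow>
    bounded_clinear T \<and> (\<exists>B. is_onb B \<and> (\<lambda>e. cinner e (abs_op T e)) summable_on B)"

definition trace_norm :: "('a::chilbert_space \<Rightarrow> 'a) \<Rightarrow> real"
  where "trace_norm T = Re (trace (abs_op T))"

section \<open>Square-summable families\<close>

typedef (overloaded) ('i, 'a) ell2 =
  "{f :: 'i \<Rightarrow> 'a::complex_inner. (\<lambda>i. (norm (f i))\<^sup>2) summable_on UNIV}"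
  morphisms ell2_nth Abs_ell2
  by (rule exI[of _ "\<lambda>_. 0"]) simp

setup_lifting type_definition_ell2

lemma ell2_bound_summable:
  fixes f g :: "'i \<Rightarrow> 'a::complex_inner"
  assumes "(\<lambda>i. (norm (f i))\<^sup>2) summable_on A" "(\<lambda>i. (norm (g i))\<^sup>2) summable_on A"
  shows "(\<lambda>i. norm (f i) * norm (g i)) summable_on A"
proof (rule summable_on_comparison_test)
  show "(\<lambda>i. (norm (f i))\<^sup>2 + (norm (g i))\<^sup>2) summable_on A"
    by (rule summable_on_add[OF assms])
  show "norm (f i) * norm (g i) \<le> (norm (f i))\<^sup>2 + (norm (g i))\<^sup>2" for i
    using sum_squares_bound[of "norm (f i)" "norm (g i)"] mult_nonneg_nonneg[OF norm_ge_zero[of "f i"] norm_ge_zero[of "g i"]]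
    by linarith
qed simp

lemma ell2_add_closed:
  fixes f g :: "'i \<Rightarrow> 'a::complex_inner"
  assumes "(\<lambda>i. (norm (f i))\<^sup>2) summable_on A" "(\<lambda>i. (norm (g i))\<^sup>2) summable_on A"
  shows "(\<lambda>i. (norm (f i + g i))\<^sup>2) summable_on A"
proof (rule summable_on_comparison_test)
  show "(\<lambda>i. ((norm (f i))\<^sup>2 + (norm (g i))\<^sup>2) + 2 * (norm (f i) * norm (g i))) summable_on A"
    by (intro summable_on_add assms summable_on_cmult_right ell2_bound_summable)
  show "(norm (f i + g i))\<^sup>2 \<le> ((norm (f i))\<^sup>2 + (norm (g i))\<^sup>2) + 2 * (norm (f i) * norm (g i))" for i
    using power_mono[OF norm_triangle_ineq[of "f i" "g i"], of 2] by (simp add: power2_sum)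
qed simp

lemma ell2_scaleC_closed:
  fixes f :: "'i \<Rightarrow> 'a::complex_inner"
  assumes "(\<lambda>i. (norm (f i))\<^sup>2) summable_on A"
  shows "(\<lambda>i. (norm (c *\<^sub>C f i))\<^sup>2) summable_on A"
  using summable_on_cmult_right[OF assms, of "(cmod c)\<^sup>2"] by (simp add: norm_scaleC power_mult_distrib)

lemma ell2_cinner_summable:
  fixes f g :: "'i \<Rightarrow> 'a::complex_inner"
  assumes "(\<lambda>i. (norm (f i))\<^sup>2) summable_on A" "(\<lambda>i. (norm (g i))\<^sup>2) summable_on A"
  shows "(\<lambda>i. cinner (f i) (g i)) summable_on A"
proof (rule abs_summable_summable, rule summable_on_comparison_test[OF ell2_bound_summable[OF assms]])
  show "cmod (cinner (f i) (g i)) \<le> norm (f i) * norm (g i)" for i by (rule cinner_bound)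
qed simp

lemma ell2_cinner_self:
  fixes f :: "'i \<Rightarrow> 'a::complex_inner"
  assumes "(\<lambda>i. (norm (f i))\<^sup>2) summable_on A"
  shows "Re (\<Sum>\<^sub>\<infinity>i\<in>A. cinner (f i) (f i)) = (\<Sum>\<^sub>\<infinity>i\<in>A. (norm (f i))\<^sup>2)"
  unfolding infsum_Re[OF ell2_cinner_summable[OF assms assms], symmetric]
  by (simp add: Re_cinner power2_norm_eq_inner)

instantiation ell2 :: (type, complex_inner) complex_inner
begin

lift_definition zero_ell2 :: "('a, 'b) ell2" is "\<lambda>_. 0" by simp
lift_definition plus_ell2 :: "('a, 'b) ell2 \<Rightarrow> ('a, 'b) ell2 \<Rightarrow> ('a, 'b) ell2" is "\<lambda>f g i. f i + g i"
  by (rule ell2_add_closed)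
lift_definition scaleC_ell2 :: "complex \<Rightarrow> ('a, 'b) ell2 \<Rightarrow> ('a, 'b) ell2" is "\<lambda>c f i. c *\<^sub>C f i"
  by (rule ell2_scaleC_closed)
lift_definition cinner_ell2 :: "('a, 'b) ell2 \<Rightarrow> ('a, 'b) ell2 \<Rightarrow> complex"
  is "\<lambda>f g. \<Sum>\<^sub>\<infinity>i. cinner (f i) (g i)" .
definition uminus_ell2 :: "('a, 'b) ell2 \<Rightarrow> ('a, 'b) ell2"
  where "uminus_ell2 f = (-1) *\<^sub>C f"
definition minus_ell2 :: "('a, 'b) ell2 \<Rightarrow> ('a, 'b) ell2 \<Rightarrow> ('a, 'b) ell2"
  where "minus_ell2 f g = f + (- g)"
definition scaleR_ell2 :: "real \<Rightarrow> ('a, 'b) ell2 \<Rightarrow> ('a, 'b) ell2"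
  where "scaleR_ell2 r f = complex_of_real r *\<^sub>C f"
definition inner_ell2 :: "('a, 'b) ell2 \<Rightarrow> ('a, 'b) ell2 \<Rightarrow> real"
  where "inner_ell2 f g = Re (cinner f g)"
definition norm_ell2 :: "('a, 'b) ell2 \<Rightarrow> real"
  where "norm_ell2 f = sqrt (inner f f)"
definition sgn_ell2 :: "('a, 'b) ell2 \<Rightarrow> ('a, 'b) ell2"
  where "sgn_ell2 f = inverse (norm f) *\<^sub>R f"
definition dist_ell2 :: "('a, 'b) ell2 \<Rightarrow> ('a, 'b) ell2 \<Rightarrow> real"
  where "dist_ell2 f g = norm (f - g)"
definition uniformity_ell2 :: "(('a, 'b) ell2 \<times> ('a, 'b) ell2) filter"
  where "uniformity_ell2 = (INF e\<in>{0 <..}. principal {(x, y). dist x y < e})"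
definition open_ell2 :: "('a, 'b) ell2 set \<Rightarrow> bool"
  where "open_ell2 U \<longleftrightarrow> (\<forall>x\<in>U. \<forall>\<^sub>F (x', y) in uniformity. x' = x \<longrightarrow> y \<in> U)"

instance
proof
  fix x y z :: "('a, 'b) ell2" and c d :: complex and a b r s :: real and U :: "('a, 'b) ell2 set"
  show "x + y + z = x + (y + z)" by transfer (simp add: add.assoc)
  show comm: "x + y = y + x" for x y :: "('a, 'b) ell2" by transfer (simp add: add.commute)
  show "0 + x = x" by transfer simp
  have neg: "x + (- x) = 0" for x :: "('a, 'b) ell2"
    unfolding uminus_ell2_def by transfer (simp add: cvec.scale_minus_left)
  then show "- x + x = 0" using comm by metis
  show "x - y = x + - y" by (simp add: minus_ell2_def)
  show scr: "c *\<^sub>C (x + y) = c *\<^sub>C x + c *\<^sub>C y" for c by transfer (simp add: scaleC_add_right)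
  show scl: "(c + d) *\<^sub>C x = c *\<^sub>C x + d *\<^sub>C x" for c d by transfer (simp add: scaleC_add_left)
  show scc: "c *\<^sub>C d *\<^sub>C x = (c * d) *\<^sub>C x" for c d by transfer (simp add: scaleC_scaleC)
  show "complex_of_real r *\<^sub>C x = r *\<^sub>R x" by (simp add: scaleR_ell2_def)
  show "a *\<^sub>R (x + y) = a *\<^sub>R x + a *\<^sub>R y" by (simp add: scaleR_ell2_def scr)
  show "(a + b) *\<^sub>R x = a *\<^sub>R x + b *\<^sub>R x" by (simp add: scaleR_ell2_def scl)
  show "a *\<^sub>R b *\<^sub>R x = (a * b) *\<^sub>R x" by (simp add: scaleR_ell2_def scc)
  show "1 *\<^sub>R x = x" unfolding scaleR_ell2_def by transfer simp
  show cc: "cinner x y = cnj (cinner y x)" for x y :: "('a, 'b) ell2"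
    apply transfer
    apply (subst infsum_cnj[symmetric])
    apply (rule infsum_cong)
    apply (rule cinner_commute)
    done
  show ca: "cinner x (y + z) = cinner x y + cinner x z" for x y z :: "('a, 'b) ell2"
    by transfer (simp add: cinner_add_right infsum_add ell2_cinner_summable)
  show cs: "cinner x (c *\<^sub>C y) = c * cinner x y" for x y :: "('a, 'b) ell2" and c
    by transfer (simp add: cinner_scaleC_right infsum_cmult_right')
  show "Re (cinner x y) = inner x y" by (simp add: inner_ell2_def)
  show "inner x y = inner y x" unfolding inner_ell2_def by (subst cc) simp
  show "inner (x + y) z = inner x z + inner y z"
    unfolding inner_ell2_def by (subst (1 2 3) cc) (simp add: ca)
  show "inner (r *\<^sub>R x) y = r * inner x y"
    unfolding inner_ell2_def scaleR_ell2_def by (subst (1 2) cc) (simp add: cs)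
  have self: "\<exists>f. ell2_nth x = f \<and> (\<lambda>i. (norm (f i))\<^sup>2) summable_on UNIV
      \<and> inner x x = (\<Sum>\<^sub>\<infinity>i. (norm (f i))\<^sup>2)"
    unfolding inner_ell2_def
    by transfer (use ell2_cinner_self in blast)
  show "0 \<le> inner x x" using self by (auto intro: infsum_nonneg)
  show "inner x x = 0 \<longleftrightarrow> x = 0"
  proof
    assume "inner x x = 0"
    with self have "(norm (ell2_nth x i))\<^sup>2 = 0" for i
      using nonneg_infsum_le_0D[of "\<lambda>i. (norm (ell2_nth x i))\<^sup>2" UNIV i] by auto
    then show "x = 0" by transfer (simp add: fun_eq_iff)
  next
    assume "x = 0" then show "inner x x = 0" unfolding inner_ell2_def by (auto simp: zero_ell2.rep_eq cinner_ell2.rep_eq)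
  qed
  show "norm x = sqrt (inner x x)" by (simp add: norm_ell2_def)
  show "sgn x = inverse (norm x) *\<^sub>R x" by (simp add: sgn_ell2_def)
  show "dist x y = norm (x - y)" by (simp add: dist_ell2_def)
  show "uniformity = (INF e\<in>{0 <..}. principal {(x, y :: ('a, 'b) ell2). dist x y < e})"
    by (simp add: uniformity_ell2_def)
  show "open U \<longleftrightarrow> (\<forall>x\<in>U. \<forall>\<^sub>F (x', y) in uniformity. x' = x \<longrightarrow> y \<in> U)"
    by (simp add: open_ell2_def)
qed

end

lemma ell2_nth_summable: "(\<lambda>i. (norm (ell2_nth f i))\<^sup>2) summable_on UNIV"
  using ell2_nth by blast

lemma ell2_nth_minus: "ell2_nth (f - g) i = ell2_nth f i - ell2_nth g i"
  unfolding minus_ell2_def uminus_ell2_def plus_ell2.rep_eq scaleC_ell2.rep_eq by simp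

lemma ell2_norm_power2: "(norm f)\<^sup>2 = (\<Sum>\<^sub>\<infinity>i. (norm (ell2_nth f i))\<^sup>2)"
proof -
  have "(norm f)\<^sup>2 = Re (cinner f f)" by (simp add: Re_cinner power2_norm_eq_inner)
  also have "\<dots> = (\<Sum>\<^sub>\<infinity>i. (norm (ell2_nth f i))\<^sup>2)"
    unfolding cinner_ell2.rep_eq by (rule ell2_cinner_self[OF ell2_nth_summable])
  finally show ?thesis .
qed

lemma ell2_sum_le_norm: "finite F \<Longrightarrow> (\<Sum>i\<in>F. (norm (ell2_nth f i))\<^sup>2) \<le> (norm f)\<^sup>2"
  unfolding ell2_norm_power2 by (rule finite_sum_le_infsum[OF ell2_nth_summable]) auto

lemma ell2_nth_norm_le: "norm (ell2_nth f i) \<le> norm f"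
proof (rule power2_le_imp_le)
  show "(norm (ell2_nth f i))\<^sup>2 \<le> (norm f)\<^sup>2" using ell2_sum_le_norm[of "{i}" f] by simp
qed simp

instance ell2 :: (type, chilbert_space) chilbert_space
proof
  fix X :: "nat \<Rightarrow> ('a, 'b) ell2" assume X: "Cauchy X"
  have "Cauchy (\<lambda>n. ell2_nth (X n) i)" for i
    unfolding Cauchy_def
  proof (intro allI impI)
    fix e :: real assume "e > 0"
    with X obtain M where M: "\<And>m n. m \<ge> M \<Longrightarrow> n \<ge> M \<Longrightarrow> dist (X m) (X n) < e"
      unfolding Cauchy_def by blast
    have "dist (ell2_nth (X m) i) (ell2_nth (X n) i) \<le> dist (X m) (X n)" for m n
      unfolding dist_norm ell2_nth_minus[symmetric] by (rule ell2_nth_norm_le)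
    then show "\<exists>M. \<forall>m\<ge>M. \<forall>n\<ge>M. dist (ell2_nth (X m) i) (ell2_nth (X n) i) < e"
      using M order_le_less_trans by blast
  qed
  then have "\<forall>i. \<exists>l. (\<lambda>n. ell2_nth (X n) i) \<longlonglongrightarrow> l"
    using Cauchy_convergent convergent_def by blast
  then obtain g where g: "\<And>i. (\<lambda>n. ell2_nth (X n) i) \<longlonglongrightarrow> g i" by metis
  have close: "\<exists>M. \<forall>n\<ge>M. \<forall>F. finite F \<longrightarrow> (\<Sum>i\<in>F. (norm (ell2_nth (X n) i - g i))\<^sup>2) \<le> e\<^sup>2"
    if "e > 0" for e
  proof -
    from X that obtain M where M: "\<And>m n. m \<ge> M \<Longrightarrow> n \<ge> M \<Longrightarrow> dist (X m) (X n) < e"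
      unfolding Cauchy_def by blast
    have "(\<Sum>i\<in>F. (norm (ell2_nth (X n) i - g i))\<^sup>2) \<le> e\<^sup>2" if "n \<ge> M" "finite F" for n F
    proof (rule tendsto_upperbound)
      show "(\<lambda>m. \<Sum>i\<in>F. (norm (ell2_nth (X n) i - ell2_nth (X m) i))\<^sup>2)
          \<longlonglongrightarrow> (\<Sum>i\<in>F. (norm (ell2_nth (X n) i - g i))\<^sup>2)"
        by (intro tendsto_intros g)
      show "\<forall>\<^sub>F m in sequentially. (\<Sum>i\<in>F. (norm (ell2_nth (X n) i - ell2_nth (X m) i))\<^sup>2) \<le> e\<^sup>2"
      proof (rule eventually_sequentiallyI[of M])
        fix m assume "m \<ge> M"
        have "(\<Sum>i\<in>F. (norm (ell2_nth (X n) i - ell2_nth (X m) i))\<^sup>2) \<le> (norm (X n - X m))\<^sup>2"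
          unfolding ell2_nth_minus[symmetric] by (rule ell2_sum_le_norm[OF \<open>finite F\<close>])
        also have "\<dots> \<le> e\<^sup>2"
          using M[OF \<open>n \<ge> M\<close> \<open>m \<ge> M\<close>] by (intro power_mono) (auto simp: dist_norm)
        finally show "(\<Sum>i\<in>F. (norm (ell2_nth (X n) i - ell2_nth (X m) i))\<^sup>2) \<le> e\<^sup>2" .
      qed
    qed simp
    then show ?thesis by blast
  qed
  have diff_summable: "(\<lambda>i. (norm (ell2_nth (X n) i - g i))\<^sup>2) summable_on UNIV"
    if "\<forall>F. finite F \<longrightarrow> (\<Sum>i\<in>F. (norm (ell2_nth (X n) i - g i))\<^sup>2) \<le> e\<^sup>2" for n e
    by (rule nonneg_bdd_above_summable_on) (use that in \<open>auto intro!: bdd_aboveI2[where M="e\<^sup>2"]\<close>)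
  obtain M where "\<forall>F. finite F \<longrightarrow> (\<Sum>i\<in>F. (norm (ell2_nth (X M) i - g i))\<^sup>2) \<le> 1\<^sup>2"
    using close[of 1] by auto
  from ell2_add_closed[OF ell2_scaleC_closed[OF diff_summable[OF this], of "-1"] ell2_nth_summable[of "X M"]]
  have "(\<lambda>i. (norm (g i))\<^sup>2) summable_on UNIV" by (simp add: cvec.scale_minus_left)
  then obtain G where G: "ell2_nth G = g" using Abs_ell2_inverse by blast
  have "X \<longlonglongrightarrow> G"
  proof (rule metric_LIMSEQ_I)
    fix r :: real assume "r > 0"
    then obtain M where M: "\<forall>n\<ge>M. \<forall>F. finite F \<longrightarrow> (\<Sum>i\<in>F. (norm (ell2_nth (X n) i - g i))\<^sup>2) \<le> (r/2)\<^sup>2"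
      using close[of "r/2"] by auto
    have "dist (X n) G < r" if "n \<ge> M" for n
    proof -
      have "(norm (X n - G))\<^sup>2 \<le> (r/2)\<^sup>2"
        unfolding ell2_norm_power2 ell2_nth_minus G
        by (rule infsum_le_finite_sums[OF diff_summable[of n "r/2"]]) (use M that in auto)
      then have "norm (X n - G) \<le> r/2" using \<open>r > 0\<close> by (simp add: power2_le_iff_abs_le)
      then show ?thesis using \<open>r > 0\<close> by (simp add: dist_norm)
    qed
    then show "\<exists>M. \<forall>n\<ge>M. dist (X n) G < r" by blast
  qed
  then show "convergent X" by (auto simp: convergent_def)
qed

section \<open>Hilbert-Schmidt operators\<close>

definition hilbert_schmidt :: "('a::chilbert_space \<Rightarrow> 'b::chilbert_space) \<Rightarrow> bool"
  where "hilbert_schmidt T \<longleftrightarrow>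
    bounded_clinear T \<and> (\<exists>B. is_onb B \<and> (\<lambda>e. (norm (T e))\<^sup>2) summable_on B)"

lemma hilbert_schmidt_adj_summable:
  assumes T: "bounded_clinear T" and B: "is_onb B" and C: "is_onb C"
    and sum: "(\<lambda>e. (norm (T e))\<^sup>2) summable_on B"
  shows "(\<lambda>f. (norm (adj T f))\<^sup>2) summable_on C"
proof -
  let ?h = "\<lambda>e f. (cmod (cinner f (T e)))\<^sup>2"
  have "(\<lambda>(e, f). ?h e f) summable_on Sigma B (\<lambda>_. C)"
    by (rule summable_on_SigmaI[where g="\<lambda>e. (norm (T e))\<^sup>2"]) (use parseval[OF C] sum in auto)
  then have "(\<lambda>(f, e). ?h e f) summable_on Sigma C (\<lambda>_. B)"
    by (subst (asm) summable_on_swap) simp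
  then have "(\<lambda>f. \<Sum>\<^sub>\<infinity>e\<in>B. ?h e f) summable_on C"
    using summable_on_Sigma_banach[of "\<lambda>f e. ?h e f" C "\<lambda>_. B"] by simp
  moreover have "(\<Sum>\<^sub>\<infinity>e\<in>B. ?h e f) = (norm (adj T f))\<^sup>2" for f
  proof -
    have "?h e f = (cmod (cinner e (adj T f)))\<^sup>2" for e
      by (metis T cinner_adj_left cinner_commute complex_mod_cnj)
    then show ?thesis using parseval[OF B, of "adj T f"] by (simp add: infsumI)
  qed
  ultimately show ?thesis by simp
qed

lemma hilbert_schmidt_summable:
  assumes "hilbert_schmidt T" "is_onb C"
  shows "(\<lambda>e. (norm (T e))\<^sup>2) summable_on C"
proof -
  obtain B where B: "is_onb B" "(\<lambda>e. (norm (T e))\<^sup>2) summable_on B" and T: "bounded_clinear T"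
    using assms(1) unfolding hilbert_schmidt_def by blast
  have "(\<lambda>f. (norm (adj T f))\<^sup>2) summable_on some_onb"
    by (rule hilbert_schmidt_adj_summable[OF T B(1) some_onb_is_onb B(2)])
  from hilbert_schmidt_adj_summable[OF adj_bounded_clinear[OF T] some_onb_is_onb assms(2) this]
  show ?thesis by (simp add: adj_adj[OF T])
qed

lemma hilbert_schmidt_bounded_clinear: "hilbert_schmidt T \<Longrightarrow> bounded_clinear T"
  by (simp add: hilbert_schmidt_def)

lemma hilbert_schmidtI:
  "bounded_clinear T \<Longrightarrow> (\<lambda>e. (norm (T e))\<^sup>2) summable_on some_onb \<Longrightarrow> hilbert_schmidt T"
  unfolding hilbert_schmidt_def using some_onb_is_onb by blast

lemma hilbert_schmidt_zero: "hilbert_schmidt (\<lambda>_. 0)"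
  by (rule hilbert_schmidtI, rule bounded_clinear_intro[where K=0]) auto

lemma bounded_clinear_plus:
  assumes "bounded_clinear S" "bounded_clinear T"
  shows "bounded_clinear (\<lambda>x. S x + T x)"
  using assms unfolding bounded_clinear_def by (auto intro: bounded_linear_add simp: scaleC_add_right)

lemma bounded_clinear_scale:
  assumes "bounded_clinear T"
  shows "bounded_clinear (\<lambda>x. c *\<^sub>C T x)"
  using assms unfolding bounded_clinear_def
  by (auto intro: bounded_linear_compose[OF bounded_linear_scaleC_right] simp: scaleC_scaleC mult.commute)

lemma hilbert_schmidt_add:
  assumes "hilbert_schmidt S" "hilbert_schmidt T"
  shows "hilbert_schmidt (\<lambda>x. S x + T x)"
  by (rule hilbert_schmidtI[OF
        bounded_clinear_plus[OF assms[THEN hilbert_schmidt_bounded_clinear]]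
        ell2_add_closed[OF assms[THEN hilbert_schmidt_summable[OF _ some_onb_is_onb]]]])

lemma hilbert_schmidt_scaleC:
  assumes "hilbert_schmidt T"
  shows "hilbert_schmidt (\<lambda>x. c *\<^sub>C T x)"
  by (rule hilbert_schmidtI[OF
        bounded_clinear_scale[OF hilbert_schmidt_bounded_clinear[OF assms]]
        ell2_scaleC_closed[OF hilbert_schmidt_summable[OF assms some_onb_is_onb]]])

lemma bounded_clinear_eq_on_onb:
  assumes T: "bounded_clinear T" and B: "is_onb B" and 0: "\<And>e. e \<in> B \<Longrightarrow> T e = 0"
  shows "T x = 0"
proof -
  have "((\<lambda>e. T (cinner e x *\<^sub>C e)) has_sum T x) B"
    by (rule has_sum_bounded_linear[OF bounded_clinear_bounded_linear[OF T] onb_has_sum[OF B]])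
  moreover have "((\<lambda>e. T (cinner e x *\<^sub>C e)) has_sum 0) B"
    using 0 by (intro has_sum_0) (simp add: bounded_clinear_scaleC[OF T])
  ultimately show ?thesis by (rule has_sum_unique)
qed

typedef (overloaded) ('a, 'b) hs = "{T :: 'a::chilbert_space \<Rightarrow> 'b::chilbert_space. hilbert_schmidt T}"
  morphisms hs_apply Abs_hs
  using hilbert_schmidt_zero by blast

setup_lifting type_definition_hs

text \<open>The family of values on an orthonormal basis embeds the Hilbert-Schmidt operators
  isometrically into a space of square-summable families.\<close>

definition hs_values :: "('a::chilbert_space \<Rightarrow> 'b::chilbert_space) \<Rightarrow> ('a, 'b) ell2"
  where "hs_values T = Abs_ell2 (\<lambda>e. if e \<in> some_onb then T e else 0)"

lemma ell2_nth_hs_values: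
  assumes "hilbert_schmidt T"
  shows "ell2_nth (hs_values T) e = (if e \<in> some_onb then T e else 0)"
proof -
  have "(\<lambda>e. (norm (if e \<in> some_onb then T e else 0))\<^sup>2) summable_on UNIV"
    using hilbert_schmidt_summable[OF assms some_onb_is_onb]
    by (subst summable_on_cong_neutral[where T=some_onb and g="\<lambda>e. (norm (T e))\<^sup>2"]) auto
  then show ?thesis unfolding hs_values_def by (simp add: Abs_ell2_inverse)
qed

lemma trace_adj_comp:
  assumes "hilbert_schmidt S" "hilbert_schmidt T"
  shows "trace (adj S \<circ> T) = cinner (hs_values S) (hs_values T)"
  unfolding trace_def cinner_ell2.rep_eq
  by (rule infsum_cong_neutral)
    (auto simp: ell2_nth_hs_values assms cinner_adj_right hilbert_schmidt_bounded_clinear)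

lemma hs_values_add:
  assumes "hilbert_schmidt S" "hilbert_schmidt T"
  shows "hs_values (\<lambda>x. S x + T x) = hs_values S + hs_values T"
  by (rule ell2_nth_inject[THEN iffD1])
    (auto simp: fun_eq_iff plus_ell2.rep_eq ell2_nth_hs_values assms hilbert_schmidt_add)

lemma hs_values_scaleC:
  assumes "hilbert_schmidt T"
  shows "hs_values (\<lambda>x. c *\<^sub>C T x) = c *\<^sub>C hs_values T"
  by (rule ell2_nth_inject[THEN iffD1])
    (auto simp: fun_eq_iff scaleC_ell2.rep_eq ell2_nth_hs_values assms hilbert_schmidt_scaleC)

lemma hs_values_eq_0:
  assumes T: "hilbert_schmidt T" and 0: "hs_values T = 0"
  shows "T = (\<lambda>_. 0)"
proof
  fix x
  have "T e = 0" if "e \<in> some_onb" for e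
    using ell2_nth_hs_values[OF T, of e] that 0 by (simp add: zero_ell2.rep_eq)
  then show "T x = 0"
    by (rule bounded_clinear_eq_on_onb[OF hilbert_schmidt_bounded_clinear[OF T] some_onb_is_onb])
qed

instantiation hs :: (chilbert_space, chilbert_space) complex_inner
begin

lift_definition zero_hs :: "('a, 'b) hs" is "\<lambda>_. 0" by (rule hilbert_schmidt_zero)
lift_definition plus_hs :: "('a, 'b) hs \<Rightarrow> ('a, 'b) hs \<Rightarrow> ('a, 'b) hs" is "\<lambda>S T x. S x + T x"
  by (rule hilbert_schmidt_add)
lift_definition scaleC_hs :: "complex \<Rightarrow> ('a, 'b) hs \<Rightarrow> ('a, 'b) hs" is "\<lambda>c T x. c *\<^sub>C T x"
  by (rule hilbert_schmidt_scaleC)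
lift_definition cinner_hs :: "('a, 'b) hs \<Rightarrow> ('a, 'b) hs \<Rightarrow> complex"
  is "\<lambda>S T. trace (adj S \<circ> T)" .
definition uminus_hs :: "('a, 'b) hs \<Rightarrow> ('a, 'b) hs"
  where "uminus_hs T = (-1) *\<^sub>C T"
definition minus_hs :: "('a, 'b) hs \<Rightarrow> ('a, 'b) hs \<Rightarrow> ('a, 'b) hs"
  where "minus_hs S T = S + (- T)"
definition scaleR_hs :: "real \<Rightarrow> ('a, 'b) hs \<Rightarrow> ('a, 'b) hs"
  where "scaleR_hs r T = complex_of_real r *\<^sub>C T"
definition inner_hs :: "('a, 'b) hs \<Rightarrow> ('a, 'b) hs \<Rightarrow> real"
  where "inner_hs S T = Re (cinner S T)"
definition norm_hs :: "('a, 'b) hs \<Rightarrow> real"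
  where "norm_hs T = sqrt (inner T T)"
definition sgn_hs :: "('a, 'b) hs \<Rightarrow> ('a, 'b) hs"
  where "sgn_hs T = inverse (norm T) *\<^sub>R T"
definition dist_hs :: "('a, 'b) hs \<Rightarrow> ('a, 'b) hs \<Rightarrow> real"
  where "dist_hs S T = norm (S - T)"
definition uniformity_hs :: "(('a, 'b) hs \<times> ('a, 'b) hs) filter"
  where "uniformity_hs = (INF e\<in>{0 <..}. principal {(x, y). dist x y < e})"
definition open_hs :: "('a, 'b) hs set \<Rightarrow> bool"
  where "open_hs U \<longleftrightarrow> (\<forall>x\<in>U. \<forall>\<^sub>F (x', y) in uniformity. x' = x \<longrightarrow> y \<in> U)"

instance
proof
  fix x y z :: "('a, 'b) hs" and c d :: complex and a b r s :: real and U :: "('a, 'b) hs set"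
  show "x + y + z = x + (y + z)" by transfer (simp add: add.assoc)
  show comm: "x + y = y + x" for x y :: "('a, 'b) hs" by transfer (simp add: add.commute)
  show "0 + x = x" by transfer simp
  have neg: "x + (- x) = 0" for x :: "('a, 'b) hs"
    unfolding uminus_hs_def by transfer (simp add: cvec.scale_minus_left)
  then show "- x + x = 0" using comm by metis
  show "x - y = x + - y" by (simp add: minus_hs_def)
  show scr: "c *\<^sub>C (x + y) = c *\<^sub>C x + c *\<^sub>C y" for c by transfer (simp add: scaleC_add_right)
  show scl: "(c + d) *\<^sub>C x = c *\<^sub>C x + d *\<^sub>C x" for c d by transfer (simp add: scaleC_add_left)
  show scc: "c *\<^sub>C d *\<^sub>C x = (c * d) *\<^sub>C x" for c d by transfer (simp add: scaleC_scaleC)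
  show "complex_of_real r *\<^sub>C x = r *\<^sub>R x" by (simp add: scaleR_hs_def)
  show "a *\<^sub>R (x + y) = a *\<^sub>R x + a *\<^sub>R y" by (simp add: scaleR_hs_def scr)
  show "(a + b) *\<^sub>R x = a *\<^sub>R x + b *\<^sub>R x" by (simp add: scaleR_hs_def scl)
  show "a *\<^sub>R b *\<^sub>R x = (a * b) *\<^sub>R x" by (simp add: scaleR_hs_def scc)
  show "1 *\<^sub>R x = x" unfolding scaleR_hs_def by transfer simp
  have emb: "cinner x y = cinner (hs_values (hs_apply x)) (hs_values (hs_apply y))"
    for x y :: "('a, 'b) hs" by transfer (rule trace_adj_comp)
  show cc: "cinner x y = cnj (cinner y x)" for x y :: "('a, 'b) hs"
    unfolding emb by (rule cinner_commute)
  show ca: "cinner x (y + z) = cinner x y + cinner x z" for x y z :: "('a, 'b) hs"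
    unfolding emb by transfer (simp only: hs_values_add cinner_add_right)
  show cs: "cinner x (c *\<^sub>C y) = c * cinner x y" for x y :: "('a, 'b) hs" and c
    unfolding emb by transfer (simp only: hs_values_scaleC cinner_scaleC_right)
  show "Re (cinner x y) = inner x y" by (simp add: inner_hs_def)
  show "inner x y = inner y x" unfolding inner_hs_def by (subst cc) simp
  show "inner (x + y) z = inner x z + inner y z"
    unfolding inner_hs_def by (subst (1 2 3) cc) (simp add: ca)
  show "inner (r *\<^sub>R x) y = r * inner x y"
    unfolding inner_hs_def scaleR_hs_def by (subst (1 2) cc) (simp add: cs)
  have self: "inner x x = inner (hs_values (hs_apply x)) (hs_values (hs_apply x))"
    unfolding inner_hs_def emb by (rule Re_cinner)
  show "0 \<le> inner x x" unfolding self by simp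
  show "inner x x = 0 \<longleftrightarrow> x = 0"
  proof
    assume "inner x x = 0"
    then have "hs_values (hs_apply x) = 0" unfolding self by simp
    then show "x = 0" by transfer (rule hs_values_eq_0)
  next
    assume x: "x = 0"
    have "hs_values (hs_apply x) = hs_values (hs_apply x) + hs_values (hs_apply x)"
      unfolding x by transfer (simp add: hs_values_add[OF hilbert_schmidt_zero hilbert_schmidt_zero, symmetric])
    then show "inner x x = 0" unfolding self by simp
  qed
  show "norm x = sqrt (inner x x)" by (simp add: norm_hs_def)
  show "sgn x = inverse (norm x) *\<^sub>R x" by (simp add: sgn_hs_def)
  show "dist x y = norm (x - y)" by (simp add: dist_hs_def)
  show "uniformity = (INF e\<in>{0 <..}. principal {(x, y :: ('a, 'b) hs). dist x y < e})"
    by (simp add: uniformity_hs_def)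
  show "open U \<longleftrightarrow> (\<forall>x\<in>U. \<forall>\<^sub>F (x', y) in uniformity. x' = x \<longrightarrow> y \<in> U)"
    by (simp add: open_hs_def)
qed

end

lemma hs_apply_bounded_clinear: "bounded_clinear (hs_apply T)"
  using hs_apply[of T] by (simp add: hilbert_schmidt_bounded_clinear)

lemma hs_apply_minus: "hs_apply (S - T) x = hs_apply S x - hs_apply T x"
  unfolding minus_hs_def uminus_hs_def plus_hs.rep_eq scaleC_hs.rep_eq by simp

lemma hs_norm_values: "norm T = norm (hs_values (hs_apply T))"
proof -
  have "cinner T T = cinner (hs_values (hs_apply T)) (hs_values (hs_apply T))"
    by transfer (rule trace_adj_comp)
  then have "inner T T = inner (hs_values (hs_apply T)) (hs_values (hs_apply T))"
    by (metis Re_cinner)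
  then show ?thesis by (simp add: norm_eq_sqrt_inner)
qed

lemma hs_values_minus:
  "hs_values (hs_apply (S - T)) = hs_values (hs_apply S) - hs_values (hs_apply T)"
proof -
  have hs: "hilbert_schmidt (hs_apply U)" for U :: "('a, 'b) hs" using hs_apply[of U] by simp
  show ?thesis
    by (rule ell2_nth_inject[THEN iffD1])
      (auto simp: fun_eq_iff ell2_nth_minus ell2_nth_hs_values hs hs_apply_minus)
qed

lemma hs_norm_le:
  fixes T :: "('a::chilbert_space, 'b::chilbert_space) hs"
  shows "norm (hs_apply T x) \<le> norm T * norm x"
proof -
  let ?T = "hs_apply T"
  let ?B = "some_onb :: 'a set"
  have hs: "hilbert_schmidt ?T" using hs_apply[of T] by simp
  have bc: "bounded_clinear ?T" by (rule hs_apply_bounded_clinear)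
  have ortho: "orthonormal ?B" using some_onb_is_onb[where 'a='a] by (simp add: is_onb_def)
  have "((\<lambda>e. ?T (cinner e x *\<^sub>C e)) has_sum ?T x) ?B"
    by (rule has_sum_bounded_linear[OF bounded_clinear_bounded_linear[OF bc] onb_has_sum[OF some_onb_is_onb]])
  then have lim: "((\<lambda>F. norm (\<Sum>e\<in>F. ?T (cinner e x *\<^sub>C e))) \<longlongrightarrow> norm (?T x)) (finite_subsets_at_top ?B)"
    unfolding has_sum_def by (rule tendsto_norm)
  have bound: "norm (\<Sum>e\<in>F. ?T (cinner e x *\<^sub>C e)) \<le> norm T * norm x" if F: "finite F" "F \<subseteq> ?B" for F
  proof -
    have "norm (\<Sum>e\<in>F. ?T (cinner e x *\<^sub>C e)) \<le> (\<Sum>e\<in>F. \<bar>norm (?T e)\<bar> * \<bar>cmod (cinner e x)\<bar>)"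
      by (rule sum_norm_le) (simp add: bounded_clinear_scaleC[OF bc] norm_scaleC)
    also have "\<dots> \<le> L2_set (\<lambda>e. norm (?T e)) F * L2_set (\<lambda>e. cmod (cinner e x)) F"
      by (rule L2_set_mult_ineq)
    also have "\<dots> \<le> norm T * norm x"
    proof (rule mult_mono)
      have "(\<Sum>e\<in>F. (norm (?T e))\<^sup>2) = (\<Sum>e\<in>F. (norm (ell2_nth (hs_values ?T) e))\<^sup>2)"
        by (rule sum.cong) (use F in \<open>auto simp: ell2_nth_hs_values[OF hs]\<close>)
      also have "\<dots> \<le> (norm T)\<^sup>2"
        unfolding hs_norm_values by (rule ell2_sum_le_norm[OF F(1)])
      finally show "L2_set (\<lambda>e. norm (?T e)) F \<le> norm T"
        unfolding L2_set_def by (rule real_le_lsqrt[rotated]) simp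
      show "L2_set (\<lambda>e. cmod (cinner e x)) F \<le> norm x"
        unfolding L2_set_def by (rule real_le_lsqrt[OF _ bessel[OF ortho F]]) simp
    qed (auto intro: L2_set_nonneg)
    finally show ?thesis .
  qed
  show ?thesis
    by (rule tendsto_upperbound[OF lim])
      (auto intro!: eventually_finite_subsets_at_top_weakI bound)
qed

instance hs :: (chilbert_space, chilbert_space) chilbert_space
proof
  fix X :: "nat \<Rightarrow> ('a, 'b) hs" assume X: "Cauchy X"
  define Y where "Y n = hs_values (hs_apply (X n))" for n
  have dY: "dist (Y m) (Y n) = dist (X m) (X n)" for m n
    unfolding Y_def dist_norm hs_values_minus[symmetric] hs_norm_values ..
  have "Cauchy Y" using X unfolding Cauchy_def dY .
  then obtain g where g: "Y \<longlonglongrightarrow> g" using Cauchy_convergent convergent_def by blast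
  have dist_le: "dist (hs_apply (X m) x) (hs_apply (X n) x) \<le> dist (X m) (X n) * norm x" for m n x
    unfolding dist_norm hs_apply_minus[symmetric] by (rule hs_norm_le)
  have "Cauchy (\<lambda>n. hs_apply (X n) x)" for x
    unfolding Cauchy_def
  proof (intro allI impI)
    fix e :: real assume e: "e > 0"
    then have "e / (norm x + 1) > 0" by (simp add: add_nonneg_pos)
    then obtain M where M: "\<And>m n. m \<ge> M \<Longrightarrow> n \<ge> M \<Longrightarrow> dist (X m) (X n) < e / (norm x + 1)"
      using X unfolding Cauchy_def by blast
    have "dist (hs_apply (X m) x) (hs_apply (X n) x) < e" if "m \<ge> M" "n \<ge> M" for m n
    proof -
      have "dist (X m) (X n) * norm x \<le> dist (X m) (X n) * (norm x + 1)"
        by (intro mult_left_mono) auto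
      also have "\<dots> < e"
        using M[OF that] by (simp add: pos_less_divide_eq add_nonneg_pos)
      finally show ?thesis using dist_le[of m x n] by linarith
    qed
    then show "\<exists>M. \<forall>m\<ge>M. \<forall>n\<ge>M. dist (hs_apply (X m) x) (hs_apply (X n) x) < e" by blast
  qed
  then have "\<forall>x. \<exists>l. (\<lambda>n. hs_apply (X n) x) \<longlonglongrightarrow> l"
    using Cauchy_convergent convergent_def by blast
  then obtain T where T: "\<And>x. (\<lambda>n. hs_apply (X n) x) \<longlonglongrightarrow> T x" by metis
  obtain K where K: "\<And>n. norm (X n) \<le> K"
    using cauchy_imp_bounded[OF X] by (auto simp: bounded_iff)
  have bc: "bounded_clinear T"
  proof (rule bounded_clinear_intro[where K=K])
    show "T (x + y) = T x + T y" for x y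
      by (rule LIMSEQ_unique[OF T]) (simp add: bounded_clinear_add[OF hs_apply_bounded_clinear] tendsto_add T)
    show "T (c *\<^sub>C x) = c *\<^sub>C T x" for c x
      by (rule LIMSEQ_unique[OF T])
        (simp add: bounded_clinear_scaleC[OF hs_apply_bounded_clinear]
          bounded_linear.tendsto[OF bounded_linear_scaleC_right] T)
    show "norm (T x) \<le> norm x * K" for x
    proof (rule tendsto_upperbound[OF tendsto_norm[OF T]])
      have "norm (hs_apply (X n) x) \<le> norm x * K" for n
        using hs_norm_le[of "X n" x] mult_right_mono[OF K[of n] norm_ge_zero[of x]]
        by (simp add: mult.commute)
      then show "\<forall>\<^sub>F n in sequentially. norm (hs_apply (X n) x) \<le> norm x * K" by simp
    qed simp
  qed
  have hsX: "hilbert_schmidt (hs_apply (X n))" for n using hs_apply[of "X n"] by simp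
  have gT: "ell2_nth g e = (if e \<in> some_onb then T e else 0)" for e
  proof -
    have "(\<lambda>n. ell2_nth (Y n) e) \<longlonglongrightarrow> ell2_nth g e"
    proof (rule metric_LIMSEQ_I)
      fix r :: real assume "r > 0"
      then obtain M where M: "\<And>n. n \<ge> M \<Longrightarrow> dist (Y n) g < r"
        using metric_LIMSEQ_D[OF g] by blast
      have "dist (ell2_nth (Y n) e) (ell2_nth g e) \<le> dist (Y n) g" for n
        unfolding dist_norm ell2_nth_minus[symmetric] by (rule ell2_nth_norm_le)
      then show "\<exists>M. \<forall>n\<ge>M. dist (ell2_nth (Y n) e) (ell2_nth g e) < r"
        using M order_le_less_trans by blast
    qed
    moreover have "(\<lambda>n. ell2_nth (Y n) e) \<longlonglongrightarrow> (if e \<in> some_onb then T e else 0)"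
      unfolding Y_def ell2_nth_hs_values[OF hsX] using T by simp
    ultimately show ?thesis by (rule LIMSEQ_unique)
  qed
  have "(\<lambda>e. (norm (ell2_nth g e))\<^sup>2) summable_on some_onb"
    by (rule summable_on_subset_banach[OF ell2_nth_summable]) simp
  moreover have "(\<lambda>e. (norm (ell2_nth g e))\<^sup>2) summable_on some_onb
      \<longleftrightarrow> (\<lambda>e. (norm (T e))\<^sup>2) summable_on some_onb"
    by (rule summable_on_cong) (simp add: gT)
  ultimately have "(\<lambda>e. (norm (T e))\<^sup>2) summable_on some_onb" by simp
  then have hsT: "hilbert_schmidt T" using bc by (intro hilbert_schmidtI)
  define L where "L = Abs_hs T"
  have L: "hs_apply L = T" unfolding L_def using hsT by (simp add: Abs_hs_inverse)
  have "hs_values (hs_apply L) = g"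
    by (rule ell2_nth_inject[THEN iffD1]) (auto simp: fun_eq_iff L ell2_nth_hs_values[OF hsT] gT)
  then have "dist (X n) L = dist (Y n) g" for n
    unfolding Y_def dist_norm hs_norm_values[of "_ - _"] hs_values_minus by simp
  then have "X \<longlonglongrightarrow> L"
    using g by (simp add: tendsto_iff)
  then show "convergent X" by (auto simp: convergent_def)
qed

section \<open>The dual space\<close>

text \<open>By the Riesz representation theorem the bounded functionals are exactly the bras.\<close>

typedef (overloaded) 'a dual = "range (cinner :: 'a::chilbert_space \<Rightarrow> 'a \<Rightarrow> complex)"
  morphisms dual_apply Abs_dual
  by blast

setup_lifting type_definition_dual

lift_definition bra :: "'a::chilbert_space \<Rightarrow> 'a dual" is "cinner" by simp

definition unbra :: "'a::chilbert_space dual \<Rightarrow> 'a"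
  where "unbra \<phi> = (THE x. bra x = \<phi>)"

lemma bra_inject: "bra x = bra y \<longleftrightarrow> x = y"
proof
  assume "bra x = bra y"
  then have "cinner x = cinner y" by transfer
  then have "cinner (x - y) (x - y) = 0" by (simp add: cinner_diff_left)
  then show "x = y" by (simp only: cinner_eq_zero_iff right_minus_eq)
qed simp

lemma unbra_bra [simp]: "unbra (bra x) = x"
  unfolding unbra_def by (simp add: bra_inject)

lemma bra_cases: obtains x where "\<phi> = bra x"
proof -
  have "\<exists>x. \<phi> = bra x" by transfer blast
  then show thesis using that by blast
qed

lemma bra_unbra [simp]: "bra (unbra \<phi>) = \<phi>"
  by (cases \<phi> rule: bra_cases) simp

instantiation dual :: (chilbert_space) complex_inner
begin

lift_definition zero_dual :: "'a dual" is "\<lambda>_. 0"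
  by (rule range_eqI[where x=0]) (simp add: fun_eq_iff)
lift_definition plus_dual :: "'a dual \<Rightarrow> 'a dual \<Rightarrow> 'a dual" is "\<lambda>\<phi> \<psi> x. \<phi> x + \<psi> x"
  by (auto simp: cinner_add_left[symmetric])
lift_definition scaleC_dual :: "complex \<Rightarrow> 'a dual \<Rightarrow> 'a dual" is "\<lambda>c \<phi> x. c * \<phi> x"
proof (elim rangeE)
  fix c x and \<phi> :: "'a \<Rightarrow> complex" assume "\<phi> = cinner x"
  then show "(\<lambda>x. c * \<phi> x) \<in> range cinner"
    by (intro range_eqI[where x="cnj c *\<^sub>C x"]) (simp add: fun_eq_iff cinner_scaleC_left)
qed
definition cinner_dual :: "'a dual \<Rightarrow> 'a dual \<Rightarrow> complex"
  where "cinner_dual \<phi> \<psi> = cinner (unbra \<psi>) (unbra \<phi>)"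
definition uminus_dual :: "'a dual \<Rightarrow> 'a dual"
  where "uminus_dual \<phi> = (-1) *\<^sub>C \<phi>"
definition minus_dual :: "'a dual \<Rightarrow> 'a dual \<Rightarrow> 'a dual"
  where "minus_dual \<phi> \<psi> = \<phi> + (- \<psi>)"
definition scaleR_dual :: "real \<Rightarrow> 'a dual \<Rightarrow> 'a dual"
  where "scaleR_dual r \<phi> = complex_of_real r *\<^sub>C \<phi>"
definition inner_dual :: "'a dual \<Rightarrow> 'a dual \<Rightarrow> real"
  where "inner_dual \<phi> \<psi> = Re (cinner \<phi> \<psi>)"
definition norm_dual :: "'a dual \<Rightarrow> real"
  where "norm_dual \<phi> = sqrt (inner \<phi> \<phi>)"
definition sgn_dual :: "'a dual \<Rightarrow> 'a dual"
  where "sgn_dual \<phi> = inverse (norm \<phi>) *\<^sub>R \<phi>"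
definition dist_dual :: "'a dual \<Rightarrow> 'a dual \<Rightarrow> real"
  where "dist_dual \<phi> \<psi> = norm (\<phi> - \<psi>)"
definition uniformity_dual :: "('a dual \<times> 'a dual) filter"
  where "uniformity_dual = (INF e\<in>{0 <..}. principal {(x, y). dist x y < e})"
definition open_dual :: "'a dual set \<Rightarrow> bool"
  where "open_dual U \<longleftrightarrow> (\<forall>x\<in>U. \<forall>\<^sub>F (x', y) in uniformity. x' = x \<longrightarrow> y \<in> U)"

lemma bra_add: "bra (x + y) = bra x + bra y"
  by transfer (simp add: fun_eq_iff cinner_add_left)

lemma bra_scaleC: "bra (c *\<^sub>C x) = cnj c *\<^sub>C bra x"
  by transfer (simp add: fun_eq_iff cinner_scaleC_left)

lemma bra_zero: "bra 0 = 0"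
  by transfer (simp add: fun_eq_iff)

instance
proof
  fix x y z :: "'a dual" and c d :: complex and a b r s :: real and U :: "'a dual set"
  show "x + y + z = x + (y + z)" by transfer (simp add: add.assoc)
  show comm: "x + y = y + x" for x y :: "'a dual" by transfer (simp add: add.commute)
  show "0 + x = x" by transfer simp
  have neg: "x + (- x) = 0" for x :: "'a dual"
    unfolding uminus_dual_def by transfer simp
  then show "- x + x = 0" using comm by metis
  show "x - y = x + - y" by (simp add: minus_dual_def)
  show scr: "c *\<^sub>C (x + y) = c *\<^sub>C x + c *\<^sub>C y" for c by transfer (simp add: distrib_left)
  show scl: "(c + d) *\<^sub>C x = c *\<^sub>C x + d *\<^sub>C x" for c d by transfer (simp add: distrib_right)
  show scc: "c *\<^sub>C d *\<^sub>C x = (c * d) *\<^sub>C x" for c d by transfer (simp add: mult.assoc)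
  show "complex_of_real r *\<^sub>C x = r *\<^sub>R x" by (simp add: scaleR_dual_def)
  show "a *\<^sub>R (x + y) = a *\<^sub>R x + a *\<^sub>R y" by (simp add: scaleR_dual_def scr)
  show "(a + b) *\<^sub>R x = a *\<^sub>R x + b *\<^sub>R x" by (simp add: scaleR_dual_def scl)
  show "a *\<^sub>R b *\<^sub>R x = (a * b) *\<^sub>R x" by (simp add: scaleR_dual_def scc)
  show "1 *\<^sub>R x = x" unfolding scaleR_dual_def by transfer simp
  have ua: "unbra (x + y) = unbra x + unbra y" for x y :: "'a dual"
    by (cases x rule: bra_cases, cases y rule: bra_cases) (simp flip: bra_add)
  have us: "unbra (c *\<^sub>C x) = cnj c *\<^sub>C unbra x" for x :: "'a dual" and c
    by (cases x rule: bra_cases) (metis bra_scaleC complex_cnj_cnj unbra_bra)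
  show cc: "cinner x y = cnj (cinner y x)" for x y :: "'a dual"
    unfolding cinner_dual_def by (rule cinner_commute)
  show ca: "cinner x (y + z) = cinner x y + cinner x z" for x y z :: "'a dual"
    unfolding cinner_dual_def by (simp only: ua cinner_add_left)
  show cs: "cinner x (c *\<^sub>C y) = c * cinner x y" for x y :: "'a dual" and c
    unfolding cinner_dual_def by (simp only: us cinner_scaleC_left complex_cnj_cnj)
  show "Re (cinner x y) = inner x y" by (simp add: inner_dual_def)
  show "inner x y = inner y x" unfolding inner_dual_def by (subst cc) simp
  show "inner (x + y) z = inner x z + inner y z"
    unfolding inner_dual_def by (subst (1 2 3) cc) (simp add: ca)
  show "inner (r *\<^sub>R x) y = r * inner x y"
    unfolding inner_dual_def scaleR_dual_def by (subst (1 2) cc) (simp add: cs)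
  have self: "inner x x = inner (unbra x) (unbra x)"
    unfolding inner_dual_def cinner_dual_def by (rule Re_cinner)
  show "0 \<le> inner x x" unfolding self by simp
  have "unbra x = 0 \<longleftrightarrow> x = 0" by (metis bra_unbra bra_zero unbra_bra)
  then show "inner x x = 0 \<longleftrightarrow> x = 0" unfolding self by simp
  show "norm x = sqrt (inner x x)" by (simp add: norm_dual_def)
  show "sgn x = inverse (norm x) *\<^sub>R x" by (simp add: sgn_dual_def)
  show "dist x y = norm (x - y)" by (simp add: dist_dual_def)
  show "uniformity = (INF e\<in>{0 <..}. principal {(x, y :: 'a dual). dist x y < e})"
    by (simp add: uniformity_dual_def)
  show "open U \<longleftrightarrow> (\<forall>x\<in>U. \<forall>\<^sub>F (x', y) in uniformity. x' = x \<longrightarrow> y \<in> U)"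
    by (simp add: open_dual_def)
qed

end

lemma cinner_bra [simp]: "cinner (bra y) (bra x) = cinner x y"
  by (simp add: cinner_dual_def)

lemma bra_minus: "bra (x - y) = bra x - bra y"
  using bra_add[of "x - y" y] by simp

lemma norm_bra [simp]: "norm (bra x) = norm x"
proof -
  have "inner (bra x) (bra x) = inner x x" by (metis Re_cinner cinner_bra)
  then show ?thesis by (simp add: norm_eq_sqrt_inner)
qed

instance dual :: (chilbert_space) chilbert_space
proof
  fix X :: "nat \<Rightarrow> 'a dual" assume X: "Cauchy X"
  have dist_bra: "dist (bra x) (bra y) = dist x y" for x y :: 'a
    by (simp add: dist_norm flip: bra_minus)
  then have dist_unbra: "dist (unbra \<phi>) (unbra \<psi>) = dist \<phi> \<psi>" for \<phi> \<psi> :: "'a dual"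
    by (metis bra_unbra)
  have "Cauchy (\<lambda>n. unbra (X n))" using X unfolding Cauchy_def dist_unbra .
  then obtain x where "(\<lambda>n. unbra (X n)) \<longlonglongrightarrow> x" using Cauchy_convergent convergent_def by blast
  then have "X \<longlonglongrightarrow> bra x"
    unfolding tendsto_iff by (metis (mono_tags, lifting) bra_unbra dist_bra eventually_mono)
  then show "convergent X" by (auto simp: convergent_def)
qed

lemma dual_apply_bra: "dual_apply (bra x) y = cinner x y"
  by (simp add: bra.rep_eq)

lemma dual_apply_cinner: "dual_apply \<phi> y = cinner (bra y) \<phi>"
  by (cases \<phi> rule: bra_cases) (simp add: dual_apply_bra)

section \<open>Tensor products\<close>

text \<open>The Hilbert space tensor product of \<open>H\<close> and \<open>K\<close> is realised as the space of
  Hilbert-Schmidt operators from the dual of \<open>K\<close> to \<open>H\<close>, where the elementary tensor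
  of \<open>x\<close> and \<open>y\<close> is the operator mapping \<open>\<phi>\<close> to \<open>\<phi>(y) x\<close>. The lemmas
  \<open>cinner_tensor\<close> and \<open>tensor_total\<close> below characterise this space up to a unique unitary.\<close>

type_synonym ('a, 'b) tensor = "('b dual, 'a) hs"

lift_definition tensor :: "'a::chilbert_space \<Rightarrow> 'b::chilbert_space \<Rightarrow> ('a, 'b) tensor"
    (infixr \<open>\<otimes>\<close> 70)
  is "\<lambda>x y \<phi>. dual_apply \<phi> y *\<^sub>C x"
proof (rule hilbert_schmidtI)
  fix x :: 'a and y :: 'b
  show "bounded_clinear (\<lambda>\<phi>. dual_apply \<phi> y *\<^sub>C x)"
    unfolding dual_apply_cinner
  proof (rule bounded_clinear_intro[where K="norm y * norm x"])
    show "norm (cinner (bra y) \<phi> *\<^sub>C x) \<le> norm \<phi> * (norm y * norm x)" for \<phi>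
      using mult_right_mono[OF cinner_bound[of "bra y" \<phi>] norm_ge_zero[of x]]
      by (simp add: norm_scaleC mult_ac)
  qed (simp_all add: cinner_add_right scaleC_add_left cinner_scaleC_right scaleC_scaleC)
  have "(\<lambda>\<phi>. (cmod (cinner \<phi> (bra y)))\<^sup>2 * (norm x)\<^sup>2) summable_on some_onb"
    using some_onb_is_onb[where 'a="'b dual"]
    by (intro summable_on_cmult_left bessel_summable) (simp add: is_onb_def)
  moreover have "(cmod (cinner \<phi> (bra y)))\<^sup>2 * (norm x)\<^sup>2 = (norm (dual_apply \<phi> y *\<^sub>C x))\<^sup>2" for \<phi>
    unfolding dual_apply_cinner
    by (subst cinner_commute) (simp add: norm_scaleC power_mult_distrib)
  ultimately show "(\<lambda>\<phi>. (norm (dual_apply \<phi> y *\<^sub>C x))\<^sup>2) summable_on some_onb" by simp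
qed

lemma cinner_hs_eq: "cinner S T = (\<Sum>\<^sub>\<infinity>e\<in>some_onb. cinner (hs_apply S e) (hs_apply T e))"
  unfolding cinner_hs.rep_eq trace_def
  by (simp add: cinner_adj_right hs_apply_bounded_clinear)

lemma cinner_tensor_left: "cinner (x \<otimes> y) T = cinner x (hs_apply T (bra y))"
proof -
  have "((\<lambda>\<phi>. hs_apply T (cinner \<phi> (bra y) *\<^sub>C \<phi>)) has_sum hs_apply T (bra y)) some_onb"
    by (rule has_sum_bounded_linear[OF bounded_clinear_bounded_linear[OF hs_apply_bounded_clinear]
          onb_has_sum[OF some_onb_is_onb]])
  from has_sum_bounded_linear[OF bounded_linear_cinner_right this, of x]
  have "((\<lambda>\<phi>. cinner \<phi> (bra y) * cinner x (hs_apply T \<phi>)) has_sum cinner x (hs_apply T (bra y))) some_onb"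
    by (simp add: bounded_clinear_scaleC[OF hs_apply_bounded_clinear] cinner_scaleC_right)
  moreover have "cinner (hs_apply (x \<otimes> y) \<phi>) (hs_apply T \<phi>) = cinner \<phi> (bra y) * cinner x (hs_apply T \<phi>)" for \<phi>
    unfolding tensor.rep_eq dual_apply_cinner cinner_scaleC_left
    by (subst cinner_commute[of \<phi>]) simp
  ultimately show ?thesis unfolding cinner_hs_eq by (simp add: infsumI)
qed

lemma cinner_tensor: "cinner (x \<otimes> y) (x' \<otimes> y') = cinner x x' * cinner y y'"
  by (simp add: cinner_tensor_left tensor.rep_eq dual_apply_bra cinner_scaleC_right mult.commute)

lemma tensor_total:
  assumes "\<And>x y. cinner (x \<otimes> y) T = 0"
  shows "T = 0"
proof -
  have "hs_apply T \<phi> = 0" for \<phi>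
  proof (cases \<phi> rule: bra_cases)
    fix y assume "\<phi> = bra y"
    then show ?thesis using assms cinner_tensor_left by (metis cinner_zeroI)
  qed
  then show ?thesis by transfer (simp add: fun_eq_iff)
qed

definition tensor_op :: "('a::chilbert_space \<Rightarrow> 'c::chilbert_space) \<Rightarrow> ('b::chilbert_space \<Rightarrow> 'd::chilbert_space)
    \<Rightarrow> (('a, 'b) tensor \<Rightarrow> ('c, 'd) tensor)"
  where "tensor_op a b = (THE c. bounded_clinear c \<and> (\<forall>x y. c (x \<otimes> y) = a x \<otimes> b y))"

definition partial_trace :: "(('a::chilbert_space, 'b::chilbert_space) tensor \<Rightarrow> ('a, 'b) tensor) \<Rightarrow> ('a \<Rightarrow> 'a)"
  where "partial_trace s = (THE t. trace_class t \<and>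
    (\<forall>a. bounded_clinear a \<longrightarrow> trace (t \<circ> a) = trace (s \<circ> tensor_op a id)))"

section \<open>Maps between spaces of trace-class operators\<close>

text \<open>Trace-class operators are represented by the functions satisfying \<open>trace_class\<close>, so a
  map \<open>\<Phi>\<close> between spaces of trace-class operators matters only through its values on them.\<close>

definition tc_linear :: "(('a::chilbert_space \<Rightarrow> 'a) \<Rightarrow> ('b::chilbert_space \<Rightarrow> 'b)) \<Rightarrow> bool"
  where "tc_linear \<Phi> \<longleftrightarrow>
    (\<forall>s. trace_class s \<longrightarrow> trace_class (\<Phi> s)) \<and>
    (\<forall>s t. trace_class s \<longrightarrow> trace_class t \<longrightarrow> \<Phi> (\<lambda>x. s x + t x) = (\<lambda>x. \<Phi> s x + \<Phi> t x)) \<and>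
    (\<forall>c s. trace_class s \<longrightarrow> \<Phi> (\<lambda>x. c *\<^sub>C s x) = (\<lambda>x. c *\<^sub>C \<Phi> s x))"

definition finite_rank :: "('a::complex_inner \<Rightarrow> 'b::complex_inner) \<Rightarrow> bool"
  where "finite_rank T \<longleftrightarrow> bounded_clinear T \<and> (\<exists>F. finite F \<and> range T \<subseteq> cspan F)"

definition finite_rank_preserving ::
    "(('a::chilbert_space \<Rightarrow> 'a) \<Rightarrow> ('b::chilbert_space \<Rightarrow> 'b)) \<Rightarrow> bool"
  where "finite_rank_preserving \<Phi> \<longleftrightarrow> (\<forall>s. finite_rank s \<longrightarrow> finite_rank (\<Phi> s))"

definition trace_preserving ::
    "(('a::chilbert_space \<Rightarrow> 'a) \<Rightarrow> ('b::chilbert_space \<Rightarrow> 'b)) \<Rightarrow> bool"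
  where "trace_preserving \<Phi> \<longleftrightarrow> (\<forall>s. trace_class s \<longrightarrow> trace (\<Phi> s) = trace s)"

text \<open>The space \<open>\<complex>\<^sup>n \<otimes> H\<close> is the direct sum of \<open>n\<close> copies of \<open>H\<close>, where \<open>e\<^sub>j \<otimes> x\<close> is the family
  with \<open>x\<close> at position \<open>j\<close> and zeros elsewhere. As \<open>n\<close> has to be quantified over, all these spaces are
  taken as subspaces of the single space of square-summable sequences in \<open>H\<close>, and operators on
  \<open>\<complex>\<^sup>n \<otimes> H\<close> are extended by zero to the orthogonal complement, which changes neither positivity nor
  the trace norm.\<close>

lift_definition ell2_single :: "'i \<Rightarrow> 'a::complex_inner \<Rightarrow> ('i, 'a) ell2"
  is "\<lambda>j x i. if i = j then x else 0"
proof -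
  fix j :: 'i and x :: 'a
  have "finite {i. (norm (if i = j then x else 0))\<^sup>2 \<noteq> 0}"
    by (rule finite_subset[of _ "{j}"]) auto
  then show "(\<lambda>i. (norm (if i = j then x else 0))\<^sup>2) summable_on UNIV"
    by (intro finite_nonzero_values_imp_summable_on) simp
qed

definition ell2_trunc :: "nat \<Rightarrow> (nat, 'a::complex_inner) ell2 \<Rightarrow> (nat, 'a) ell2"
  where "ell2_trunc n f = (\<Sum>i<n. ell2_single i (ell2_nth f i))"

definition amp_trace_class :: "nat \<Rightarrow> ((nat, 'a::chilbert_space) ell2 \<Rightarrow> (nat, 'a) ell2) \<Rightarrow> bool"
  where "amp_trace_class n S \<longleftrightarrow> trace_class S \<and> S = ell2_trunc n \<circ> S \<circ> ell2_trunc n"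

definition block :: "((nat, 'a::complex_inner) ell2 \<Rightarrow> (nat, 'a) ell2) \<Rightarrow> nat \<Rightarrow> nat \<Rightarrow> ('a \<Rightarrow> 'a)"
  where "block S i j = (\<lambda>x. ell2_nth (S (ell2_single j x)) i)"

text \<open>The map \<open>id\<^sub>n \<otimes> \<Phi>\<close>: since \<open>S\<close> is the sum of the \<open>E\<^sub>i\<^sub>j \<otimes> S\<^sub>i\<^sub>j\<close> with blocks \<open>S\<^sub>i\<^sub>j\<close> and matrix
  units \<open>E\<^sub>i\<^sub>j\<close>, its image is the sum of the \<open>E\<^sub>i\<^sub>j \<otimes> \<Phi>(S\<^sub>i\<^sub>j)\<close>.\<close>

definition ampliation :: "nat \<Rightarrow> (('a::chilbert_space \<Rightarrow> 'a) \<Rightarrow> ('b::chilbert_space \<Rightarrow> 'b)) \<Rightarrow>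
    ((nat, 'a) ell2 \<Rightarrow> (nat, 'a) ell2) \<Rightarrow> ((nat, 'b) ell2 \<Rightarrow> (nat, 'b) ell2)"
  where "ampliation n \<Phi> S = (\<lambda>f. \<Sum>i<n. \<Sum>j<n. ell2_single i (\<Phi> (block S i j) (ell2_nth f j)))"

definition completely_positive ::
    "(('a::chilbert_space \<Rightarrow> 'a) \<Rightarrow> ('b::chilbert_space \<Rightarrow> 'b)) \<Rightarrow> bool"
  where "completely_positive \<Phi> \<longleftrightarrow>
    (\<forall>n S. amp_trace_class n S \<longrightarrow> positive_op S \<longrightarrow> positive_op (ampliation n \<Phi> S))"

definition cb_norm :: "(('a::chilbert_space \<Rightarrow> 'a) \<Rightarrow> ('b::chilbert_space \<Rightarrow> 'b)) \<Rightarrow> ennreal"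
  where "cb_norm \<Phi> = (SUP n. SUP S\<in>{S. amp_trace_class n S \<and> trace_norm S \<le> 1}.
    ennreal (trace_norm (ampliation n \<Phi> S)))"

definition completely_bounded ::
    "(('a::chilbert_space \<Rightarrow> 'a) \<Rightarrow> ('b::chilbert_space \<Rightarrow> 'b)) \<Rightarrow> bool"
  where "completely_bounded \<Phi> \<longleftrightarrow> cb_norm \<Phi> < \<infinity>"

definition completely_contractive ::
    "(('a::chilbert_space \<Rightarrow> 'a) \<Rightarrow> ('b::chilbert_space \<Rightarrow> 'b)) \<Rightarrow> bool"
  where "completely_contractive \<Phi> \<longleftrightarrow> cb_norm \<Phi> \<le> 1"

section \<open>The map \<open>\<Psi>\<close>\<close>

definition Ad :: "('a::chilbert_space \<Rightarrow> 'b::chilbert_space) \<Rightarrow> ('a \<Rightarrow> 'a) \<Rightarrow> ('b \<Rightarrow> 'b)"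
  where "Ad V s = V \<circ> s \<circ> adj V"

definition unitary_op :: "('a::chilbert_space \<Rightarrow> 'b::chilbert_space) \<Rightarrow> bool"
  where "unitary_op U \<longleftrightarrow> bounded_clinear U \<and> adj U \<circ> U = id \<and> U \<circ> adj U = id"

text \<open>\<open>\<H>\<close> is the space of Hilbert-Schmidt operators from \<open>H\<^sub>1 \<otimes> H\<^sub>2\<close> to \<open>H\<^sub>2\<close>, and
  \<open>\<theta>\<close> identifies it with \<open>H\<^sub>2 \<otimes> (H\<^sub>1\<^sup>* \<otimes> H\<^sub>2\<^sup>*)\<close>.\<close>

type_synonym ('a, 'b) hspace = "(('a, 'b) tensor, 'b) hs"

definition theta :: "('a::chilbert_space, 'b::chilbert_space) hspace \<Rightarrow> ('b, ('a dual, 'b dual) tensor) tensor"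
  where "theta = (THE U. unitary_op U \<and>
    (\<forall>x y z \<xi> \<eta>. hs_apply (adj U (z \<otimes> (bra x \<otimes> bra y))) (\<xi> \<otimes> \<eta>) = (cinner x \<xi> * cinner y \<eta>) *\<^sub>C z))"

definition Psi :: "(('a::chilbert_space, 'b::chilbert_space) hspace \<Rightarrow> ('a, 'b) hspace) \<Rightarrow> ('b \<Rightarrow> 'b)"
  where "Psi = partial_trace \<circ> Ad theta"

end

theory Submission
  imports Defs
begin

text \<open>Write \<open>\<Phi>\<^sub>V\<close> for \<open>\<Psi> \<circ> Ad V\<close>. An operator is trace class iff it is a product \<open>A B\<^sup>*\<close> of two
  Hilbert-Schmidt operators, the trace norm being the least value of \<open>\<parallel>A\<parallel> \<parallel>B\<parallel>\<close>. Evaluation of the elements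
  of \<open>\<H>\<close> at an orthonormal basis of \<open>H\<^sub>1 \<otimes> H\<^sub>2\<close> turns \<open>V\<close> into Kraus operators \<open>V\<^sub>k\<close>, and
  \<open>\<Phi>\<^sub>V(A B\<^sup>*) = C\<^sub>A\<^sup>* C\<^sub>B\<close> for the Hilbert-Schmidt operator \<open>C\<^sub>A y = (A\<^sup>* V\<^sub>k\<^sup>* y)\<^sub>k\<close> with
  \<open>\<langle>C\<^sub>A, C\<^sub>B\<rangle> = \<langle>V B, V A\<rangle>\<close>; complete positivity, the bound \<open>\<parallel>V\<parallel>\<^sup>2\<close> on the completely bounded norm and the
  trace formula are read off from this. Conversely, for a completely positive \<open>\<Phi>\<close> the weighted Choi
  operator \<open>G = \<Sum>\<^sub>i\<^sub>j 2\<^sup>-\<^sup>i 2\<^sup>-\<^sup>j M\<^sub>i \<Phi>(|e\<^sub>i\<rangle>\<langle>e\<^sub>j|) M\<^sub>j\<^sup>*\<close> with \<open>M\<^sub>i y = e\<^sub>i \<otimes> y\<close> is bounded and positive on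
  \<open>H\<^sub>1 \<otimes> H\<^sub>2\<close>, because the basis of \<open>H\<^sub>1\<close> is countable. The operators \<open>w\<^sub>i = 2\<^sup>i M\<^sub>i\<^sup>* \<surd>G\<close> lie in \<open>\<H>\<close> and satisfy
  \<open>w\<^sub>i w\<^sub>j\<^sup>* = \<Phi>(|e\<^sub>i\<rangle>\<langle>e\<^sub>j|)\<close>, so \<open>V e\<^sub>i = w\<^sub>i\<close> defines the required operator, with \<open>\<parallel>V x\<parallel>\<^sup>2 = tr \<Phi>(|x\<rangle>\<langle>x|)\<close>.\<close>

section \<open>Bounded operators and adjoints\<close>

text \<open>Without weights the Choi operator is unbounded on an infinite-dimensional H_1: for the
  identity map its compression to n basis vectors has norm n. Weights cost nothing, since the
  relations between the w_i are homogeneous in each index and each w_i can be rescaled afterwards.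
  The root of G acts on the tensor product of H_1 and H_2, which is why the values of V are
  operators from that space to H_2. A trace-preserving map comes with no continuity at all. Complete
  boundedness, complete contractivity and trace preservation enter the construction of V only
  through tr Phi(s) <= C tr s for positive s, where C is the completely bounded norm, 1 and 1.
  Together with positivity this makes the map sending (A, B) to the image of
  \<open>hs_prod A B\<close> bounded and sesquilinear on a Hilbert space, so Riesz representation
  takes the place of approximation in the trace norm: two such maps agree once they agree on
  rank-one factors |e><g| with e in the basis. Absolute values, partial trace and theta are given by
  unique description, so each requires existence and uniqueness; the root is a limit of polynomials
  in the operator.\<close>

lemma cinner_eqI: "(\<And>y. cinner y u = cinner y v) \<Longrightarrow> u = (v::'a::complex_inner)"
  using cinner_zeroI[of "u - v"] by (simp add: cinner_diff_right)

lemma bounded_clinear_compose: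
  assumes "bounded_clinear S" "bounded_clinear T"
  shows "bounded_clinear (S \<circ> T)"
  using assms bounded_linear_compose[of S T] unfolding bounded_clinear_def by (auto simp: o_def)

lemma bounded_clinear_ident: "bounded_clinear (\<lambda>x. x)"
  by (simp add: bounded_clinear_def bounded_linear_ident)

lemma bounded_clinear_id: "bounded_clinear id"
  using bounded_clinear_ident by (simp add: id_def)

lemma bounded_clinear_const_zero: "bounded_clinear (\<lambda>_. 0)"
  by (rule bounded_clinear_intro[where K=0]) simp_all

lemma bounded_clinear_sum_fun:
  "(\<And>i. i \<in> A \<Longrightarrow> bounded_clinear (f i)) \<Longrightarrow> bounded_clinear (\<lambda>x. \<Sum>i\<in>A. f i x)"
  by (induction A rule: infinite_finite_induct)
    (auto intro: bounded_clinear_plus bounded_clinear_const_zero)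

lemma bounded_clinear_minus:
  assumes "bounded_clinear S" "bounded_clinear T"
  shows "bounded_clinear (\<lambda>x. S x - T x)"
  using bounded_clinear_plus[OF assms(1) bounded_clinear_scale[OF assms(2), of "-1"]]
  by (simp add: cvec.scale_minus_left)

lemma bounded_clinear_norm_le: "bounded_clinear T \<Longrightarrow> norm (T x) \<le> onorm T * norm x"
  by (simp add: bounded_clinear_def onorm)

lemma bounded_clinear_onorm_pos_le: "bounded_clinear T \<Longrightarrow> 0 \<le> onorm T"
  by (simp add: bounded_clinear_def onorm_pos_le)

lemma bounded_clinear_tendsto:
  "bounded_clinear T \<Longrightarrow> (f \<longlongrightarrow> l) F \<Longrightarrow> ((\<lambda>x. T (f x)) \<longlongrightarrow> T l) F"
  by (simp add: bounded_clinear_def bounded_linear.tendsto)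

lemma tendsto_cinner:
  assumes "(f \<longlongrightarrow> a) F" "(g \<longlongrightarrow> b) F"
  shows "((\<lambda>x. cinner (f x) (g x)) \<longlongrightarrow> cinner a (b::'a::complex_inner)) F"
proof -
  \<comment> \<open>The form is antilinear in its first argument, so the imaginary part is a real
    inner product as well, and continuity of the real one suffices.\<close>
  have c: "cinner x y = Complex (inner x y) (inner (\<i> *\<^sub>C x) y)" for x y :: 'a
    by (rule complex_eqI) (simp_all flip: Re_cinner add: cinner_scaleC_left)
  show ?thesis unfolding c
    by (intro tendsto_Complex tendsto_inner assms bounded_linear.tendsto[OF bounded_linear_scaleC_right])
qed

lemma adj_eqI:
  assumes "bounded_clinear T" "\<And>x y. cinner (S y) x = cinner y (T x)"
  shows "adj T = S"
proof
  show "adj T y = S y" for y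
  proof (rule cinner_eqI)
    fix x
    have "cinner (adj T y) x = cinner (S y) x" using assms by (simp add: cinner_adj_left)
    then show "cinner x (adj T y) = cinner x (S y)" by (metis cinner_commute)
  qed
qed

lemma adj_compose:
  assumes "bounded_clinear S" "bounded_clinear T"
  shows "adj (S \<circ> T) = adj T \<circ> adj S"
  by (rule adj_eqI) (simp_all add: assms bounded_clinear_compose cinner_adj_left)

lemma adj_norm_le:
  assumes T: "bounded_clinear T" and "K \<ge> 0" and K: "\<And>x. norm (T x) \<le> K * norm x"
  shows "norm (adj T y) \<le> K * norm y"
proof (cases "adj T y = 0")
  case False
  have "(norm (adj T y))\<^sup>2 = cmod (cinner y (T (adj T y)))"
    by (simp add: cinner_adj_left[OF T, symmetric] cinner_self del: of_real_power)
  also have "\<dots> \<le> norm y * (K * norm (adj T y))"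
    by (rule order_trans[OF cinner_bound mult_left_mono[OF K]]) simp
  finally show ?thesis using False by (simp add: power2_eq_square mult_ac)
qed (use assms(2) in simp)

text \<open>Polarisation: the value at x + y gives the sum of the two cross terms, and replacing x
  by ix gives their difference. Complex scalars matter here, as the rotation of the real plane by a
  right angle shows.\<close>

lemma cinner_quadratic_zero:
  assumes T: "bounded_clinear T" and z: "\<And>x. cinner x (T x) = 0"
  shows "T x = 0"
proof (rule cinner_zeroI)
  fix y
  have eq: "cinner y (T x) + cinner x (T y) = 0" for x y
    using z[of "x + y"] by (simp add: bounded_clinear_add[OF T] cinner_add_left cinner_add_right z)
  have "cinner y (T (\<i> *\<^sub>C x)) + cinner (\<i> *\<^sub>C x) (T y) = 0" by (rule eq)
  then have "\<i> * (cinner y (T x) - cinner x (T y)) = 0"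
    by (simp add: bounded_clinear_scaleC[OF T] cinner_scaleC_right cinner_scaleC_left algebra_simps)
  then show "cinner y (T x) = 0" using eq[of y x] by simp
qed

section \<open>Positive operators and their square roots\<close>

lemma positive_op_bounded_clinear: "positive_op P \<Longrightarrow> bounded_clinear P"
  by (simp add: positive_op_def)

lemma positive_op_Re_nonneg: "positive_op P \<Longrightarrow> 0 \<le> Re (cinner x (P x))"
  by (simp add: positive_op_def complex_nonneg_Reals_iff)

lemma positive_op_cinner_of_real:
  assumes "positive_op P"
  shows "cinner x (P x) = complex_of_real (Re (cinner x (P x)))"
proof -
  have "cinner x (P x) \<in> \<real>\<^sub>\<ge>\<^sub>0" using assms by (simp add: positive_op_def)
  then show ?thesis by (simp add: complex_eq_iff complex_nonneg_Reals_iff)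
qed

text \<open>The quadratic form of P is real, so that of \<open>adj P x - P x\<close> vanishes
  identically.\<close>

lemma positive_op_adj:
  assumes P: "positive_op P"
  shows "adj P = P"
proof
  fix x
  have bP: "bounded_clinear P" by (rule positive_op_bounded_clinear[OF P])
  have "bounded_clinear (\<lambda>x. adj P x - P x)"
    by (rule bounded_clinear_minus[OF adj_bounded_clinear[OF bP] bP])
  moreover have "cinner x (adj P x - P x) = 0" for x
  proof -
    have "cinner (P x) x = cnj (cinner x (P x))" by (rule cinner_commute)
    also have "\<dots> = cinner x (P x)"
      by (subst (1 2) positive_op_cinner_of_real[OF P]) simp
    finally have "cinner (P x) x = cinner x (P x)" .
    then show ?thesis by (simp add: cinner_diff_right cinner_adj_right[OF bP])
  qed
  ultimately have "adj P x - P x = 0" by (rule cinner_quadratic_zero)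
  then show "adj P x = P x" by simp
qed

lemma positive_op_cinner:
  "positive_op P \<Longrightarrow> cinner (P x) y = cinner x (P (y::'a::chilbert_space))"
  using cinner_adj_left[of P x y] by (simp add: positive_op_adj positive_op_bounded_clinear)

lemma positive_opI:
  assumes "bounded_clinear P" "\<And>x. \<exists>r\<ge>0. cinner x (P x) = complex_of_real r"
  shows "positive_op P"
  unfolding positive_op_def
proof (intro conjI allI assms(1))
  fix x
  from assms(2)[of x] obtain r where "r \<ge> 0" "cinner x (P x) = complex_of_real r" by blast
  then show "cinner x (P x) \<in> \<real>\<^sub>\<ge>\<^sub>0" by simp
qed

lemma positive_op_adj_comp:
  assumes T: "bounded_clinear T"
  shows "positive_op (adj T \<circ> T)"
proof (rule positive_opI)
  show "bounded_clinear (adj T \<circ> T)"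
    by (rule bounded_clinear_compose[OF adj_bounded_clinear[OF T] T])
  show "\<exists>r\<ge>0. cinner x ((adj T \<circ> T) x) = complex_of_real r" for x
    by (intro exI[of _ "(norm (T x))\<^sup>2"]) (simp add: cinner_adj_right[OF T] cinner_self)
qed

lemma positive_op_scale:
  assumes P: "positive_op P" and "c \<ge> 0"
  shows "positive_op (\<lambda>x. complex_of_real c *\<^sub>C P x)"
proof (rule positive_opI[OF bounded_clinear_scale[OF positive_op_bounded_clinear[OF P]]])
  fix x
  show "\<exists>r\<ge>0. cinner x (complex_of_real c *\<^sub>C P x) = complex_of_real r"
    using positive_op_cinner_of_real[OF P, of x] positive_op_Re_nonneg[OF P, of x] assms(2)
    by (intro exI[of _ "c * Re (cinner x (P x))"]) (simp add: cinner_scaleC_right)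
qed

text \<open>This is P^2 <= P for a positive contraction. Positivity is used at x - P x; the leftover
  term <P x, P P x> is at most |P x|^2.\<close>

lemma positive_contraction_norm:
  fixes P :: "'a::chilbert_space \<Rightarrow> 'a"
  assumes P: "positive_op P" and K: "\<And>x. norm (P x) \<le> norm x"
  shows "(norm (P x))\<^sup>2 \<le> Re (cinner x (P x))"
proof -
  have bP: "bounded_clinear P" by (rule positive_op_bounded_clinear[OF P])
  have "0 \<le> Re (cinner (x - P x) (P (x - P x)))" by (rule positive_op_Re_nonneg[OF P])
  also have "cinner (x - P x) (P (x - P x))
      = cinner x (P x) - 2 * cinner (P x) (P x) + cinner (P x) (P (P x))"
    by (simp add: bounded_clinear_diff[OF bP] cinner_diff_left cinner_diff_right
        flip: positive_op_cinner[OF P, of x "P x"])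
  finally have "2 * (norm (P x))\<^sup>2 \<le> Re (cinner x (P x)) + Re (cinner (P x) (P (P x)))"
    by (simp add: cinner_self)
  also have "Re (cinner (P x) (P (P x))) \<le> cmod (cinner (P x) (P (P x)))"
    by (rule complex_Re_le_cmod)
  also have "\<dots> \<le> norm (P x) * norm (P x)"
    by (rule order_trans[OF cinner_bound mult_left_mono[OF K]]) simp
  finally show ?thesis by (simp add: power2_eq_square)
qed

lemma positive_op_normalize:
  fixes P :: "'a::chilbert_space \<Rightarrow> 'a"
  assumes P: "positive_op P"
  obtains c A where "c > 0" "positive_op A" "\<And>x. norm (A x) \<le> norm x"
    "P = (\<lambda>x. complex_of_real c *\<^sub>C A x)" "A = (\<lambda>x. complex_of_real (1 / c) *\<^sub>C P x)"
proof -
  have bP: "bounded_clinear P" by (rule positive_op_bounded_clinear[OF P])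
  \<comment> \<open>The summand 1 keeps c positive for P = 0.\<close>
  define c where "c = onorm P + 1"
  define A where "A = (\<lambda>x. complex_of_real (1 / c) *\<^sub>C P x)"
  have c: "c > 0" using bounded_clinear_onorm_pos_le[OF bP] by (simp add: c_def)
  have "norm (A x) \<le> norm x" for x
  proof -
    have "norm (P x) \<le> c * norm x"
      using bounded_clinear_norm_le[OF bP, of x] by (simp add: c_def distrib_right add_increasing2)
    then show ?thesis
      using c by (simp add: A_def norm_scaleC norm_divide pos_divide_le_eq mult.commute)
  qed
  moreover have "P = (\<lambda>x. complex_of_real c *\<^sub>C A x)"
    using c by (simp add: A_def scaleC_scaleC)
  moreover have "positive_op A"
    unfolding A_def using c by (intro positive_op_scale[OF P]) simp
  ultimately show thesis using that[OF c _ _ _ A_def] by blast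
qed

text \<open>After scaling to a contraction, P^2 <= P bounds |P x|^2 by the quadratic form.\<close>

lemma positive_op_cinner_eq_0:
  fixes P :: "'a::chilbert_space \<Rightarrow> 'a"
  assumes P: "positive_op P" and z: "cinner x (P x) = 0"
  shows "P x = 0"
proof -
  obtain c A where A: "positive_op A" "\<And>x. norm (A x) \<le> norm x"
    "P = (\<lambda>x. complex_of_real c *\<^sub>C A x)" "A = (\<lambda>x. complex_of_real (1 / c) *\<^sub>C P x)"
    using positive_op_normalize[OF P] by metis
  have "cinner x (A x) = 0" unfolding A(4) by (simp add: cinner_scaleC_right z)
  then have "A x = 0" using positive_contraction_norm[OF A(1,2), of x] by simp
  then show ?thesis by (simp add: A(3))
qed

section \<open>Polynomials in a bounded operator\<close>

definition op_poly :: "real poly \<Rightarrow> ('a::complex_inner \<Rightarrow> 'a) \<Rightarrow> 'a \<Rightarrow> 'a"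
  where "op_poly p X = fold_coeffs (\<lambda>a f x. a *\<^sub>R x + X (f x)) p (\<lambda>_. 0)"

lemma op_poly_0 [simp]: "op_poly 0 X x = 0"
  by (simp add: op_poly_def)

context
  fixes X :: "'a::complex_inner \<Rightarrow> 'a"
  assumes X: "bounded_clinear X"
begin

lemma op_poly_pCons: "op_poly (pCons a p) X x = a *\<^sub>R x + X (op_poly p X x)"
  by (cases "p = 0 \<and> a = 0") (auto simp: op_poly_def bounded_clinear_zero[OF X])

lemma op_poly_add: "op_poly (p + q) X x = op_poly p X x + op_poly q X x"
  by (induction p q rule: poly_induct2)
    (simp_all add: op_poly_pCons bounded_clinear_add[OF X] scaleR_add_left algebra_simps)

lemma bounded_clinear_scaleR: "bounded_clinear T \<Longrightarrow> T (a *\<^sub>R x) = a *\<^sub>R T x"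
  by (simp add: scaleR_scaleC bounded_clinear_scaleC)

lemma op_poly_smult: "op_poly (smult a p) X x = a *\<^sub>R op_poly p X x"
  by (induction p) (simp_all add: op_poly_pCons bounded_clinear_scaleR[OF X] scaleR_add_right)

lemma op_poly_diff: "op_poly (p - q) X x = op_poly p X x - op_poly q X x"
  using op_poly_add[of "p - q" q x] by simp

lemma op_poly_mult: "op_poly (p * q) X x = op_poly p X (op_poly q X x)"
  by (induction p) (simp_all add: op_poly_pCons op_poly_add op_poly_smult)

lemma op_poly_commute:
  assumes "bounded_clinear Q" "\<And>x. Q (X x) = X (Q x)"
  shows "Q (op_poly p X x) = op_poly p X (Q x)"
  by (induction p)
    (simp_all add: op_poly_pCons bounded_clinear_add[OF assms(1)] bounded_clinear_scaleR[OF assms(1)]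
      bounded_clinear_zero[OF assms(1)] assms(2))

text \<open>With nonnegative coefficients the triangle inequality compares the operator with the
  scalar value at 1, so convergence of operator iterates becomes a question about one real
  sequence.\<close>

lemma op_poly_norm_le:
  assumes "\<And>x. norm (X x) \<le> norm x" "\<And>i. coeff p i \<ge> 0"
  shows "norm (op_poly p X x) \<le> poly p 1 * norm x"
  using assms(2)
proof (induction p)
  case (pCons a p)
  have a: "a \<ge> 0" and p: "\<And>i. coeff p i \<ge> 0"
    using pCons.prems[of 0] pCons.prems[of "Suc _"] by (auto simp del: One_nat_def)
  have "norm (op_poly (pCons a p) X x) \<le> a * norm x + norm (op_poly p X x)"
    unfolding op_poly_pCons using a
    by (intro order_trans[OF norm_triangle_ineq] add_mono assms(1)) simp
  then show ?case using pCons.IH[OF p] by (simp add: distrib_right)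
qed simp

lemma op_poly_bounded_clinear: "bounded_clinear (op_poly p X)"
proof (induction p)
  case 0
  then show ?case by (simp add: op_poly_def bounded_clinear_const_zero)
next
  case (pCons a p)
  have "bounded_clinear (\<lambda>x. complex_of_real a *\<^sub>C x + (X \<circ> op_poly p X) x)"
    by (intro bounded_clinear_plus bounded_clinear_scale bounded_clinear_compose bounded_clinear_ident X pCons)
  then show ?case
    by (rule back_subst[of bounded_clinear]) (simp add: fun_eq_iff op_poly_pCons scaleR_scaleC)
qed

lemma op_poly_cinner:
  assumes "\<And>x y. cinner (X x) y = cinner x (X y)"
  shows "cinner (op_poly p X x) y = cinner x (op_poly p X y)"
proof (induction p arbitrary: y)
  case (pCons a p)
  have comm: "X (op_poly p X y) = op_poly p X (X y)" for y by (rule op_poly_commute[OF X refl])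
  have "cinner (X (op_poly p X x)) y = cinner x (X (op_poly p X y))"
    by (simp only: comm[of y] assms[of "op_poly p X x"] pCons.IH)
  then show ?case
    by (simp add: op_poly_pCons cinner_add_left cinner_add_right scaleR_scaleC cinner_scaleC_left
        cinner_scaleC_right)
qed simp

end

text \<open>The iterates of \<open>y \<mapsto> (x + y\<^sup>2) / 2\<close> starting from \<open>0\<close>; their limit is \<open>1 - sqrt (1 - x)\<close>.
  As all coefficients are nonnegative, differences of iterates are controlled by their values at \<open>1\<close>.\<close>

fun sqrt_poly :: "nat \<Rightarrow> real poly"
  where "sqrt_poly 0 = 0"
  | "sqrt_poly (Suc n) = smult (1/2) ([:0, 1:] + sqrt_poly n * sqrt_poly n)"

lemma coeff_mult_nonneg:
  "(\<And>i. coeff p i \<ge> 0) \<Longrightarrow> (\<And>i. coeff q i \<ge> 0) \<Longrightarrow> coeff (p * q) i \<ge> (0::real)"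
  by (simp add: coeff_mult sum_nonneg)

lemma coeff_X_nonneg: "coeff [:0, 1:] i \<ge> (0::real)"
  by (simp add: coeff_pCons split: nat.split)

lemma sqrt_poly_coeff_nonneg: "coeff (sqrt_poly n) i \<ge> 0"
  by (induction n arbitrary: i) (simp_all add: coeff_mult_nonneg coeff_X_nonneg del: mult_pCons_left mult_pCons_right)

text \<open>Difference of two squares. The second factor has nonnegative coefficients, so
  nonnegativity of the increments passes from one step to the next.\<close>

lemma sqrt_poly_step:
  "sqrt_poly (Suc (Suc n)) - sqrt_poly (Suc n)
      = smult (1/2) ((sqrt_poly (Suc n) - sqrt_poly n) * (sqrt_poly (Suc n) + sqrt_poly n))"
proof -
  have *: "smult c (x + p * p) - smult c (x + q * q) = smult c ((p - q) * (p + q))" for c and x p q :: "real poly"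
    unfolding smult_diff_right[symmetric] by (simp add: algebra_simps)
  show ?thesis
    by (subst sqrt_poly.simps(2)[of "Suc n"], subst (2) sqrt_poly.simps(2)[of n]) (rule *)
qed

lemma sqrt_poly_step_coeff_nonneg: "coeff (sqrt_poly (Suc n) - sqrt_poly n) i \<ge> 0"
proof (induction n arbitrary: i)
  case (Suc n)
  have "coeff ((sqrt_poly (Suc n) - sqrt_poly n) * (sqrt_poly (Suc n) + sqrt_poly n)) i \<ge> 0"
    by (rule coeff_mult_nonneg[OF Suc]) (simp only: coeff_add add_nonneg_nonneg sqrt_poly_coeff_nonneg)
  then show ?case by (simp only: sqrt_poly_step coeff_smult)
qed (simp add: coeff_pCons split: nat.split)

lemma sqrt_poly_diff_coeff_nonneg: "n \<le> m \<Longrightarrow> coeff (sqrt_poly m - sqrt_poly n) i \<ge> 0"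
proof (induction m rule: dec_induct)
  case (step m)
  then show ?case using sqrt_poly_step_coeff_nonneg[of m i] by (simp del: sqrt_poly.simps)
qed simp

text \<open>1 is the fixed point of y = (1 + y^2) / 2, and iteration from 0 never crosses
  it.\<close>

lemma sqrt_poly_le_1: "0 \<le> poly (sqrt_poly n) 1 \<and> poly (sqrt_poly n) 1 \<le> 1"
proof (induction n)
  case (Suc n)
  then have "poly (sqrt_poly n) 1 * poly (sqrt_poly n) 1 \<le> 1 * 1" by (intro mult_mono) auto
  then show ?case by simp
qed simp

lemma sqrt_poly_mono:
  assumes "n \<le> m"
  shows "poly (sqrt_poly n) 1 \<le> poly (sqrt_poly m) 1"
proof -
  have "0 \<le> poly (sqrt_poly m - sqrt_poly n) 1"
    unfolding poly_altdef by (intro sum_nonneg mult_nonneg_nonneg sqrt_poly_diff_coeff_nonneg[OF assms]) simp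
  then show ?thesis by simp
qed

text \<open>With X = 1 - A and Y the limit of the iterates at X, the fixed-point equation 2 Y = X +
  Y^2 says (1 - Y)^2 = A. The commutation clause is inherited from polynomials in X and is the
  source of uniqueness of the root.\<close>

lemma positive_contraction_sqrt:
  fixes A :: "'a::chilbert_space \<Rightarrow> 'a"
  assumes A: "positive_op A" and A1: "\<And>x. norm (A x) \<le> norm x"
  shows "\<exists>R. positive_op R \<and> R \<circ> R = A \<and> (\<forall>Q. bounded_clinear Q \<longrightarrow> Q \<circ> A = A \<circ> Q \<longrightarrow> Q \<circ> R = R \<circ> Q)"
proof -
  have bA: "bounded_clinear A" by (rule positive_op_bounded_clinear[OF A])
  define X where "X = (\<lambda>x. x - A x)"
  have bX: "bounded_clinear X" unfolding X_def by (rule bounded_clinear_minus[OF bounded_clinear_ident bA])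
  \<comment> \<open>|x - A x|^2 = |x|^2 - 2 <x, A x> + |A x|^2, where A^2 <= A and A >= 0 make the
    correction nonpositive.\<close>
  have X1: "norm (X x) \<le> norm x" for x
  proof (rule power2_le_imp_le)
    have "cinner (X x) (X x) = cinner x x - 2 * cinner x (A x) + cinner (A x) (A x)"
      by (simp add: X_def cinner_diff_left cinner_diff_right positive_op_cinner[OF A])
    then have "complex_of_real ((norm (X x))\<^sup>2) = complex_of_real ((norm x)\<^sup>2) - 2 * cinner x (A x) + complex_of_real ((norm (A x))\<^sup>2)"
      by (simp only: cinner_self)
    then have "(norm (X x))\<^sup>2 = (norm x)\<^sup>2 - 2 * Re (cinner x (A x)) + (norm (A x))\<^sup>2"
      by (simp add: complex_eq_iff del: of_real_power)
    then show "(norm (X x))\<^sup>2 \<le> (norm x)\<^sup>2"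
      using positive_contraction_norm[OF A A1, of x] positive_op_Re_nonneg[OF A, of x] by linarith
  qed simp
  have Xs: "cinner (X x) y = cinner x (X y)" for x y
    by (simp add: X_def cinner_diff_left cinner_diff_right positive_op_cinner[OF A])
  define Yn where "Yn n = op_poly (sqrt_poly n) X" for n
  have Yn_diff: "norm (Yn m x - Yn n x) \<le> (poly (sqrt_poly m) 1 - poly (sqrt_poly n) 1) * norm x" if "n \<le> m" for m n x
    using op_poly_norm_le[OF bX X1 sqrt_poly_diff_coeff_nonneg[OF that], of x]
    by (simp add: Yn_def op_poly_diff[OF bX])
  have Yn1: "norm (Yn n x) \<le> norm x" for n x
  proof -
    have "norm (Yn n x) \<le> poly (sqrt_poly n) 1 * norm x"
      unfolding Yn_def by (rule op_poly_norm_le[OF bX X1 sqrt_poly_coeff_nonneg])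
    also have "\<dots> \<le> 1 * norm x" using sqrt_poly_le_1[of n] by (intro mult_right_mono) auto
    finally show ?thesis by simp
  qed
  have "convergent (\<lambda>n. poly (sqrt_poly n) 1)"
    by (rule Bseq_mono_convergent)
      (use sqrt_poly_le_1 sqrt_poly_mono in \<open>auto intro!: BseqI'[of _ 1] simp: abs_le_iff intro: order_trans\<close>)
  then have cs: "Cauchy (\<lambda>n. poly (sqrt_poly n) 1)" by (rule convergent_Cauchy)
  have "Cauchy (\<lambda>n. Yn n x)" for x
  proof (rule CauchyI)
    fix e :: real assume e: "e > 0"
    then have "e / (norm x + 1) > 0" by (simp add: add_nonneg_pos)
    then obtain M where M: "\<And>m n. m \<ge> M \<Longrightarrow> n \<ge> M \<Longrightarrow> norm (poly (sqrt_poly m) 1 - poly (sqrt_poly n) 1) < e / (norm x + 1)"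
      using CauchyD[OF cs] by blast
    have *: "norm (Yn m x - Yn n x) < e" if mn: "m \<ge> M" "n \<ge> M" "n \<le> m" for m n
    proof -
      have "norm (Yn m x - Yn n x) \<le> norm (poly (sqrt_poly m) 1 - poly (sqrt_poly n) 1) * (norm x + 1)"
        by (rule order_trans[OF Yn_diff[OF mn(3)] mult_mono]) auto
      also have "\<dots> < e" using M[OF mn(1,2)] by (simp add: pos_less_divide_eq add_nonneg_pos)
      finally show ?thesis .
    qed
    show "\<exists>M. \<forall>m\<ge>M. \<forall>n\<ge>M. norm (Yn m x - Yn n x) < e"
      using * by (intro exI[of _ M]) (metis nle_le norm_minus_commute)
  qed
  then have "\<forall>x. \<exists>l. (\<lambda>n. Yn n x) \<longlonglongrightarrow> l" using Cauchy_convergent convergent_def by blast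
  then obtain Y where Y: "\<And>x. (\<lambda>n. Yn n x) \<longlonglongrightarrow> Y x" by metis
  have bYn: "bounded_clinear (Yn n)" for n unfolding Yn_def by (rule op_poly_bounded_clinear[OF bX])
  have Y1: "norm (Y x) \<le> norm x" for x
    by (rule tendsto_upperbound[OF tendsto_norm[OF Y]]) (simp_all add: Yn1)
  have bY: "bounded_clinear Y"
  proof (rule bounded_clinear_intro[where K=1])
    show "Y (x + y) = Y x + Y y" for x y
      by (rule LIMSEQ_unique[OF Y]) (simp add: bounded_clinear_add[OF bYn] tendsto_add Y)
    show "Y (c *\<^sub>C x) = c *\<^sub>C Y x" for c x
      by (rule LIMSEQ_unique[OF Y])
        (simp add: bounded_clinear_scaleC[OF bYn] bounded_linear.tendsto[OF bounded_linear_scaleC_right] Y)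
  qed (simp add: Y1)
  \<comment> \<open>The outer operator varies with n too; being a contraction, it keeps the null
    sequence Yn x - Y x null.\<close>
  have YY: "(\<lambda>n. Yn n (Yn n x)) \<longlonglongrightarrow> Y (Y x)" for x
  proof -
    have "(\<lambda>n. norm (Yn n x - Y x)) \<longlonglongrightarrow> 0" using Y tendsto_norm_zero LIM_zero by blast
    then have "(\<lambda>n. Yn n (Yn n x - Y x)) \<longlonglongrightarrow> 0"
      by (rule tendsto_0_le[where K=1]) (simp add: Yn1)
    from tendsto_add[OF this Y[of "Y x"]] show ?thesis
      by (simp add: bounded_clinear_diff[OF bYn])
  qed
  have fix_eq: "2 *\<^sub>R Y x = X x + Y (Y x)" for x
  proof -
    have "(\<lambda>n. 2 *\<^sub>R Yn (Suc n) x) \<longlonglongrightarrow> 2 *\<^sub>R Y x"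
      by (intro tendsto_intros LIMSEQ_Suc[OF Y])
    moreover have "2 *\<^sub>R Yn (Suc n) x = X x + Yn n (Yn n x)" for n
      unfolding Yn_def sqrt_poly.simps op_poly_smult[OF bX] op_poly_add[OF bX] op_poly_mult[OF bX]
      by (simp add: op_poly_pCons[OF bX] bounded_clinear_zero[OF bX])
    moreover have "(\<lambda>n. X x + Yn n (Yn n x)) \<longlonglongrightarrow> X x + Y (Y x)" by (intro tendsto_intros YY)
    ultimately show ?thesis using LIMSEQ_unique by simp
  qed
  define R where "R = (\<lambda>x. x - Y x)"
  have bR: "bounded_clinear R" unfolding R_def by (rule bounded_clinear_minus[OF bounded_clinear_ident bY])
  have Ys: "cinner (Y x) y = cinner x (Y y)" for x y
  proof (rule LIMSEQ_unique)
    show "(\<lambda>n. cinner (Yn n x) y) \<longlonglongrightarrow> cinner (Y x) y" by (intro tendsto_cinner Y tendsto_const)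
    have "cinner (Yn n x) y = cinner x (Yn n y)" for n
      unfolding Yn_def by (rule op_poly_cinner[OF bX Xs])
    then show "(\<lambda>n. cinner (Yn n x) y) \<longlonglongrightarrow> cinner x (Y y)" by (simp add: tendsto_cinner Y)
  qed
  \<comment> \<open>1 - Y is positive because Y is a self-adjoint contraction.\<close>
  have "positive_op R"
  proof (rule positive_opI[OF bR])
    fix x
    have "cinner x (R x) = cnj (cinner x (R x))"
      using Ys[of x x] by (subst cinner_commute[symmetric]) (simp add: R_def cinner_diff_left cinner_diff_right)
    then have "cinner x (R x) = complex_of_real (Re (cinner x (R x)))"
      by (metis Reals_cnj_iff of_real_Re)
    moreover have "Re (cinner x (Y x)) \<le> (norm x)\<^sup>2"
    proof -
      have "Re (cinner x (Y x)) \<le> norm x * norm (Y x)"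
        by (rule order_trans[OF complex_Re_le_cmod cinner_bound])
      also have "\<dots> \<le> norm x * norm x" by (intro mult_left_mono Y1) simp
      finally show ?thesis by (simp add: power2_eq_square)
    qed
    ultimately show "\<exists>r\<ge>0. cinner x (R x) = complex_of_real r"
      by (intro exI[of _ "Re (cinner x (R x))"]) (simp add: R_def cinner_diff_right cinner_self)
  qed
  moreover have "R \<circ> R = A"
  proof
    fix x
    have "(R \<circ> R) x = x - 2 *\<^sub>R Y x + Y (Y x)"
      by (simp add: R_def bounded_clinear_diff[OF bY] scaleR_2 algebra_simps)
    then show "(R \<circ> R) x = A x" by (simp add: fix_eq X_def)
  qed
  moreover have "Q \<circ> R = R \<circ> Q" if Q: "bounded_clinear Q" "Q \<circ> A = A \<circ> Q" for Q
  proof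
    fix x
    have QX: "Q (X x) = X (Q x)" for x
      using fun_cong[OF Q(2), of x] by (simp add: X_def bounded_clinear_diff[OF Q(1)])
    have "(\<lambda>n. Yn n (Q x)) \<longlonglongrightarrow> Q (Y x)"
      using bounded_clinear_tendsto[OF Q(1) Y[of x]] unfolding Yn_def op_poly_commute[OF bX Q(1) QX] .
    then have "Q (Y x) = Y (Q x)" using LIMSEQ_unique Y by blast
    then show "(Q \<circ> R) x = (R \<circ> Q) x" by (simp add: R_def bounded_clinear_diff[OF Q(1)])
  qed
  ultimately show ?thesis by blast
qed

lemma positive_sqrt_commuting:
  fixes P :: "'a::chilbert_space \<Rightarrow> 'a"
  assumes P: "positive_op P"
  shows "\<exists>R. positive_op R \<and> R \<circ> R = P \<and> (\<forall>Q. bounded_clinear Q \<longrightarrow> Q \<circ> P = P \<circ> Q \<longrightarrow> Q \<circ> R = R \<circ> Q)"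
proof -
  obtain c A where c: "c > 0" and A: "positive_op A" "\<And>x. norm (A x) \<le> norm x"
    and PA: "P = (\<lambda>x. complex_of_real c *\<^sub>C A x)" and AP: "A = (\<lambda>x. complex_of_real (1 / c) *\<^sub>C P x)"
    using positive_op_normalize[OF P] by metis
  obtain S where S: "positive_op S" "S \<circ> S = A"
    "\<And>Q. bounded_clinear Q \<Longrightarrow> Q \<circ> A = A \<circ> Q \<Longrightarrow> Q \<circ> S = S \<circ> Q"
    using positive_contraction_sqrt[OF A] by blast
  define R where "R = (\<lambda>x. complex_of_real (sqrt c) *\<^sub>C S x)"
  have "positive_op R" unfolding R_def using c by (intro positive_op_scale[OF S(1)]) simp
  moreover have "R \<circ> R = P"
  proof
    fix x
    have "complex_of_real (sqrt c) * complex_of_real (sqrt c) = complex_of_real c"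
      using c by (simp flip: of_real_mult)
    then show "(R \<circ> R) x = P x"
      using fun_cong[OF S(2), of x]
      by (simp add: R_def PA bounded_clinear_scaleC[OF positive_op_bounded_clinear[OF S(1)]] scaleC_scaleC)
  qed
  moreover have "Q \<circ> R = R \<circ> Q" if Q: "bounded_clinear Q" "Q \<circ> P = P \<circ> Q" for Q
  proof -
    have "Q \<circ> A = A \<circ> Q"
      using fun_cong[OF Q(2)] by (simp add: fun_eq_iff AP bounded_clinear_scaleC[OF Q(1)])
    then show ?thesis
      using fun_cong[OF S(3)[OF Q(1)]] by (simp add: fun_eq_iff R_def bounded_clinear_scaleC[OF Q(1)])
  qed
  ultimately show ?thesis by blast
qed

lemma positive_sqrt_exists:
  assumes P: "positive_op (P::'a::chilbert_space \<Rightarrow> 'a)"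
  obtains R where "positive_op R" "R \<circ> R = P"
  using positive_sqrt_commuting[OF P] by blast

text \<open>A root Q commutes with P = Q^2, hence with the root S constructed before. For y = (S -
  Q) x this gives (S + Q) y = 0, and positivity forces S y = Q y = 0; then <y, y> = <x, (S - Q) y> =
  0.\<close>

lemma positive_sqrt_unique:
  fixes P :: "'a::chilbert_space \<Rightarrow> 'a"
  assumes P: "positive_op P"
  shows "\<exists>!R. positive_op R \<and> R \<circ> R = P"
proof -
  obtain S where S: "positive_op S" "S \<circ> S = P"
    and comm: "\<And>Q. bounded_clinear Q \<Longrightarrow> Q \<circ> P = P \<circ> Q \<Longrightarrow> Q \<circ> S = S \<circ> Q"
    using positive_sqrt_commuting[OF P] by blast
  have "Q = S" if Q: "positive_op Q" "Q \<circ> Q = P" for Q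
  proof
    fix x
    have bS: "bounded_clinear S" and bQ: "bounded_clinear Q" using S Q positive_op_bounded_clinear by auto
    have "Q \<circ> P = P \<circ> Q" by (simp flip: Q(2) add: comp_assoc)
    then have QS: "Q (S x) = S (Q x)" for x using comm[OF bQ] by (metis comp_apply)
    have SS: "S (S x) = Q (Q x)" for x using S(2) Q(2) by (metis comp_apply)
    define y where "y = S x - Q x"
    have "S y + Q y = 0"
      by (simp add: y_def bounded_clinear_diff[OF bS] bounded_clinear_diff[OF bQ] QS SS)
    then have "cinner y (S y) + cinner y (Q y) = 0" by (simp flip: cinner_add_right)
    then have "Re (cinner y (S y)) + Re (cinner y (Q y)) = 0" by (simp add: complex_eq_iff)
    then have "Re (cinner y (S y)) = 0" "Re (cinner y (Q y)) = 0"
      using positive_op_Re_nonneg[OF S(1), of y] positive_op_Re_nonneg[OF Q(1), of y] by linarith+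
    then have "cinner y (S y) = 0" "cinner y (Q y) = 0"
      using positive_op_cinner_of_real[OF S(1), of y] positive_op_cinner_of_real[OF Q(1), of y] by auto
    then have "S y = 0" "Q y = 0" using positive_op_cinner_eq_0 S(1) Q(1) by blast+
    moreover have "cinner y y = cinner x (S y) - cinner x (Q y)"
      by (subst (1) y_def) (simp only: cinner_diff_left positive_op_cinner[OF S(1)] positive_op_cinner[OF Q(1)])
    ultimately have "cinner y y = 0" by simp
    then show "Q x = S x" by (simp add: y_def)
  qed
  then show ?thesis using S by blast
qed

lemma
  assumes "bounded_clinear T"
  shows abs_op_positive: "positive_op (abs_op T)"
    and abs_op_comp: "abs_op T \<circ> abs_op T = adj T \<circ> T"
  unfolding abs_op_def using theI'[OF positive_sqrt_unique[OF positive_op_adj_comp[OF assms]]] by auto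

lemma abs_op_eqI:
  assumes "bounded_clinear T" "positive_op P" "P \<circ> P = adj T \<circ> T"
  shows "abs_op T = P"
  using positive_sqrt_unique[OF positive_op_adj_comp[OF assms(1)]] abs_op_positive abs_op_comp assms
  by blast

lemma norm_abs_op:
  assumes T: "bounded_clinear T"
  shows "norm (abs_op T x) = norm (T x)"
proof -
  have "cinner (abs_op T x) (abs_op T x) = cinner (T x) (T x)"
    using fun_cong[OF abs_op_comp[OF T], of x]
    by (simp add: positive_op_cinner[OF abs_op_positive[OF T]] cinner_adj_right[OF T])
  then have "(norm (abs_op T x))\<^sup>2 = (norm (T x))\<^sup>2" unfolding cinner_self of_real_eq_iff .
  then show ?thesis by simp
qed

lemma abs_op_of_positive: "positive_op P \<Longrightarrow> abs_op P = P"
  by (rule abs_op_eqI) (simp_all add: positive_op_bounded_clinear positive_op_adj)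

section \<open>Factorisation and polar decomposition\<close>

text \<open>A functional dominated by \<open>P\<close> is represented by a vector in the closed range of \<open>P\<close>,
  expressed as orthogonality to everything orthogonal to the range. It is the limit of \<open>P\<close> along a
  sequence minimising \<open>\<parallel>P x\<parallel>\<^sup>2 / 2 - Re (f x)\<close>.\<close>

lemma riesz_on_range:
  fixes P :: "'a::complex_inner \<Rightarrow> 'b::chilbert_space" and f :: "'a \<Rightarrow> complex"
  assumes P: "bounded_clinear P" and fa: "\<And>x y. f (x + y) = f x + f y"
    and fc: "\<And>c x. f (c *\<^sub>C x) = c * f x"
    and fK: "\<And>x. cmod (f x) \<le> K * norm (P x)" and K: "K \<ge> 0"
  shows "\<exists>v. (\<forall>x. f x = cinner v (P x)) \<and> (\<forall>u. (\<forall>x. cinner u (P x) = 0) \<longrightarrow> cinner u v = 0) \<and> norm v \<le> K"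
proof -
  define J where "J x = (norm (P x))\<^sup>2 / 2 - Re (f x)" for x
  have fr: "f (r *\<^sub>R x) = complex_of_real r * f x" for r x by (simp add: scaleR_scaleC fc)
  have Pr: "P (r *\<^sub>R x) = r *\<^sub>R P x" for r x by (simp add: scaleR_scaleC bounded_clinear_scaleC[OF P])
  \<comment> \<open>Completing the square in the norm of P x.\<close>
  have Jlow: "- (K\<^sup>2 / 2) \<le> J x" for x
  proof -
    have "Re (f x) \<le> K * norm (P x)" by (rule order_trans[OF complex_Re_le_cmod fK])
    moreover have "0 \<le> (norm (P x) - K)\<^sup>2" by simp
    ultimately show ?thesis unfolding J_def power2_diff by (simp add: algebra_simps)
  qed
  define m where "m = (INF x. J x)"
  have bdd: "bdd_below (range J)" by (rule bdd_belowI2[OF Jlow])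
  have m_le: "m \<le> J x" for x unfolding m_def by (rule cINF_lower[OF bdd]) simp
  have "\<exists>x. J x < m + 1 / real (Suc n)" for n
  proof -
    have "(INF x. J x) < m + 1 / real (Suc n)" by (simp add: m_def)
    then show ?thesis by (subst (asm) cINF_less_iff) (use bdd in auto)
  qed
  then obtain X where X: "\<And>n. J (X n) < m + 1 / real (Suc n)" by metis
  have J_lin: "J (x + t *\<^sub>R w) = J x + t * (inner (P x) (P w) - Re (f w)) + t\<^sup>2 * ((norm (P w))\<^sup>2 / 2)" for x w t
  proof -
    have "(norm (P x + t *\<^sub>R P w))\<^sup>2 = (norm (P x))\<^sup>2 + 2 * t * inner (P x) (P w) + t\<^sup>2 * (norm (P w))\<^sup>2"
      unfolding power2_norm_eq_inner by (simp add: inner_add inner_commute power2_eq_square)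
    then show ?thesis
      by (simp add: J_def bounded_clinear_add[OF P] fa fr Pr algebra_simps)
  qed
  have dist_le: "(norm (P (X n) - P (X k)))\<^sup>2 \<le> 4 * (1 / real (Suc n) + 1 / real (Suc k))" for n k
  proof -
    \<comment> \<open>Parallelogram law at the midpoint: J there is at least the infimum m, while J
      at \<open>X n\<close> and \<open>X k\<close> exceeds m by less than 1/(n+1) and
      1/(k+1).\<close>
    let ?z = "X n + (1/2) *\<^sub>R (X k - X n)"
    have fd: "f (X k - X n) = f (X k) - f (X n)" using fa[of "X k - X n" "X n"] by simp
    have e: "(norm (P (X n) - P (X k)))\<^sup>2 = (norm (P (X n)))\<^sup>2 - 2 * inner (P (X n)) (P (X k)) + (norm (P (X k)))\<^sup>2"
      unfolding power2_norm_eq_inner by (simp add: inner_diff inner_commute)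
    have "J ?z = J (X n) / 2 + J (X k) / 2 - (norm (P (X n) - P (X k)))\<^sup>2 / 8"
      unfolding J_lin fd bounded_clinear_diff[OF P] norm_minus_commute[of "P (X k)"] e inner_diff_right
      by (simp add: J_def dot_square_norm power2_eq_square field_simps)
    then show ?thesis using m_le[of ?z] X[of n] X[of k] by simp
  qed
  have "Cauchy (\<lambda>n. P (X n))"
  proof (rule CauchyI)
    fix e :: real assume e: "e > 0"
    then obtain M where M: "1 / real (Suc M) < e\<^sup>2 / 8"
      using reals_Archimedean[of "e\<^sup>2 / 8"] by (auto simp: inverse_eq_divide)
    have "norm (P (X n) - P (X k)) < e" if "n \<ge> M" "k \<ge> M" for n k
    proof -
      have "1 / real (Suc n) \<le> 1 / real (Suc M)" "1 / real (Suc k) \<le> 1 / real (Suc M)"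
        using that by (auto intro!: divide_left_mono)
      moreover have "d < e\<^sup>2" if "a \<le> c" "b \<le> c" "d \<le> 4 * (a + b)" "c < e\<^sup>2 / 8" for a b c d :: real
        using that by simp
      ultimately have "(norm (P (X n) - P (X k)))\<^sup>2 < e\<^sup>2" using dist_le[of n k] M by blast
      then show ?thesis using e by (simp add: power_less_imp_less_base)
    qed
    then show "\<exists>M. \<forall>m\<ge>M. \<forall>n\<ge>M. norm (P (X m) - P (X n)) < e" by blast
  qed
  then obtain v where v: "(\<lambda>n. P (X n)) \<longlonglongrightarrow> v" using Cauchy_convergent convergent_def by blast
  have re_eq: "inner v (P w) = Re (f w)" for w
  proof -
    have lin: "0 \<le> t * (inner v (P w) - Re (f w)) + t\<^sup>2 * ((norm (P w))\<^sup>2 / 2)" for t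
    proof (rule LIMSEQ_le)
      show "(\<lambda>n. - (1 / real (Suc n))) \<longlonglongrightarrow> 0"
        using LIMSEQ_inverse_real_of_nat_add_minus[of 0] by (simp add: inverse_eq_divide)
      show "(\<lambda>n. t * (inner (P (X n)) (P w) - Re (f w)) + t\<^sup>2 * ((norm (P w))\<^sup>2 / 2))
          \<longlonglongrightarrow> t * (inner v (P w) - Re (f w)) + t\<^sup>2 * ((norm (P w))\<^sup>2 / 2)"
        by (intro tendsto_intros v)
      have "- (1 / real (Suc n)) \<le> t * (inner (P (X n)) (P w) - Re (f w)) + t\<^sup>2 * ((norm (P w))\<^sup>2 / 2)" for n
        using m_le[of "X n + t *\<^sub>R w"] X[of n] unfolding J_lin by linarith
      then show "\<exists>N. \<forall>n\<ge>N. - (1 / real (Suc n)) \<le> t * (inner (P (X n)) (P w) - Re (f w)) + t\<^sup>2 * ((norm (P w))\<^sup>2 / 2)"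
        by blast
    qed
    define a where "a = inner v (P w) - Re (f w)"
    define b where "b = (norm (P w))\<^sup>2 / 2"
    have b0: "b \<ge> 0" by (simp add: b_def)
    \<comment> \<open>At t = -r the quadratic inequality collapses to 0 <= -r^2; the 1 in the
      denominator covers P w = 0.\<close>
    define r where "r = a / (b + 1)"
    have a: "a = r * (b + 1)" using b0 by (simp add: r_def)
    have "0 \<le> (- r) * a + (- r)\<^sup>2 * b" using lin[of "- r"] by (simp only: a_def b_def)
    also have "\<dots> = - (r\<^sup>2)" by (simp add: a power2_eq_square algebra_simps)
    finally have "r = 0" by simp
    then have "a = 0" by (simp add: a)
    then show ?thesis by (simp add: a_def)
  qed
  have fv: "f x = cinner v (P x)" for x
  proof (rule complex_eqI)
    show "Re (f x) = Re (cinner v (P x))" by (simp add: Re_cinner re_eq)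
    have "Re (cinner v (P (\<i> *\<^sub>C x))) = Re (f (\<i> *\<^sub>C x))" by (simp add: Re_cinner re_eq)
    then show "Im (f x) = Im (cinner v (P x))"
      by (simp add: fc bounded_clinear_scaleC[OF P] cinner_scaleC_right)
  qed
  moreover have "cinner u v = 0" if "\<forall>x. cinner u (P x) = 0" for u
    using LIMSEQ_unique[OF tendsto_cinner[OF tendsto_const[of u] v]] that by simp
  moreover have "norm v \<le> K"
  proof -
    have "(\<lambda>n. cmod (cinner v (P (X n)))) \<longlonglongrightarrow> cmod (cinner v v)"
      by (intro tendsto_norm tendsto_cinner tendsto_const v)
    moreover have "(\<lambda>n. K * norm (P (X n))) \<longlonglongrightarrow> K * norm v" by (intro tendsto_intros v)
    ultimately have "cmod (cinner v v) \<le> K * norm v"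
      by (rule LIMSEQ_le) (use fK fv in simp)
    then have "norm v * norm v \<le> K * norm v" by (simp add: cinner_self power2_eq_square norm_mult)
    then show ?thesis using K by (cases "norm v = 0") auto
  qed
  ultimately show ?thesis by blast
qed

text \<open>The adjoint of U is constructed first: for each z the functional <z, T x> is dominated
  by |P x| and is represented by a vector W z in the closed range of P. There the representing
  vector is unique, which makes W linear.\<close>

lemma douglas_factorization:
  fixes P :: "'a::chilbert_space \<Rightarrow> 'b::chilbert_space" and T :: "'a \<Rightarrow> 'c::chilbert_space"
  assumes P: "bounded_clinear P" and T: "bounded_clinear T" and c: "c \<ge> 0"
    and le: "\<And>x. norm (T x) \<le> c * norm (P x)"
  shows "\<exists>U. bounded_clinear U \<and> (\<forall>y. norm (U y) \<le> c * norm y) \<and> T = U \<circ> P"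
proof -
  have "\<exists>v. (\<forall>x. cinner z (T x) = cinner v (P x)) \<and> (\<forall>u. (\<forall>x. cinner u (P x) = 0) \<longrightarrow> cinner u v = 0)
      \<and> norm v \<le> c * norm z" for z
  proof (rule riesz_on_range[OF P])
    show "cmod (cinner z (T x)) \<le> c * norm z * norm (P x)" for x
      using mult_left_mono[OF le[of x] norm_ge_zero[of z]]
      by (intro order_trans[OF cinner_bound]) (simp add: mult_ac)
  qed (simp_all add: bounded_clinear_add[OF T] bounded_clinear_scaleC[OF T] cinner_add_right cinner_scaleC_right c)
  then obtain W where W: "\<And>z x. cinner z (T x) = cinner (W z) (P x)"
    "\<And>z u. (\<And>x. cinner u (P x) = 0) \<Longrightarrow> cinner u (W z) = 0" "\<And>z. norm (W z) \<le> c * norm z"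
    by metis
  \<comment> \<open>Such d lies in the range's orthogonal complement and also in the complement of
    that complement; take u = d.\<close>
  have uniq: "d = 0" if "\<And>x. cinner d (P x) = 0" "(\<And>u. (\<And>x. cinner u (P x) = 0) \<Longrightarrow> cinner u d = 0)" for d
    using that(2)[of d] that(1) by simp
  have bW: "bounded_clinear W"
  proof (rule bounded_clinear_intro[where K=c])
    show "W (x + y) = W x + W y" for x y
    proof -
      have "W (x + y) - (W x + W y) = 0"
        by (rule uniq) (simp_all add: cinner_diff_left cinner_diff_right cinner_add_left cinner_add_right W(2) W(1)[symmetric])
      then show ?thesis by simp
    qed
    show "W (a *\<^sub>C x) = a *\<^sub>C W x" for a x
    proof -
      have "W (a *\<^sub>C x) - a *\<^sub>C W x = 0"
        by (rule uniq) (simp_all add: cinner_diff_left cinner_diff_right cinner_scaleC_left cinner_scaleC_right W(2) W(1)[symmetric])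
      then show ?thesis by simp
    qed
  qed (simp add: W(3) mult.commute)
  show ?thesis
  proof (intro exI[of _ "adj W"] conjI allI)
    show "norm (adj W y) \<le> c * norm y" for y by (rule adj_norm_le[OF bW c W(3)])
    show "T = adj W \<circ> P"
    proof
      show "T x = (adj W \<circ> P) x" for x
        by (rule cinner_eqI) (simp add: W(1) cinner_adj_right[OF bW])
    qed
  qed (rule adj_bounded_clinear[OF bW])
qed

lemma polar_decomposition:
  assumes T: "bounded_clinear (T::'a::chilbert_space \<Rightarrow> 'a)"
  shows "\<exists>U. bounded_clinear U \<and> (\<forall>y. norm (U y) \<le> norm y) \<and> T = U \<circ> abs_op T"
  using douglas_factorization[OF positive_op_bounded_clinear[OF abs_op_positive[OF T]] T, of 1]
  by (simp add: norm_abs_op[OF T])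

text \<open>|T x| equals the norm of \<open>abs_op T x\<close>, so the factorisation runs both ways.
  In this direction the absolute value inherits every factorisation of T.\<close>

lemma polar_decomposition_inverse:
  assumes T: "bounded_clinear (T::'a::chilbert_space \<Rightarrow> 'a)"
  shows "\<exists>W. bounded_clinear W \<and> (\<forall>y. norm (W y) \<le> norm y) \<and> abs_op T = W \<circ> T"
  using douglas_factorization[OF T positive_op_bounded_clinear[OF abs_op_positive[OF T]], of 1]
  by (simp add: norm_abs_op[OF T])

section \<open>Hilbert-Schmidt operators\<close>

lemma isometry_inner:
  fixes F :: "'a::real_inner \<Rightarrow> 'b::real_inner"
  assumes "F (x + y) = F x + F y" "\<And>x. norm (F x) = norm x"
  shows "inner (F x) (F y) = inner x y"
proof -
  have "(norm (F x + F y))\<^sup>2 = (norm (x + y))\<^sup>2" by (simp add: assms(2) flip: assms(1))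
  moreover have "inner (F x) (F x) = inner x x" "inner (F y) (F y) = inner y y"
    by (simp_all add: dot_square_norm assms(2))
  ultimately show ?thesis
    by (simp add: power2_norm_eq_inner inner_add inner_commute)
qed

lemma cinner_Complex: "cinner x y = Complex (inner x y) (inner (\<i> *\<^sub>C x) (y::'a::complex_inner))"
  by (rule complex_eqI) (simp_all flip: Re_cinner add: cinner_scaleC_left)

lemma isometry_cinner:
  fixes F :: "'a::complex_inner \<Rightarrow> 'b::complex_inner"
  assumes "\<And>x y. F (x + y) = F x + F y" "\<And>c x. F (c *\<^sub>C x) = c *\<^sub>C F x" "\<And>x. norm (F x) = norm x"
  shows "cinner (F x) (F y) = cinner x y"
  unfolding cinner_Complex assms(2)[symmetric] by (simp add: isometry_inner[OF assms(1) assms(3)])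

lemma antilinear_isometry_cinner:
  fixes F :: "'a::complex_inner \<Rightarrow> 'b::complex_inner"
  assumes "\<And>x y. F (x + y) = F x + F y" "\<And>c x. F (c *\<^sub>C x) = cnj c *\<^sub>C F x" "\<And>x. norm (F x) = norm x"
  shows "cinner (F x) (F y) = cinner y x"
proof -
  have e: "\<i> *\<^sub>C F x = F ((- \<i>) *\<^sub>C x)" using assms(2)[of "- \<i>" x] by simp
  have "cinner (F x) (F y) = Complex (inner x y) (inner ((- \<i>) *\<^sub>C x) y)"
    unfolding cinner_Complex[of "F x"] e by (simp add: isometry_inner[OF assms(1) assms(3)])
  also have "\<dots> = cnj (cinner x y)" unfolding cinner_Complex by (simp add: cvec.scale_minus_left complex_eq_iff)
  finally show ?thesis by (metis cinner_commute)
qed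

lemma hilbert_schmidt_hs_apply: "hilbert_schmidt (hs_apply T)"
  using hs_apply[of T] by simp

lemma hs_apply_Abs_hs: "hilbert_schmidt T \<Longrightarrow> hs_apply (Abs_hs T) = T"
  by (simp add: Abs_hs_inverse)

lemma hs_eqI: "(\<And>x. hs_apply S x = hs_apply T x) \<Longrightarrow> S = T"
  by (simp add: hs_apply_inject[symmetric] fun_eq_iff)

lemma hs_apply_add: "hs_apply (S + T) x = hs_apply S x + hs_apply T x"
  by (simp add: plus_hs.rep_eq)

lemma hs_apply_scaleC: "hs_apply (c *\<^sub>C T) x = c *\<^sub>C hs_apply T x"
  by (simp add: scaleC_hs.rep_eq)

lemma hs_apply_zero: "hs_apply 0 x = 0"
  by (simp add: zero_hs.rep_eq)

lemma hs_apply_sum: "hs_apply (sum f A) x = (\<Sum>i\<in>A. hs_apply (f i) x)"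
  by (induction A rule: infinite_finite_induct) (simp_all add: hs_apply_zero hs_apply_add)

lemma hs_norm_has_sum_some_onb: "((\<lambda>e. (norm (hs_apply T e))\<^sup>2) has_sum (norm T)\<^sup>2) some_onb"
proof -
  let ?v = "hs_values (hs_apply T)"
  have "((\<lambda>e. (norm (ell2_nth ?v e))\<^sup>2) has_sum (norm T)\<^sup>2) UNIV"
    unfolding hs_norm_values ell2_norm_power2 by (rule has_sum_infsum[OF ell2_nth_summable])
  then show ?thesis
    by (subst (asm) has_sum_cong_neutral[where T=some_onb and g="\<lambda>e. (norm (hs_apply T e))\<^sup>2"])
      (auto simp: ell2_nth_hs_values[OF hilbert_schmidt_hs_apply])
qed

text \<open>Tonelli: for nonnegative terms the iterated sum in one order gives joint summability,
  hence the other order.\<close>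

lemma nonneg_has_sum_swap:
  fixes f :: "'x \<Rightarrow> 'y \<Rightarrow> real"
  assumes rows: "\<And>x. x \<in> A \<Longrightarrow> (f x has_sum g x) B" and g: "(g has_sum s) A"
    and cols: "\<And>y. y \<in> B \<Longrightarrow> ((\<lambda>x. f x y) has_sum h y) A" and nonneg: "\<And>x y. f x y \<ge> 0"
  shows "(h has_sum s) B"
proof -
  have summ: "(\<lambda>(x, y). f x y) summable_on Sigma A (\<lambda>_. B)"
    by (rule summable_on_SigmaI[where g=g]) (use rows has_sum_imp_summable[OF g] nonneg in auto)
  have "(\<Sum>\<^sub>\<infinity>x\<in>A. \<Sum>\<^sub>\<infinity>y\<in>B. f x y) = (\<Sum>\<^sub>\<infinity>y\<in>B. \<Sum>\<^sub>\<infinity>x\<in>A. f x y)"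
    by (rule infsum_swap_banach) (use summ in simp)
  moreover have "(\<Sum>\<^sub>\<infinity>x\<in>A. \<Sum>\<^sub>\<infinity>y\<in>B. f x y) = (\<Sum>\<^sub>\<infinity>x\<in>A. g x)"
    by (rule infsum_cong) (rule infsumI[OF rows])
  moreover have h: "(\<Sum>\<^sub>\<infinity>x\<in>A. f x y) = h y" if "y \<in> B" for y
    by (rule infsumI[OF cols[OF that]])
  ultimately have "infsum h B = s"
    using infsumI[OF g] by (simp cong: infsum_cong)
  moreover have "(\<lambda>(y, x). f x y) summable_on Sigma B (\<lambda>_. A)"
    by (subst summable_on_swap) (use summ in simp)
  then have "(\<lambda>y. \<Sum>\<^sub>\<infinity>x\<in>A. f x y) summable_on B"
    using summable_on_Sigma_banach[of "\<lambda>y x. f x y" B "\<lambda>_. A"] by simp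
  then have "h summable_on B"
    using h by (simp cong: summable_on_cong)
  ultimately show ?thesis by (metis has_sum_infsum)
qed

text \<open>The double sum of |<f, T e>|^2 over both bases, read by rows and by columns, is
  Parseval's identity on each side.\<close>

lemma hilbert_schmidt_adj_has_sum:
  assumes T: "bounded_clinear T" and B: "is_onb B" and C: "is_onb C"
    and sum: "((\<lambda>e. (norm (T e))\<^sup>2) has_sum s) B"
  shows "((\<lambda>f. (norm (adj T f))\<^sup>2) has_sum s) C"
proof (rule nonneg_has_sum_swap[OF parseval[OF C] sum])
  show "((\<lambda>e. (cmod (cinner f (T e)))\<^sup>2) has_sum (norm (adj T f))\<^sup>2) B" for f
  proof -
    have "(cmod (cinner f (T e)))\<^sup>2 = (cmod (cinner e (adj T f)))\<^sup>2" for e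
      by (metis T cinner_adj_left cinner_commute complex_mod_cnj)
    then show ?thesis using parseval[OF B, of "adj T f"] by simp
  qed
qed simp

lemma hilbert_schmidt_adj:
  assumes "hilbert_schmidt T"
  shows "hilbert_schmidt (adj T)"
proof (rule hilbert_schmidtI)
  show "bounded_clinear (adj T)"
    by (rule adj_bounded_clinear[OF hilbert_schmidt_bounded_clinear[OF assms]])
  show "(\<lambda>f. (norm (adj T f))\<^sup>2) summable_on some_onb"
    by (rule hilbert_schmidt_adj_summable[OF hilbert_schmidt_bounded_clinear[OF assms] some_onb_is_onb
          some_onb_is_onb hilbert_schmidt_summable[OF assms some_onb_is_onb]])
qed

lift_definition hs_adj :: "('a::chilbert_space, 'b::chilbert_space) hs \<Rightarrow> ('b, 'a) hs" is adj
  by (rule hilbert_schmidt_adj)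

text \<open>Passing to the adjoint lets the basis change; doing it twice leads from
  \<open>some_onb\<close> to B.\<close>

lemma hs_norm_has_sum:
  assumes "is_onb B"
  shows "((\<lambda>e. (norm (hs_apply T e))\<^sup>2) has_sum (norm T)\<^sup>2) B"
proof -
  have T: "bounded_clinear (hs_apply T)" by (rule hs_apply_bounded_clinear)
  have "((\<lambda>e. (norm (adj (hs_apply T) e))\<^sup>2) has_sum (norm T)\<^sup>2) some_onb"
    by (rule hilbert_schmidt_adj_has_sum[OF T some_onb_is_onb some_onb_is_onb hs_norm_has_sum_some_onb])
  from hilbert_schmidt_adj_has_sum[OF adj_bounded_clinear[OF T] some_onb_is_onb assms this]
  show ?thesis by (simp add: adj_adj[OF T])
qed

lemma norm_hs_adj: "norm (hs_adj T) = norm T"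
proof -
  have "((\<lambda>e. (norm (hs_apply (hs_adj T) e))\<^sup>2) has_sum (norm T)\<^sup>2) some_onb"
    unfolding hs_adj.rep_eq
    by (rule hilbert_schmidt_adj_has_sum[OF hs_apply_bounded_clinear some_onb_is_onb some_onb_is_onb hs_norm_has_sum_some_onb])
  from has_sum_unique[OF this hs_norm_has_sum_some_onb] show ?thesis by simp
qed

lemma adj_plus:
  assumes "bounded_clinear S" "bounded_clinear T"
  shows "adj (\<lambda>x. S x + T x) = (\<lambda>y. adj S y + adj T y)"
  by (rule adj_eqI) (simp_all add: assms bounded_clinear_plus cinner_add_left cinner_add_right cinner_adj_left)

lemma adj_scaleC:
  assumes "bounded_clinear T"
  shows "adj (\<lambda>x. c *\<^sub>C T x) = (\<lambda>y. cnj c *\<^sub>C adj T y)"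
  by (rule adj_eqI) (simp_all add: assms bounded_clinear_scale cinner_scaleC_left cinner_scaleC_right cinner_adj_left)

lemma hs_adj_add: "hs_adj (S + T) = hs_adj S + hs_adj T"
  by transfer (simp add: adj_plus hilbert_schmidt_bounded_clinear)

lemma hs_adj_scaleC: "hs_adj (c *\<^sub>C T) = cnj c *\<^sub>C hs_adj T"
  by transfer (simp add: adj_scaleC hilbert_schmidt_bounded_clinear)

lemma hs_adj_adj [simp]: "hs_adj (hs_adj T) = T"
  by transfer (simp add: adj_adj hilbert_schmidt_bounded_clinear)

lemma cinner_hs_adj: "cinner (hs_adj S) (hs_adj T) = cinner T S"
  by (rule antilinear_isometry_cinner) (simp_all add: hs_adj_add hs_adj_scaleC norm_hs_adj)

lemma cinner_polarization:
  "4 * cinner x y = complex_of_real ((norm (x + y))\<^sup>2) - complex_of_real ((norm (x - y))\<^sup>2)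
    - \<i> * complex_of_real ((norm (x + \<i> *\<^sub>C y))\<^sup>2) + \<i> * complex_of_real ((norm (x - \<i> *\<^sub>C (y::'a::complex_inner)))\<^sup>2)"
  unfolding cinner_self[symmetric]
  by (simp add: cinner_add_left cinner_add_right cinner_diff_left cinner_diff_right cinner_scaleC_left
      cinner_scaleC_right algebra_simps)

text \<open>The norm identity holds for every operator, and polarisation transfers it to pairs,
  convergence included.\<close>

lemma hs_cinner_has_sum:
  assumes B: "is_onb B"
  shows "((\<lambda>e. cinner (hs_apply S e) (hs_apply T e)) has_sum cinner S T) B"
proof -
  have n: "((\<lambda>e. complex_of_real ((norm (hs_apply U e))\<^sup>2)) has_sum complex_of_real ((norm U)\<^sup>2)) B" for U :: "('a, 'b) hs"
    by (rule has_sum_of_real[OF hs_norm_has_sum[OF B]])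
  have d: "((\<lambda>e. f e - g e) has_sum a - b) B" if "(f has_sum a) B" "(g has_sum b) B" for f g :: "'a \<Rightarrow> complex" and a b
    using has_sum_add[OF that(1), of "\<lambda>e. - g e" "- b"] that(2) by (simp add: has_sum_uminus)
  have "((\<lambda>e. 4 * cinner (hs_apply S e) (hs_apply T e)) has_sum 4 * cinner S T) B"
    unfolding cinner_polarization hs_apply_add[symmetric] hs_apply_minus[symmetric] hs_apply_scaleC[symmetric]
    by (intro has_sum_add d has_sum_cmult_right n)
  from has_sum_cmult_right[OF this, of "1 / 4"] show ?thesis by simp
qed

lemma
  assumes a: "bounded_clinear a" and K: "K \<ge> 0" "\<And>x. norm (a x) \<le> K * norm x"
  shows hilbert_schmidt_comp_left': "hilbert_schmidt (a \<circ> hs_apply T)"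
    and norm_hs_comp_left': "norm (Abs_hs (a \<circ> hs_apply T)) \<le> K * norm T"
proof -
  have le: "(norm ((a \<circ> hs_apply T) e))\<^sup>2 \<le> K\<^sup>2 * (norm (hs_apply T e))\<^sup>2" for e
    using power_mono[OF K(2)[of "hs_apply T e"], of 2] by (simp add: power_mult_distrib)
  have s: "((\<lambda>e. K\<^sup>2 * (norm (hs_apply T e))\<^sup>2) has_sum K\<^sup>2 * (norm T)\<^sup>2) some_onb"
    by (rule has_sum_cmult_right[OF hs_norm_has_sum_some_onb])
  show hs: "hilbert_schmidt (a \<circ> hs_apply T)"
  proof (rule hilbert_schmidtI[OF bounded_clinear_compose[OF a hs_apply_bounded_clinear]])
    show "(\<lambda>e. (norm ((a \<circ> hs_apply T) e))\<^sup>2) summable_on some_onb"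
      by (rule summable_on_comparison_test[OF has_sum_imp_summable[OF s]]) (use le in auto)
  qed
  have "((\<lambda>e. (norm ((a \<circ> hs_apply T) e))\<^sup>2) has_sum (norm (Abs_hs (a \<circ> hs_apply T)))\<^sup>2) some_onb"
    using hs_norm_has_sum_some_onb[of "Abs_hs (a \<circ> hs_apply T)"] by (simp add: hs_apply_Abs_hs[OF hs])
  then have "(norm (Abs_hs (a \<circ> hs_apply T)))\<^sup>2 \<le> K\<^sup>2 * (norm T)\<^sup>2"
    using s by (rule has_sum_mono) (use le in auto)
  then show "norm (Abs_hs (a \<circ> hs_apply T)) \<le> K * norm T"
    using K(1) by (metis mult_nonneg_nonneg norm_ge_zero power2_le_imp_le power_mult_distrib)
qed

definition hs_lcomp :: "('b::chilbert_space \<Rightarrow> 'c::chilbert_space) \<Rightarrow> ('a::chilbert_space, 'b) hs \<Rightarrow> ('a, 'c) hs"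
  where "hs_lcomp a T = Abs_hs (a \<circ> hs_apply T)"

lemma hs_apply_lcomp:
  assumes "bounded_clinear a"
  shows "hs_apply (hs_lcomp a T) = a \<circ> hs_apply T"
  unfolding hs_lcomp_def
  by (rule hs_apply_Abs_hs hilbert_schmidt_comp_left'[where K="onorm a"] assms
      bounded_clinear_onorm_pos_le bounded_clinear_norm_le)+

lemma norm_hs_lcomp_le:
  assumes "bounded_clinear a" "K \<ge> 0" "\<And>x. norm (a x) \<le> K * norm x"
  shows "norm (hs_lcomp a T) \<le> K * norm T"
  unfolding hs_lcomp_def by (rule norm_hs_comp_left'[OF assms])

lemma bounded_clinear_hs_lcomp:
  assumes a: "bounded_clinear a"
  shows "bounded_clinear (hs_lcomp a)"
proof (rule bounded_clinear_intro[where K="onorm a"])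
  show "hs_lcomp a (S + T) = hs_lcomp a S + hs_lcomp a T" for S T
    by (rule hs_eqI) (simp add: hs_apply_lcomp[OF a] hs_apply_add bounded_clinear_add[OF a])
  show "hs_lcomp a (c *\<^sub>C T) = c *\<^sub>C hs_lcomp a T" for c T
    by (rule hs_eqI) (simp add: hs_apply_lcomp[OF a] hs_apply_scaleC bounded_clinear_scaleC[OF a])
  show "norm (hs_lcomp a T) \<le> norm T * onorm a" for T
    using norm_hs_lcomp_le[OF a bounded_clinear_onorm_pos_le[OF a] bounded_clinear_norm_le[OF a]]
    by (simp add: mult.commute)
qed

lemma hs_lcomp_comp:
  assumes "bounded_clinear a" "bounded_clinear b"
  shows "hs_lcomp a (hs_lcomp b T) = hs_lcomp (a \<circ> b) T"
  by (rule hs_eqI) (simp add: hs_apply_lcomp assms bounded_clinear_compose)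

lemma cinner_hs_lcomp:
  assumes a: "bounded_clinear a"
  shows "cinner (hs_lcomp a S) T = cinner S (hs_lcomp (adj a) T)"
  unfolding cinner_hs_eq hs_apply_lcomp[OF a] hs_apply_lcomp[OF adj_bounded_clinear[OF a]]
  by (simp add: cinner_adj_right[OF a])

lemma adj_hs_lcomp:
  assumes a: "bounded_clinear a"
  shows "adj (hs_lcomp a) = hs_lcomp (adj a)"
  by (rule adj_eqI[OF bounded_clinear_hs_lcomp[OF a]])
    (simp add: cinner_hs_lcomp[OF adj_bounded_clinear[OF a]] adj_adj[OF a])

lemma hilbert_schmidt_comp_left:
  assumes "bounded_clinear a" "hilbert_schmidt T"
  shows "hilbert_schmidt (a \<circ> T)"
  using hilbert_schmidt_hs_apply[of "hs_lcomp a (Abs_hs T)"] assms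
  by (simp add: hs_apply_lcomp hs_apply_Abs_hs)

lemma hilbert_schmidt_comp_right:
  assumes "hilbert_schmidt T" "bounded_clinear a"
  shows "hilbert_schmidt (T \<circ> a)"
proof -
  have T: "bounded_clinear T" by (rule hilbert_schmidt_bounded_clinear[OF assms(1)])
  have "hilbert_schmidt (adj (adj a \<circ> adj T))"
    by (intro hilbert_schmidt_adj hilbert_schmidt_comp_left adj_bounded_clinear assms)
  then show ?thesis by (simp add: adj_compose adj_bounded_clinear adj_adj assms(2) T)
qed

subsection \<open>Operators of rank one\<close>

text \<open>The operator |x><y|, taken as an element of the Hilbert space so that pairing with it
  reads off matrix entries.\<close>

lift_definition ketbra :: "'b::chilbert_space \<Rightarrow> 'a::chilbert_space \<Rightarrow> ('a, 'b) hs"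
  is "\<lambda>x y z. cinner y z *\<^sub>C x"
proof (rule hilbert_schmidtI)
  fix x :: 'b and y :: 'a
  show "bounded_clinear (\<lambda>z. cinner y z *\<^sub>C x)"
  proof (rule bounded_clinear_intro[where K="norm y * norm x"])
    show "norm (cinner y z *\<^sub>C x) \<le> norm z * (norm y * norm x)" for z
      using mult_right_mono[OF cinner_bound[of y z] norm_ge_zero[of x]]
      by (simp add: norm_scaleC mult_ac)
  qed (simp_all add: cinner_add_right scaleC_add_left cinner_scaleC_right scaleC_scaleC)
  have "(\<lambda>e. (cmod (cinner e y))\<^sup>2 * (norm x)\<^sup>2) summable_on some_onb"
    using some_onb_is_onb[where 'a='a]
    by (intro summable_on_cmult_left bessel_summable) (simp add: is_onb_def)
  moreover have "(cmod (cinner e y))\<^sup>2 * (norm x)\<^sup>2 = (norm (cinner y e *\<^sub>C x))\<^sup>2" for e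
    by (subst cinner_commute) (simp add: norm_scaleC power_mult_distrib)
  ultimately show "(\<lambda>e. (norm (cinner y e *\<^sub>C x))\<^sup>2) summable_on some_onb" by simp
qed

lemma ketbra_apply: "hs_apply (ketbra x y) z = cinner y z *\<^sub>C x"
  by (simp add: ketbra.rep_eq)

lemma cinner_ketbra_left: "cinner (ketbra x y) T = cinner x (hs_apply T y)"
proof -
  have "((\<lambda>e. cinner (adj (hs_apply T) x) e * cinner e y) has_sum cinner (adj (hs_apply T) x) y) some_onb"
    by (rule onb_cinner_has_sum[OF some_onb_is_onb])
  moreover have "cinner (adj (hs_apply T) x) e * cinner e y = cinner (hs_apply (ketbra x y) e) (hs_apply T e)" for e
    by (simp add: ketbra_apply cinner_scaleC_left cinner_adj_left[OF hs_apply_bounded_clinear] flip: cinner_commute[of e y])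
  ultimately show ?thesis
    unfolding cinner_hs_eq by (simp add: infsumI cinner_adj_left[OF hs_apply_bounded_clinear])
qed

lemma hs_adj_ketbra: "hs_adj (ketbra x y) = ketbra y x"
proof -
  have "adj (hs_apply (ketbra x y)) = hs_apply (ketbra y x)"
    by (rule adj_eqI[OF hs_apply_bounded_clinear])
      (simp add: ketbra_apply cinner_scaleC_left cinner_scaleC_right flip: cinner_commute)
  then show ?thesis by (simp add: hs_apply_inject[symmetric] hs_adj.rep_eq)
qed

lemma norm_ketbra: "norm (ketbra x y) = norm x * norm y"
proof -
  have "cinner (ketbra x y) (ketbra x y) = cinner y y * cinner x x"
    by (simp add: cinner_ketbra_left ketbra_apply cinner_scaleC_right)
  then have "complex_of_real ((norm (ketbra x y))\<^sup>2) = complex_of_real ((norm x * norm y)\<^sup>2)"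
    unfolding cinner_self by (simp add: power_mult_distrib)
  then have "(norm (ketbra x y))\<^sup>2 = (norm x * norm y)\<^sup>2" unfolding of_real_eq_iff .
  then show ?thesis by simp
qed

section \<open>Trace-class operators\<close>

text \<open>The product of A with the adjoint of B. The middle space is left free: it can be H_1
  itself, a sum of copies of H_1 for ampliations, or a space of families for Kraus
  operators.\<close>

definition hs_prod :: "('c::chilbert_space, 'a::chilbert_space) hs \<Rightarrow> ('c, 'b::chilbert_space) hs \<Rightarrow> ('b \<Rightarrow> 'a)"
  where "hs_prod A B = hs_apply A \<circ> adj (hs_apply B)"

lemma bounded_clinear_hs_prod: "bounded_clinear (hs_prod A B)"
  unfolding hs_prod_def by (intro bounded_clinear_compose adj_bounded_clinear hs_apply_bounded_clinear)

lemma cinner_hs_prod: "cinner x (hs_prod A B y) = cinner (hs_apply (hs_adj A) x) (hs_apply (hs_adj B) y)"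
  by (simp add: hs_prod_def hs_adj.rep_eq cinner_adj_left[OF hs_apply_bounded_clinear])

text \<open>Each term pairs A^* e with B^* e, and passing to adjoints reverses the Hilbert-Schmidt
  inner product.\<close>

lemma cinner_hs_prod_has_sum:
  assumes "is_onb C"
  shows "((\<lambda>e. cinner e (hs_prod A B e)) has_sum cinner B A) C"
  unfolding cinner_hs_prod using hs_cinner_has_sum[OF assms] cinner_hs_adj by metis

lemma cinner_hs_prod_bound: "cmod (cinner x (hs_prod A B y)) \<le> norm A * norm B * (norm x * norm y)"
proof -
  have "cmod (cinner x (hs_prod A B y)) \<le> norm (hs_apply (hs_adj A) x) * norm (hs_apply (hs_adj B) y)"
    unfolding cinner_hs_prod by (rule cinner_bound)
  also have "\<dots> \<le> (norm (hs_adj A) * norm x) * (norm (hs_adj B) * norm y)"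
    by (intro mult_mono hs_norm_le) (auto intro: mult_nonneg_nonneg)
  finally show ?thesis by (simp add: norm_hs_adj mult_ac)
qed

lemma trace_hs_prod: "trace (hs_prod A B) = cinner B A"
  unfolding trace_def by (rule infsumI[OF cinner_hs_prod_has_sum[OF some_onb_is_onb]])

lemma comp_hs_prod: "bounded_clinear a \<Longrightarrow> a \<circ> hs_prod A B = hs_prod (hs_lcomp a A) B"
  by (simp add: hs_prod_def hs_apply_lcomp comp_assoc)

lemma hs_prod_comp:
  assumes "bounded_clinear a"
  shows "hs_prod A B \<circ> a = hs_prod A (hs_lcomp (adj a) B)"
  by (simp add: hs_prod_def hs_apply_lcomp adj_bounded_clinear assms adj_compose hs_apply_bounded_clinear adj_adj comp_assoc)

lemma hs_prod_add_left: "hs_prod (A + A') B x = hs_prod A B x + hs_prod A' B x"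
  by (simp add: hs_prod_def hs_apply_add)

lemma hs_prod_scaleC_left: "hs_prod (c *\<^sub>C A) B x = c *\<^sub>C hs_prod A B x"
  by (simp add: hs_prod_def hs_apply_scaleC)

lemma hs_prod_add_right: "hs_prod A (B + B') x = hs_prod A B x + hs_prod A B' x"
  by (simp add: hs_prod_def plus_hs.rep_eq adj_plus hs_apply_bounded_clinear bounded_clinear_add[OF hs_apply_bounded_clinear])

lemma hs_prod_scaleC_right: "hs_prod A (c *\<^sub>C B) x = cnj c *\<^sub>C hs_prod A B x"
  by (simp add: hs_prod_def scaleC_hs.rep_eq adj_scaleC hs_apply_bounded_clinear bounded_clinear_scaleC[OF hs_apply_bounded_clinear])

lemma hs_prod_ketbra: "hs_prod (ketbra x g) (ketbra y h) = hs_apply (cinner g h *\<^sub>C ketbra x y)"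
  unfolding hs_prod_def hs_adj.rep_eq[symmetric] hs_adj_ketbra
  by (simp add: fun_eq_iff ketbra_apply hs_apply_scaleC cinner_scaleC_right scaleC_scaleC mult.commute)

lemma positive_op_hs_prod: "positive_op (hs_prod A A)"
  using positive_op_adj_comp[OF hs_apply_bounded_clinear[of "hs_adj A"]]
  by (simp add: hs_prod_def hs_adj.rep_eq adj_adj hs_apply_bounded_clinear)

lemma hs_prod_trace_class_aux:
  "\<exists>W. bounded_clinear W \<and> (\<forall>y. norm (W y) \<le> norm y) \<and> abs_op (hs_prod A B) = hs_prod (hs_lcomp W A) B"
  using polar_decomposition_inverse[OF bounded_clinear_hs_prod[of A B]] comp_hs_prod by metis

lemma trace_class_hs_prod: "trace_class (hs_prod A B)"
  unfolding trace_class_def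
  using hs_prod_trace_class_aux[of A B] cinner_hs_prod_has_sum[OF some_onb_is_onb] bounded_clinear_hs_prod
    some_onb_is_onb has_sum_imp_summable by metis

text \<open>The absolute value is W A B^* for a contraction W, so its trace is <B, W A> and the
  Cauchy-Schwarz inequality applies.\<close>

lemma trace_norm_hs_prod_le: "trace_norm (hs_prod A B) \<le> norm A * norm B"
proof -
  obtain W where W: "bounded_clinear W" "\<And>y. norm (W y) \<le> norm y" "abs_op (hs_prod A B) = hs_prod (hs_lcomp W A) B"
    using hs_prod_trace_class_aux by metis
  have "trace_norm (hs_prod A B) = Re (cinner B (hs_lcomp W A))"
    by (simp add: trace_norm_def W(3) trace_hs_prod)
  also have "\<dots> \<le> norm B * norm (hs_lcomp W A)" by (rule order_trans[OF complex_Re_le_cmod cinner_bound])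
  also have "\<dots> \<le> norm B * (1 * norm A)"
    by (intro mult_left_mono norm_hs_lcomp_le W(1)) (simp_all add: W(2))
  finally show ?thesis by (simp add: mult.commute)
qed

text \<open>The positive root R satisfies |R e|^2 = <e, P e>, so it is Hilbert-Schmidt.\<close>

lemma positive_trace_class_factor:
  assumes P: "positive_op P" and B: "is_onb B" and s: "(\<lambda>e. cinner e (P e)) summable_on B"
  shows "\<exists>R. P = hs_prod R R \<and> hs_adj R = R"
proof -
  obtain R where R: "positive_op R" "R \<circ> R = P" using positive_sqrt_exists[OF P] .
  have bR: "bounded_clinear R" by (rule positive_op_bounded_clinear[OF R(1)])
  have "cinner e (P e) = complex_of_real ((norm (R e))\<^sup>2)" for e
    by (simp add: R(2)[symmetric] cinner_self flip: positive_op_cinner[OF R(1), of e])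
  with s have "(\<lambda>e. complex_of_real ((norm (R e))\<^sup>2)) summable_on B" by simp
  then have "(\<lambda>e. Re (complex_of_real ((norm (R e))\<^sup>2))) summable_on B" by (rule summable_on_Re)
  then have "(\<lambda>e. (norm (R e))\<^sup>2) summable_on B" unfolding Re_complex_of_real .
  then have hs: "hilbert_schmidt R" unfolding hilbert_schmidt_def using bR B by blast
  have "P = hs_prod (Abs_hs R) (Abs_hs R)"
    by (simp add: hs_prod_def hs_apply_Abs_hs[OF hs] positive_op_adj[OF R(1)] R(2))
  moreover have "hs_adj (Abs_hs R) = Abs_hs R"
    by (rule hs_eqI) (simp add: hs_adj.rep_eq hs_apply_Abs_hs[OF hs] positive_op_adj[OF R(1)])
  ultimately show ?thesis by blast
qed

lemma trace_class_bounded_clinear: "trace_class T \<Longrightarrow> bounded_clinear T"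
  by (simp add: trace_class_def)

lemma positive_trace_class_sqrt:
  assumes "positive_op P" "trace_class P"
  shows "\<exists>R :: ('a::chilbert_space, 'a) hs. P = hs_prod R R \<and> hs_adj R = R \<and> (norm R)\<^sup>2 = trace_norm P"
proof -
  obtain B where "is_onb B" "(\<lambda>e. cinner e (P e)) summable_on B"
    using assms by (auto simp: trace_class_def abs_op_of_positive)
  from positive_trace_class_factor[OF assms(1) this] obtain R where R: "P = hs_prod R R" "hs_adj R = R" by blast
  have "trace_norm P = Re (trace (hs_prod R R))" by (simp only: trace_norm_def abs_op_of_positive[OF assms(1)] flip: R(1))
  then have "trace_norm P = (norm R)\<^sup>2" by (simp add: trace_hs_prod cinner_self)
  then show ?thesis using R by metis
qed

text \<open>Polar decomposition: the absolute value is R R^*, and the contraction U goes to the left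
  factor, whose norm it can only shrink.\<close>

lemma trace_class_factor:
  assumes T: "trace_class T"
  shows "\<exists>A B :: ('a::chilbert_space, 'a) hs. T = hs_prod A B \<and> norm A \<le> norm B \<and> (norm B)\<^sup>2 = trace_norm T"
proof -
  have bT: "bounded_clinear T" by (rule trace_class_bounded_clinear[OF T])
  obtain C where "is_onb C" "(\<lambda>e. cinner e (abs_op T e)) summable_on C" using T by (auto simp: trace_class_def)
  from positive_trace_class_factor[OF abs_op_positive[OF bT] this]
  obtain R :: "('a, 'a) hs" where R: "abs_op T = hs_prod R R" by blast
  obtain U where U: "bounded_clinear U" "\<And>y. norm (U y) \<le> norm y" "T = U \<circ> abs_op T"
    using polar_decomposition[OF bT] by metis
  have "T = hs_prod (hs_lcomp U R) R" using U(3) by (simp add: R comp_hs_prod[OF U(1)])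
  moreover have "norm (hs_lcomp U R) \<le> 1 * norm R" by (rule norm_hs_lcomp_le[OF U(1)]) (simp_all add: U(2))
  moreover have "(norm R)\<^sup>2 = trace_norm T" by (simp add: trace_norm_def R trace_hs_prod cinner_self)
  ultimately show ?thesis by (metis mult_1)
qed

lemma trace_class_obtain:
  assumes "trace_class T"
  obtains A B :: "('a::chilbert_space, 'a) hs" where "T = hs_prod A B" "norm A * norm B \<le> trace_norm T"
proof -
  obtain A B :: "('a, 'a) hs" where AB: "T = hs_prod A B" "norm A \<le> norm B" "(norm B)\<^sup>2 = trace_norm T"
    using trace_class_factor[OF assms] by blast
  have "norm A * norm B \<le> norm B * norm B" by (rule mult_right_mono[OF AB(2)]) simp
  then show thesis using that AB(1,3) by (simp add: power2_eq_square)
qed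

lemma trace_norm_nonneg: "trace_class T \<Longrightarrow> 0 \<le> trace_norm T"
  using trace_class_factor[of T] by (metis zero_le_power2)

lemma trace_class_cinner_bound:
  fixes T :: "'a::chilbert_space \<Rightarrow> 'a"
  assumes "trace_class T"
  shows "cmod (cinner x (T y)) \<le> trace_norm T * (norm x * norm y)"
proof -
  obtain A B :: "('a, 'a) hs" where AB: "T = hs_prod A B" "norm A * norm B \<le> trace_norm T"
    using trace_class_obtain[OF assms] .
  show ?thesis unfolding AB(1)
    by (rule order_trans[OF cinner_hs_prod_bound mult_right_mono]) (use AB in auto)
qed

lemma trace_has_sum:
  assumes "trace_class T" "is_onb C"
  shows "((\<lambda>e. cinner e (T e)) has_sum trace T) C"
  using trace_class_factor[OF assms(1)] cinner_hs_prod_has_sum[OF assms(2)] trace_hs_prod by metis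

lemma trace_class_comp:
  assumes T: "trace_class T" and X: "bounded_clinear X" and Y: "bounded_clinear Y"
  shows "trace_class (X \<circ> T \<circ> Y)"
  using trace_class_factor[OF T]
  by (metis X Y comp_hs_prod hs_prod_comp trace_class_hs_prod)

lemma trace_norm_comp_contraction:
  fixes T :: "'a::chilbert_space \<Rightarrow> 'a"
  assumes T: "trace_class T" and X: "bounded_clinear X" and Y: "bounded_clinear Y"
    and X1: "\<And>x. norm (X x) \<le> norm x" and Y1: "\<And>x. norm (Y x) \<le> norm x"
  shows "trace_norm (X \<circ> T \<circ> Y) \<le> trace_norm T"
proof -
  obtain A B :: "('a, 'a) hs" where AB: "T = hs_prod A B" "norm A * norm B \<le> trace_norm T"
    using trace_class_obtain[OF T] .
  have "trace_norm (X \<circ> T \<circ> Y) \<le> norm (hs_lcomp X A) * norm (hs_lcomp (adj Y) B)"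
    unfolding AB(1) comp_hs_prod[OF X] hs_prod_comp[OF Y] by (rule trace_norm_hs_prod_le)
  also have "\<dots> \<le> (1 * norm A) * (1 * norm B)"
    using adj_norm_le[OF Y, of 1]
    by (intro mult_mono norm_hs_lcomp_le X adj_bounded_clinear[OF Y]) (simp_all add: X1 Y1)
  finally show ?thesis using AB(2) by simp
qed

lemma trace_class_scaleC: "trace_class T \<Longrightarrow> trace_class (\<lambda>x. c *\<^sub>C T x)"
  using trace_class_factor[of T] trace_class_hs_prod[of "c *\<^sub>C _"] by (metis hs_prod_scaleC_left ext)

lemma trace_norm_scaleC_le:
  fixes T :: "'a::chilbert_space \<Rightarrow> 'a"
  assumes "trace_class T"
  shows "trace_norm (\<lambda>x. c *\<^sub>C T x) \<le> cmod c * trace_norm T"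
proof -
  obtain A B :: "('a, 'a) hs" where AB: "T = hs_prod A B" "norm A * norm B \<le> trace_norm T"
    using trace_class_obtain[OF assms] .
  have "trace_norm (\<lambda>x. c *\<^sub>C T x) \<le> norm (c *\<^sub>C A) * norm B"
    unfolding AB(1) hs_prod_scaleC_left[symmetric] by (rule trace_norm_hs_prod_le)
  also have "\<dots> \<le> cmod c * trace_norm T"
    using mult_left_mono[OF AB(2), of "cmod c"] by (simp add: norm_scaleC mult_ac)
  finally show ?thesis .
qed

text \<open>A sum of two products is not visibly a product. But its absolute value is W (S + T),
  whose diagonal splits into the diagonals of two products, each summable.\<close>

lemma trace_class_add:
  fixes S T :: "'a::chilbert_space \<Rightarrow> 'a"
  assumes "trace_class S" "trace_class T"
  shows "trace_class (\<lambda>x. S x + T x)"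
proof -
  obtain A B :: "('a, 'a) hs" where S: "S = hs_prod A B" using trace_class_factor[OF assms(1)] by blast
  obtain C D :: "('a, 'a) hs" where T: "T = hs_prod C D" using trace_class_factor[OF assms(2)] by blast
  have b: "bounded_clinear (\<lambda>x. S x + T x)"
    unfolding S T by (intro bounded_clinear_plus bounded_clinear_hs_prod)
  obtain W where W: "bounded_clinear W" "abs_op (\<lambda>x. S x + T x) = W \<circ> (\<lambda>x. S x + T x)"
    using polar_decomposition_inverse[OF b] by blast
  have "cinner e (abs_op (\<lambda>x. S x + T x) e)
      = cinner e (hs_prod (hs_lcomp W A) B e) + cinner e (hs_prod (hs_lcomp W C) D e)" for e
    unfolding W(2) comp_hs_prod[OF W(1), symmetric]
    by (simp add: S T bounded_clinear_add[OF W(1)] cinner_add_right)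
  moreover have "(\<lambda>e. cinner e (hs_prod (hs_lcomp W A) B e) + cinner e (hs_prod (hs_lcomp W C) D e)) summable_on some_onb"
    by (intro summable_on_add has_sum_imp_summable[OF cinner_hs_prod_has_sum[OF some_onb_is_onb]])
  ultimately show ?thesis unfolding trace_class_def using b some_onb_is_onb by auto
qed

lemma trace_class_zero: "trace_class (\<lambda>_. 0)"
  using trace_class_hs_prod[of "0::('a,'a) hs" "0::('a,'a) hs"]
  by (simp add: hs_prod_def o_def hs_apply_zero)

lemma trace_class_sum: "(\<And>i. i \<in> F \<Longrightarrow> trace_class (f i)) \<Longrightarrow> trace_class (\<lambda>x. \<Sum>i\<in>F. f i x)"
  by (induction F rule: infinite_finite_induct) (simp_all add: trace_class_zero trace_class_add)

lemma trace_comp_ketbra: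
  assumes T: "bounded_clinear T"
  shows "trace (T \<circ> hs_apply (ketbra z y)) = cinner y (T z)"
proof -
  have "((\<lambda>e. cinner y e * cinner e (T z)) has_sum cinner y (T z)) some_onb"
    by (rule onb_cinner_has_sum[OF some_onb_is_onb])
  then show ?thesis
    unfolding trace_def by (simp add: infsumI ketbra_apply bounded_clinear_scaleC[OF T] cinner_scaleC_right)
qed

text \<open>Rank-one a already separate: |z><y| returns the matrix entry <y, S z>. This is the
  uniqueness behind \<open>partial_trace\<close>.\<close>

lemma trace_class_eqI:
  fixes S T :: "'a::chilbert_space \<Rightarrow> 'a"
  assumes "bounded_clinear S" "bounded_clinear T"
    and "\<And>a. bounded_clinear a \<Longrightarrow> trace (S \<circ> a) = trace (T \<circ> a)"
  shows "S = T"
proof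
  show "S z = T z" for z
  proof (rule cinner_eqI)
    show "cinner y (S z) = cinner y (T z)" for y
      using assms(3)[OF hs_apply_bounded_clinear[of "ketbra z y"]] by (simp add: trace_comp_ketbra assms)
  qed
qed

lemma positive_trace:
  assumes "positive_op P"
  shows "trace_norm P = Re (trace P)"
  by (simp add: trace_norm_def abs_op_of_positive[OF assms])

section \<open>Square-summable families\<close>

lemma ell2_eqI: "(\<And>i. ell2_nth f i = ell2_nth g i) \<Longrightarrow> f = g"
  by (rule ell2_nth_inject[THEN iffD1]) (simp add: fun_eq_iff)

lemma ell2_nth_add: "ell2_nth (f + g) i = ell2_nth f i + ell2_nth g i"
  by (simp add: plus_ell2.rep_eq)

lemma ell2_nth_scaleC: "ell2_nth (c *\<^sub>C f) i = c *\<^sub>C ell2_nth f i"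
  by (simp add: scaleC_ell2.rep_eq)

lemma ell2_nth_zero: "ell2_nth 0 i = 0"
  by (simp add: zero_ell2.rep_eq)

lemma ell2_nth_sum: "ell2_nth (sum f A) i = (\<Sum>j\<in>A. ell2_nth (f j) i)"
  by (induction A rule: infinite_finite_induct) (simp_all add: ell2_nth_zero ell2_nth_add)

lemma ell2_nth_single: "ell2_nth (ell2_single j x) i = (if i = j then x else 0)"
  by (simp add: ell2_single.rep_eq)

lemma bounded_clinear_ell2_nth: "bounded_clinear (\<lambda>f. ell2_nth f i)"
  by (rule bounded_clinear_intro[where K=1])
    (simp_all add: ell2_nth_add ell2_nth_scaleC ell2_nth_norm_le)

lemma norm_ell2_single: "norm (ell2_single i x) = norm x"
proof -
  have "((\<lambda>k. (norm (ell2_nth (ell2_single i x) k))\<^sup>2) has_sum (norm x)\<^sup>2) UNIV"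
    by (rule has_sum_finite_neutralI[where B="{i}"]) (auto simp: ell2_nth_single)
  then have "(norm (ell2_single i x))\<^sup>2 = (norm x)\<^sup>2"
    unfolding ell2_norm_power2 by (rule infsumI)
  then show ?thesis by simp
qed

lemma bounded_clinear_ell2_single: "bounded_clinear (ell2_single i)"
  by (rule bounded_clinear_intro[where K=1])
    (auto intro!: ell2_eqI simp: ell2_nth_add ell2_nth_scaleC ell2_nth_single norm_ell2_single)

lemma cinner_ell2_single: "cinner (ell2_single i x) f = cinner x (ell2_nth f i)"
proof -
  have "((\<lambda>k. cinner (ell2_nth (ell2_single i x) k) (ell2_nth f k)) has_sum cinner x (ell2_nth f i)) UNIV"
    by (rule has_sum_finite_neutralI[where B="{i}"]) (auto simp: ell2_nth_single)
  then show ?thesis unfolding cinner_ell2.rep_eq by (rule infsumI)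
qed

lemma adj_ell2_nth: "adj (\<lambda>f::('i, 'a::chilbert_space) ell2. ell2_nth f i) = ell2_single i"
  by (rule adj_eqI[OF bounded_clinear_ell2_nth]) (rule cinner_ell2_single)

lemma adj_ell2_single: "adj (ell2_single i :: 'a::chilbert_space \<Rightarrow> _) = (\<lambda>f. ell2_nth f i)"
  using adj_adj[OF bounded_clinear_ell2_nth] by (simp add: adj_ell2_nth)

section \<open>Transposition of Hilbert-Schmidt operators into families\<close>

abbreviation hs_nth :: "'k \<Rightarrow> ('c::chilbert_space, ('k, 'b::chilbert_space) ell2) hs \<Rightarrow> ('c, 'b) hs"
  where "hs_nth k \<equiv> hs_lcomp (\<lambda>f. ell2_nth f k)"

lemma hs_nth_apply: "hs_apply (hs_nth k Z) x = ell2_nth (hs_apply Z x) k"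
  by (simp add: hs_apply_lcomp bounded_clinear_ell2_nth)

lemma hs_nth_norm_has_sum: "((\<lambda>k. (norm (hs_nth k Z))\<^sup>2) has_sum (norm Z)\<^sup>2) UNIV"
proof (rule nonneg_has_sum_swap[OF _ hs_norm_has_sum[OF some_onb_is_onb]])
  show "((\<lambda>k. (norm (ell2_nth (hs_apply Z x) k))\<^sup>2) has_sum (norm (hs_apply Z x))\<^sup>2) UNIV" for x
    unfolding ell2_norm_power2 by (rule has_sum_infsum[OF ell2_nth_summable])
  show "((\<lambda>x. (norm (ell2_nth (hs_apply Z x) k))\<^sup>2) has_sum (norm (hs_nth k Z))\<^sup>2) some_onb" for k
    using hs_norm_has_sum[OF some_onb_is_onb, of "hs_nth k Z"] by (simp add: hs_nth_apply)
qed simp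

text \<open>Each component is replaced by its adjoint while the index k stays in place. The passage
  is antilinear, so a further \<open>hs_adj\<close> restores linearity.\<close>

definition hs_transpose :: "('c::chilbert_space, ('k, 'b::chilbert_space) ell2) hs \<Rightarrow> ('b, ('k, 'c) ell2) hs"
  where "hs_transpose Z = Abs_hs (\<lambda>y. Abs_ell2 (\<lambda>k. hs_apply (hs_adj (hs_nth k Z)) y))"

text \<open>The squared norms of the adjoint components at basis vectors y, summed over k and y in
  either order, give the squared norm of Z on one side and of the new family on the other.\<close>

lemma
  fixes Z :: "('c::chilbert_space, ('k, 'b::chilbert_space) ell2) hs"
  shows hs_transpose_apply: "ell2_nth (hs_apply (hs_transpose Z) y) k = hs_apply (hs_adj (hs_nth k Z)) y"
    and norm_hs_transpose: "norm (hs_transpose Z) = norm Z"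
proof -
  define C where "C = (\<lambda>y. Abs_ell2 (\<lambda>k. hs_apply (hs_adj (hs_nth k Z)) y))"
  have le: "(norm (hs_apply (hs_adj (hs_nth k Z)) y))\<^sup>2 \<le> (norm (hs_nth k Z))\<^sup>2 * (norm y)\<^sup>2" for k y
    using power_mono[OF hs_norm_le[of "hs_adj (hs_nth k Z)" y], of 2] by (simp add: norm_hs_adj power_mult_distrib)
  have s: "((\<lambda>k. (norm (hs_nth k Z))\<^sup>2 * (norm y)\<^sup>2) has_sum (norm Z)\<^sup>2 * (norm y)\<^sup>2) UNIV" for y :: 'b
    by (rule has_sum_cmult_left[OF hs_nth_norm_has_sum])
  have summ: "(\<lambda>k. (norm (hs_apply (hs_adj (hs_nth k Z)) y))\<^sup>2) summable_on UNIV" for y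
    by (rule summable_on_comparison_test[OF has_sum_imp_summable[OF s]]) (use le in auto)
  have C: "ell2_nth (C y) k = hs_apply (hs_adj (hs_nth k Z)) y" for y k
    unfolding C_def using summ by (simp add: Abs_ell2_inverse)
  have Cn: "((\<lambda>k. (norm (hs_apply (hs_adj (hs_nth k Z)) y))\<^sup>2) has_sum (norm (C y))\<^sup>2) UNIV" for y
    using has_sum_infsum[OF summ] by (simp add: ell2_norm_power2 C)
  have bC: "bounded_clinear C"
  proof (rule bounded_clinear_intro[where K="norm Z"])
    show "C (x + y) = C x + C y" for x y
      by (rule ell2_eqI) (simp add: C ell2_nth_add bounded_clinear_add[OF hs_apply_bounded_clinear])
    show "C (c *\<^sub>C x) = c *\<^sub>C C x" for c x
      by (rule ell2_eqI) (simp add: C ell2_nth_scaleC bounded_clinear_scaleC[OF hs_apply_bounded_clinear])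
    fix y
    have "(norm (C y))\<^sup>2 \<le> (norm Z)\<^sup>2 * (norm y)\<^sup>2"
      using Cn s by (rule has_sum_mono) (use le in auto)
    then have "(norm (C y))\<^sup>2 \<le> (norm y * norm Z)\<^sup>2" by (simp add: power_mult_distrib mult.commute)
    then show "norm (C y) \<le> norm y * norm Z" by (rule power2_le_imp_le) simp
  qed
  have Csum: "((\<lambda>y. (norm (C y))\<^sup>2) has_sum (norm Z)\<^sup>2) some_onb"
  proof (rule nonneg_has_sum_swap[OF _ hs_nth_norm_has_sum Cn])
    show "((\<lambda>y. (norm (hs_apply (hs_adj (hs_nth k Z)) y))\<^sup>2) has_sum (norm (hs_nth k Z))\<^sup>2) some_onb" for k
      using hs_norm_has_sum[OF some_onb_is_onb, of "hs_adj (hs_nth k Z)"] by (simp add: norm_hs_adj)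
  qed simp
  have hsC: "hilbert_schmidt C" by (rule hilbert_schmidtI[OF bC has_sum_imp_summable[OF Csum]])
  have tr: "hs_apply (hs_transpose Z) = C" unfolding hs_transpose_def C_def[symmetric] by (rule hs_apply_Abs_hs[OF hsC])
  show "ell2_nth (hs_apply (hs_transpose Z) y) k = hs_apply (hs_adj (hs_nth k Z)) y" by (simp add: tr C)
  have "((\<lambda>y. (norm (C y))\<^sup>2) has_sum (norm (hs_transpose Z))\<^sup>2) some_onb"
    using hs_norm_has_sum[OF some_onb_is_onb, of "hs_transpose Z"] by (simp add: tr)
  from has_sum_unique[OF this Csum] show "norm (hs_transpose Z) = norm Z" by simp
qed

lemma hs_transpose_add: "hs_transpose (Y + Z) = hs_transpose Y + hs_transpose Z"
  by (intro hs_eqI ell2_eqI)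
    (simp add: hs_transpose_apply ell2_nth_add hs_apply_add hs_adj_add
      bounded_clinear_add[OF bounded_clinear_hs_lcomp[OF bounded_clinear_ell2_nth]])

lemma hs_transpose_scaleC: "hs_transpose (c *\<^sub>C Z) = cnj c *\<^sub>C hs_transpose Z"
  by (intro hs_eqI ell2_eqI)
    (simp add: hs_transpose_apply ell2_nth_scaleC hs_apply_scaleC hs_adj_scaleC
      bounded_clinear_scaleC[OF bounded_clinear_hs_lcomp[OF bounded_clinear_ell2_nth]])

lemma cinner_hs_transpose: "cinner (hs_transpose Y) (hs_transpose Z) = cinner Z Y"
  by (rule antilinear_isometry_cinner) (simp_all add: hs_transpose_add hs_transpose_scaleC norm_hs_transpose)

text \<open>The columns of an operator in the chosen basis. The index set is the whole type of
  vectors, with zeros off the basis.\<close>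

definition hs_family :: "('x::chilbert_space, 'y::chilbert_space) hs \<Rightarrow> ('x, 'y) ell2"
  where "hs_family T = hs_values (hs_apply T)"

lemma ell2_nth_hs_family: "ell2_nth (hs_family T) e = (if e \<in> some_onb then hs_apply T e else 0)"
  unfolding hs_family_def by (rule ell2_nth_hs_values[OF hilbert_schmidt_hs_apply])

lemma norm_hs_family: "norm (hs_family T) = norm T"
  by (simp add: hs_family_def hs_norm_values)

lemma hs_family_add: "hs_family (S + T) = hs_family S + hs_family T"
  by (rule ell2_eqI) (simp add: ell2_nth_hs_family ell2_nth_add hs_apply_add)

lemma hs_family_scaleC: "hs_family (c *\<^sub>C T) = c *\<^sub>C hs_family T"
  by (rule ell2_eqI) (simp add: ell2_nth_hs_family ell2_nth_scaleC hs_apply_scaleC)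

lemma bounded_clinear_hs_family: "bounded_clinear hs_family"
  by (rule bounded_clinear_intro[where K=1]) (simp_all add: hs_family_add hs_family_scaleC norm_hs_family)

lemma isometry_cinner_hs_lcomp:
  assumes "bounded_clinear a" "\<And>x. norm (a x) = norm x"
  shows "cinner (hs_lcomp a S) (hs_lcomp a T) = cinner S T"
proof -
  have "cinner (a x) (a y) = cinner x y" for x y
    by (rule isometry_cinner) (simp_all add: assms bounded_clinear_add bounded_clinear_scaleC)
  then show ?thesis by (simp add: cinner_hs_eq hs_apply_lcomp assms(1))
qed

text \<open>For \<open>Z = hs_lcomp V A\<close> with the Kraus operators \<open>V\<^sub>k x = (V x) k\<close> this is the family of the
  \<open>A\<^sup>* V\<^sub>k\<^sup>*\<close>, so that \<open>\<Sum>\<^sub>k V\<^sub>k A B\<^sup>* V\<^sub>k\<^sup>*\<close> becomes a product of two Hilbert-Schmidt operators.\<close>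

definition kraus_vec :: "('c::chilbert_space, ('x::chilbert_space, 'y::chilbert_space) hs) hs \<Rightarrow> (('x, 'c) ell2, 'y) hs"
  where "kraus_vec Z = hs_adj (hs_transpose (hs_lcomp hs_family Z))"

lemma kraus_vec_add: "kraus_vec (Y + Z) = kraus_vec Y + kraus_vec Z"
  by (simp add: kraus_vec_def hs_adj_add hs_transpose_add bounded_clinear_add[OF bounded_clinear_hs_lcomp[OF bounded_clinear_hs_family]])

lemma kraus_vec_scaleC: "kraus_vec (c *\<^sub>C Z) = c *\<^sub>C kraus_vec Z"
  by (simp add: kraus_vec_def hs_adj_scaleC hs_transpose_scaleC bounded_clinear_scaleC[OF bounded_clinear_hs_lcomp[OF bounded_clinear_hs_family]])

lemma cinner_kraus_vec: "cinner (kraus_vec Y) (kraus_vec Z) = cinner Y Z"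
  unfolding kraus_vec_def cinner_hs_adj cinner_hs_transpose
  by (rule isometry_cinner_hs_lcomp) (simp_all add: bounded_clinear_hs_family norm_hs_family)

lemma norm_kraus_vec: "norm (kraus_vec Z) = norm Z"
proof -
  have "complex_of_real ((norm (kraus_vec Z))\<^sup>2) = complex_of_real ((norm Z)\<^sup>2)"
    unfolding cinner_self[symmetric] by (rule cinner_kraus_vec)
  then have "(norm (kraus_vec Z))\<^sup>2 = (norm Z)\<^sup>2" unfolding of_real_eq_iff .
  then show ?thesis by simp
qed

text \<open>The operator \<open>a\<close> acts on the output space of every element of the inner
  Hilbert-Schmidt space, hence alike on all Kraus components. This is what makes a product of such
  vectors a partial trace.\<close>

lemma kraus_vec_hs_lcomp:
  assumes a: "bounded_clinear a"
  shows "kraus_vec (hs_lcomp (hs_lcomp a) Z) = hs_lcomp a (kraus_vec Z)"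
proof -
  have "hs_transpose (hs_lcomp hs_family (hs_lcomp (hs_lcomp a) Z)) = hs_adj (hs_lcomp a (kraus_vec Z))"
  proof (intro hs_eqI ell2_eqI)
    fix y k
    let ?F = "hs_lcomp hs_family Z"
    have fam: "hs_nth k (hs_lcomp hs_family (hs_lcomp (hs_lcomp a) Z)) = hs_lcomp a (hs_nth k ?F)"
      by (rule hs_eqI)
        (simp add: hs_apply_lcomp a bounded_clinear_ell2_nth bounded_clinear_hs_family bounded_clinear_hs_lcomp
          ell2_nth_hs_family bounded_clinear_zero)
    have adjc: "hs_apply (hs_adj (hs_lcomp a T)) y = hs_apply (hs_adj T) (adj a y)" for T :: "('w::chilbert_space, 'a) hs"
      by (simp add: hs_adj.rep_eq hs_apply_lcomp a adj_compose hs_apply_bounded_clinear)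
    show "ell2_nth (hs_apply (hs_transpose (hs_lcomp hs_family (hs_lcomp (hs_lcomp a) Z))) y) k
        = ell2_nth (hs_apply (hs_adj (hs_lcomp a (kraus_vec Z))) y) k"
      unfolding hs_transpose_apply fam adjc by (simp add: kraus_vec_def hs_transpose_apply)
  qed
  then show ?thesis by (simp add: kraus_vec_def)
qed

lemma trace_kraus_vec:
  assumes a: "bounded_clinear a"
  shows "trace (hs_prod (kraus_vec Y) (kraus_vec Z) \<circ> a) = trace (hs_prod Y Z \<circ> hs_lcomp a)"
  unfolding hs_prod_comp[OF a] hs_prod_comp[OF bounded_clinear_hs_lcomp[OF a]] trace_hs_prod adj_hs_lcomp[OF a]
    kraus_vec_hs_lcomp[OF adj_bounded_clinear[OF a], symmetric] cinner_kraus_vec ..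

section \<open>Antiunitary operators\<close>

text \<open>The identification of a space with its dual is antilinear; the unitary theta is
  assembled from pairs of such maps, one on each side of an operator.\<close>

definition antiunitary :: "('a::complex_inner \<Rightarrow> 'b::complex_inner) \<Rightarrow> bool"
  where "antiunitary F \<longleftrightarrow> (\<forall>x y. F (x + y) = F x + F y) \<and> (\<forall>c x. F (c *\<^sub>C x) = cnj c *\<^sub>C F x)
    \<and> (\<forall>x. norm (F x) = norm x) \<and> surj F"

lemma
  assumes "antiunitary F"
  shows antiunitary_add: "F (x + y) = F x + F y"
    and antiunitary_scaleC: "F (c *\<^sub>C x) = cnj c *\<^sub>C F x"
    and antiunitary_norm: "norm (F x) = norm x"
    and antiunitary_surj: "surj F"
  using assms by (auto simp: antiunitary_def)

lemma antiunitary_cinner: "antiunitary F \<Longrightarrow> cinner (F x) (F y) = cinner y x"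
  by (rule antilinear_isometry_cinner) (simp_all add: antiunitary_def)

lemma antiunitary_diff:
  assumes "antiunitary F"
  shows "F (x - y) = F x - F y"
  using antiunitary_add[OF assms, of "x - y" y] by simp

lemma antiunitary_inj:
  assumes "antiunitary F"
  shows "inj F"
proof (rule injI)
  fix x y assume "F x = F y"
  then have "norm (F (x - y)) = 0" by (simp add: antiunitary_diff[OF assms])
  then show "x = y" by (simp add: antiunitary_norm[OF assms])
qed

lemma antiunitary_onb:
  assumes F: "antiunitary F" and B: "is_onb B"
  shows "is_onb (F ` B)"
  unfolding is_onb_def
proof
  show "orthonormal (F ` B)"
    using B unfolding is_onb_def orthonormal_def
    by (auto simp: antiunitary_cinner[OF F] inj_eq[OF antiunitary_inj[OF F]])
  have "F v \<in> cspan (F ` B)" if v: "v \<in> cspan B" for v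
    using v
  proof (induction rule: cvec.span_induct_alt)
    case base
    have "F 0 = 0" using antiunitary_norm[OF F, of 0] by simp
    then show ?case by (simp add: cvec.span_zero)
  next
    case (step c x y)
    then show ?case
      by (simp add: antiunitary_add[OF F] antiunitary_scaleC[OF F] cvec.span_add cvec.span_scale cvec.span_base)
  qed
  then have "y \<in> closure (cspan (F ` B))" for y
  proof -
    assume *: "\<And>v. v \<in> cspan B \<Longrightarrow> F v \<in> cspan (F ` B)"
    obtain x where x: "y = F x" using antiunitary_surj[OF F] by (metis surjD)
    have "x \<in> closure (cspan B)" using B by (simp add: is_onb_def)
    then have "\<forall>e>0. \<exists>v\<in>cspan B. dist v x < e" by (simp add: closure_approachable)
    then have "\<forall>e>0. \<exists>v\<in>cspan B. dist (F v) y < e"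
      by (simp add: x dist_norm antiunitary_norm[OF F] flip: antiunitary_diff[OF F])
    then show ?thesis unfolding closure_approachable using * by blast
  qed
  then show "closure (cspan (F ` B)) = UNIV" by blast
qed

lemma antiunitary_bra: "antiunitary bra"
  unfolding antiunitary_def using surjI[of bra unbra] by (simp add: bra_add bra_scaleC)

lemma unbra_add: "unbra (\<phi> + \<psi>) = unbra \<phi> + unbra \<psi>"
  by (cases \<phi> rule: bra_cases, cases \<psi> rule: bra_cases) (simp flip: bra_add)

lemma unbra_scaleC: "unbra (c *\<^sub>C \<phi>) = cnj c *\<^sub>C unbra \<phi>"
  by (cases \<phi> rule: bra_cases) (metis bra_scaleC complex_cnj_cnj unbra_bra)

lemma norm_unbra: "norm (unbra \<phi>) = norm \<phi>"
  by (cases \<phi> rule: bra_cases) simp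

lemma antiunitary_unbra: "antiunitary unbra"
  unfolding antiunitary_def using surjI[of unbra bra] by (simp add: unbra_add unbra_scaleC norm_unbra)

definition hs_conj :: "('b::chilbert_space \<Rightarrow> 'd::chilbert_space) \<Rightarrow> ('c::chilbert_space \<Rightarrow> 'a::chilbert_space)
    \<Rightarrow> ('a, 'b) hs \<Rightarrow> ('c, 'd) hs"
  where "hs_conj G F T = Abs_hs (G \<circ> hs_apply T \<circ> F)"

lemma
  assumes G: "antiunitary G" and F: "antiunitary F"
  shows hs_conj_apply: "hs_apply (hs_conj G F T) x = G (hs_apply T (F x))"
    and norm_hs_conj: "norm (hs_conj G F T) = norm T"
proof -
  let ?S = "G \<circ> hs_apply T \<circ> F"
  have b: "bounded_clinear ?S"
  proof (rule bounded_clinear_intro[where K="norm T"])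
    show "norm (?S x) \<le> norm x * norm T" for x
      using hs_norm_le[of T "F x"] by (simp add: antiunitary_norm[OF G] antiunitary_norm[OF F] mult.commute)
  qed (simp_all add: antiunitary_add[OF G] antiunitary_add[OF F] antiunitary_scaleC[OF G] antiunitary_scaleC[OF F]
      bounded_clinear_add[OF hs_apply_bounded_clinear] bounded_clinear_scaleC[OF hs_apply_bounded_clinear])
  \<comment> \<open>The norm may be computed over the image basis, which reindexes to
    \<open>some_onb\<close>.\<close>
  have "((\<lambda>e. (norm (hs_apply T e))\<^sup>2) has_sum (norm T)\<^sup>2) (F ` some_onb)"
    by (rule hs_norm_has_sum[OF antiunitary_onb[OF F some_onb_is_onb]])
  then have s: "((\<lambda>e. (norm (?S e))\<^sup>2) has_sum (norm T)\<^sup>2) some_onb"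
    by (subst (asm) has_sum_reindex)
      (auto simp: antiunitary_norm[OF G] o_def intro: inj_on_subset[OF antiunitary_inj[OF F]])
  have hs: "hilbert_schmidt ?S" by (rule hilbert_schmidtI[OF b has_sum_imp_summable[OF s]])
  have a: "hs_apply (hs_conj G F T) = ?S" unfolding hs_conj_def by (rule hs_apply_Abs_hs[OF hs])
  then show "hs_apply (hs_conj G F T) x = G (hs_apply T (F x))" by simp
  have "((\<lambda>e. (norm (?S e))\<^sup>2) has_sum (norm (hs_conj G F T))\<^sup>2) some_onb"
    using hs_norm_has_sum[OF some_onb_is_onb, of "hs_conj G F T"] by (simp add: a)
  from has_sum_unique[OF this s] show "norm (hs_conj G F T) = norm T" by simp
qed

section \<open>Tensor products\<close>

lemma hs_apply_tensor: "hs_apply (x \<otimes> y) \<phi> = dual_apply \<phi> y *\<^sub>C x"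
  by (simp add: tensor.rep_eq)

lemma norm_tensor: "norm (x \<otimes> y) = norm x * norm y"
proof -
  have "complex_of_real ((norm (x \<otimes> y))\<^sup>2) = complex_of_real ((norm x * norm y)\<^sup>2)"
    using cinner_tensor[of x y x y] by (simp add: cinner_self power_mult_distrib)
  then have "(norm (x \<otimes> y))\<^sup>2 = (norm x * norm y)\<^sup>2" unfolding of_real_eq_iff .
  then show ?thesis by simp
qed

lemma bounded_clinear_tensor_right: "bounded_clinear (\<lambda>y. x \<otimes> y)"
proof (rule bounded_clinear_intro[where K="norm x"])
  show "x \<otimes> (y + y') = x \<otimes> y + x \<otimes> y'" for y y'
    by (rule hs_eqI) (simp add: hs_apply_tensor hs_apply_add dual_apply_cinner bra_add cinner_add_left scaleC_add_left)
  show "x \<otimes> (c *\<^sub>C y) = c *\<^sub>C (x \<otimes> y)" for c y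
    by (rule hs_eqI) (simp add: hs_apply_tensor hs_apply_scaleC dual_apply_cinner bra_scaleC cinner_scaleC_left scaleC_scaleC)
qed (simp add: norm_tensor)

text \<open>The difference of the adjoints at w is orthogonal to every elementary tensor, so
  \<open>tensor_total\<close> makes it zero.\<close>

lemma tensor_ext:
  assumes S: "bounded_clinear S" and T: "bounded_clinear T" and eq: "\<And>x y. S (x \<otimes> y) = T (x \<otimes> y)"
  shows "S t = (T t :: 'c::chilbert_space)"
proof (rule cinner_eqI)
  fix w
  have "adj S w - adj T w = 0"
  proof (rule tensor_total)
    fix x y
    have "cinner (adj S w - adj T w) (x \<otimes> y) = 0"
      by (simp add: cinner_diff_left cinner_adj_left S T eq)
    then show "cinner (x \<otimes> y) (adj S w - adj T w) = 0" by (metis cinner_commute complex_cnj_zero)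
  qed
  then show "cinner w (S t) = cinner w (T t)" by (simp flip: cinner_adj_left[OF S] cinner_adj_left[OF T])
qed

text \<open>Tensors are modelled as operators into the first factor, so an operator on that factor
  acts by composition from the left.\<close>

lemma tensor_op_id:
  assumes a: "bounded_clinear a"
  shows "tensor_op a (id :: 'y::chilbert_space \<Rightarrow> 'y) = hs_lcomp a"
  unfolding tensor_op_def
proof (rule the_equality)
  have "hs_lcomp a (x \<otimes> y) = a x \<otimes> id y" for x and y :: 'y
    by (rule hs_eqI) (simp add: hs_apply_lcomp a hs_apply_tensor bounded_clinear_scaleC[OF a])
  then show *: "bounded_clinear (hs_lcomp a) \<and> (\<forall>x (y::'y). hs_lcomp a (x \<otimes> y) = a x \<otimes> id y)"
    by (simp add: bounded_clinear_hs_lcomp a)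
  show "c = hs_lcomp a" if "bounded_clinear c \<and> (\<forall>x (y::'y). c (x \<otimes> y) = a x \<otimes> id y)" for c
  proof
    show "c t = hs_lcomp a t" for t by (rule tensor_ext) (use that * in auto)
  qed
qed

section \<open>The unitary \<open>\<theta>\<close>\<close>

text \<open>Conjugation by \<open>bra\<close> maps \<open>bra x \<otimes> bra y\<close> to \<open>x \<otimes> y\<close>; composed with \<open>unbra\<close> it is a unitary from
  the dual of \<open>H\<^sub>1\<^sup>* \<otimes> H\<^sub>2\<^sup>*\<close> to \<open>H\<^sub>1 \<otimes> H\<^sub>2\<close>, and \<open>\<theta>\<close> is precomposition with it.\<close>

definition dual_tensor :: "('a::chilbert_space dual, 'b::chilbert_space dual) tensor dual \<Rightarrow> ('a, 'b) tensor"
  where "dual_tensor \<phi> = hs_conj unbra bra (unbra \<phi>)"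

definition tensor_dual :: "('a::chilbert_space, 'b::chilbert_space) tensor \<Rightarrow> ('a dual, 'b dual) tensor dual"
  where "tensor_dual t = bra (hs_conj bra unbra t)"

lemmas hs_conj_unbra_bra_apply = hs_conj_apply[OF antiunitary_unbra antiunitary_bra]
lemmas hs_conj_bra_unbra_apply = hs_conj_apply[OF antiunitary_bra antiunitary_unbra]

lemma dual_tensor_tensor_dual [simp]: "dual_tensor (tensor_dual t) = t"
  unfolding dual_tensor_def tensor_dual_def
  by (rule hs_eqI) (simp add: hs_conj_unbra_bra_apply hs_conj_bra_unbra_apply)

lemma tensor_dual_dual_tensor [simp]:
  fixes \<phi> :: "('a::chilbert_space dual, 'b::chilbert_space dual) tensor dual"
  shows "tensor_dual (dual_tensor \<phi>) = \<phi>"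
proof -
  have "hs_conj bra unbra (hs_conj unbra bra k) = k" for k :: "('a dual, 'b dual) tensor"
    by (rule hs_eqI) (simp add: hs_conj_unbra_bra_apply hs_conj_bra_unbra_apply)
  then show ?thesis unfolding dual_tensor_def tensor_dual_def by simp
qed

lemma norm_dual_tensor: "norm (dual_tensor \<phi>) = norm \<phi>"
  by (simp add: dual_tensor_def norm_hs_conj antiunitary_bra antiunitary_unbra norm_unbra)

lemma norm_tensor_dual: "norm (tensor_dual t) = norm t"
  by (metis dual_tensor_tensor_dual norm_dual_tensor)

lemma bounded_clinear_dual_tensor: "bounded_clinear dual_tensor"
proof (rule bounded_clinear_intro[where K=1])
  show "dual_tensor (\<phi> + \<psi>) = dual_tensor \<phi> + dual_tensor \<psi>"
    and "dual_tensor (c *\<^sub>C \<phi>) = c *\<^sub>C dual_tensor \<phi>" for c \<phi> \<psi>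
    unfolding dual_tensor_def
    by (rule hs_eqI; simp add: hs_conj_unbra_bra_apply unbra_add unbra_scaleC hs_apply_add hs_apply_scaleC)+
qed (simp add: norm_dual_tensor)

lemma bounded_clinear_tensor_dual:
  "bounded_clinear (tensor_dual :: ('a::chilbert_space, 'b::chilbert_space) tensor \<Rightarrow> _)"
proof (rule bounded_clinear_intro[where K=1])
  show "tensor_dual (s + t) = tensor_dual s + tensor_dual t" for s t :: "('a, 'b) tensor"
    using tensor_dual_dual_tensor[of "tensor_dual s + tensor_dual t"]
    by (simp only: bounded_clinear_add[OF bounded_clinear_dual_tensor] dual_tensor_tensor_dual)
  show "tensor_dual (c *\<^sub>C t) = c *\<^sub>C tensor_dual t" for c and t :: "('a, 'b) tensor"
    using tensor_dual_dual_tensor[of "c *\<^sub>C tensor_dual t"]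
    by (simp only: bounded_clinear_scaleC[OF bounded_clinear_dual_tensor] dual_tensor_tensor_dual)
qed (simp add: norm_tensor_dual)

lemma tensor_dual_tensor:
  fixes x :: "'a::chilbert_space" and y :: "'b::chilbert_space"
  shows "tensor_dual (x \<otimes> y) = bra (bra x \<otimes> bra y)"
proof -
  have "hs_conj bra unbra (x \<otimes> y) = bra x \<otimes> bra y"
  proof (rule hs_eqI)
    fix \<phi> :: "'b dual dual"
    obtain \<psi> where \<psi>: "\<phi> = bra \<psi>" by (rule bra_cases)
    show "hs_apply (hs_conj bra unbra (x \<otimes> y)) \<phi> = hs_apply (bra x \<otimes> bra y) \<phi>"
      unfolding hs_conj_bra_unbra_apply hs_apply_tensor \<psi>
      by (simp add: bra_scaleC dual_apply_cinner[of \<psi>] dual_apply_bra flip: cinner_commute)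
  qed
  then show ?thesis by (simp add: tensor_dual_def)
qed

definition hs_rcomp :: "('b::chilbert_space, 'c::chilbert_space) hs \<Rightarrow> ('a::chilbert_space \<Rightarrow> 'b) \<Rightarrow> ('a, 'c) hs"
  where "hs_rcomp T u = Abs_hs (hs_apply T \<circ> u)"

lemma hs_apply_rcomp: "bounded_clinear u \<Longrightarrow> hs_apply (hs_rcomp T u) x = hs_apply T (u x)"
  by (simp add: hs_rcomp_def hs_apply_Abs_hs hilbert_schmidt_comp_right hilbert_schmidt_hs_apply)

lemma norm_hs_rcomp_le:
  assumes u: "bounded_clinear u" and u1: "\<And>x. norm (u x) \<le> norm x"
  shows "norm (hs_rcomp T u) \<le> norm T"
proof -
  have "hs_adj (hs_rcomp T u) = hs_lcomp (adj u) (hs_adj T)"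
  proof (rule hs_eqI)
    have "hs_apply (hs_rcomp T u) = hs_apply T \<circ> u" by (simp add: fun_eq_iff hs_apply_rcomp u)
    then show "hs_apply (hs_adj (hs_rcomp T u)) y = hs_apply (hs_lcomp (adj u) (hs_adj T)) y" for y
      by (simp add: hs_adj.rep_eq hs_apply_lcomp adj_bounded_clinear u adj_compose hs_apply_bounded_clinear)
  qed
  then have "norm (hs_rcomp T u) = norm (hs_lcomp (adj u) (hs_adj T))" by (metis norm_hs_adj)
  also have "\<dots> \<le> 1 * norm (hs_adj T)"
    using adj_norm_le[OF u, of 1] by (intro norm_hs_lcomp_le adj_bounded_clinear u) (simp_all add: u1)
  finally show ?thesis by (simp add: norm_hs_adj)
qed

definition theta_op :: "('a::chilbert_space, 'b::chilbert_space) hspace \<Rightarrow> ('b, ('a dual, 'b dual) tensor) tensor"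
  where "theta_op w = hs_rcomp w dual_tensor"

definition theta_inv :: "('b, ('a dual, 'b dual) tensor) tensor \<Rightarrow> ('a::chilbert_space, 'b::chilbert_space) hspace"
  where "theta_inv t = hs_rcomp t tensor_dual"

lemma hs_apply_theta_op: "hs_apply (theta_op w) \<phi> = hs_apply w (dual_tensor \<phi>)"
  by (simp add: theta_op_def hs_apply_rcomp bounded_clinear_dual_tensor)

lemma hs_apply_theta_inv: "hs_apply (theta_inv t) x = hs_apply t (tensor_dual x)"
  by (simp add: theta_inv_def hs_apply_rcomp bounded_clinear_tensor_dual)

lemma theta_inv_op: "theta_inv (theta_op w) = w"
  by (rule hs_eqI) (simp add: hs_apply_theta_op hs_apply_theta_inv)

lemma theta_op_inv: "theta_op (theta_inv t) = t"
  by (rule hs_eqI) (simp add: hs_apply_theta_op hs_apply_theta_inv)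

text \<open>\<open>theta_op\<close> and its inverse are both contractions, being compositions with
  isometries.\<close>

lemma norm_theta_op: "norm (theta_op w) = norm w"
proof (rule antisym)
  show "norm (theta_op w) \<le> norm w"
    unfolding theta_op_def by (rule norm_hs_rcomp_le) (simp_all add: bounded_clinear_dual_tensor norm_dual_tensor)
  have "norm (theta_inv (theta_op w)) \<le> norm (theta_op w)"
    unfolding theta_inv_def by (rule norm_hs_rcomp_le) (simp_all add: bounded_clinear_tensor_dual norm_tensor_dual)
  then show "norm w \<le> norm (theta_op w)" by (simp add: theta_inv_op)
qed

lemma theta_op_add: "theta_op (v + w) = theta_op v + theta_op w"
  by (rule hs_eqI) (simp add: hs_apply_theta_op hs_apply_add)

lemma theta_op_scaleC: "theta_op (c *\<^sub>C w) = c *\<^sub>C theta_op w"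
  by (rule hs_eqI) (simp add: hs_apply_theta_op hs_apply_scaleC)

lemma bounded_clinear_theta_op: "bounded_clinear theta_op"
  by (rule bounded_clinear_intro[where K=1]) (simp_all add: theta_op_add theta_op_scaleC norm_theta_op)

lemma adj_theta_op:
  "adj (theta_op :: ('a::chilbert_space, 'b::chilbert_space) hspace \<Rightarrow> _) = theta_inv"
proof (rule adj_eqI[OF bounded_clinear_theta_op])
  have "cinner (theta_op v) (theta_op w) = cinner v w" for v w :: "('a, 'b) hspace"
    by (rule isometry_cinner) (simp_all add: theta_op_add theta_op_scaleC norm_theta_op)
  then show "cinner (theta_inv t) w = cinner t (theta_op w)" for w :: "('a, 'b) hspace" and t
    by (metis theta_op_inv)
qed

lemma theta_inv_tensor:
  "hs_apply (theta_inv (z \<otimes> (bra x \<otimes> bra y))) (\<xi> \<otimes> \<eta>) = (cinner x \<xi> * cinner y \<eta>) *\<^sub>C z"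
  by (simp add: hs_apply_theta_inv tensor_dual_tensor hs_apply_tensor dual_apply_bra cinner_tensor)

lemma theta_eq:
  "(theta :: ('a::chilbert_space, 'b::chilbert_space) hspace \<Rightarrow> _) = theta_op"
  unfolding theta_def
proof (rule the_equality)
  show "unitary_op theta_op \<and> (\<forall>x y z \<xi> \<eta>. hs_apply (adj theta_op (z \<otimes> (bra x \<otimes> bra y))) (\<xi> \<otimes> \<eta>)
      = (cinner x \<xi> * cinner y \<eta>) *\<^sub>C z)"
    by (auto simp: unitary_op_def adj_theta_op bounded_clinear_theta_op fun_eq_iff theta_inv_op theta_op_inv theta_inv_tensor)
next
  fix U :: "('a, 'b) hspace \<Rightarrow> ('b, ('a dual, 'b dual) tensor) tensor"
  assume U: "unitary_op U \<and> (\<forall>x y z \<xi> \<eta>. hs_apply (adj U (z \<otimes> (bra x \<otimes> bra y))) (\<xi> \<otimes> \<eta>)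
      = (cinner x \<xi> * cinner y \<eta>) *\<^sub>C z)"
  then have bU: "bounded_clinear U" by (simp add: unitary_op_def)
  have bI: "bounded_clinear (theta_inv :: _ \<Rightarrow> ('a, 'b) hspace)"
    using adj_bounded_clinear[OF bounded_clinear_theta_op] by (simp add: adj_theta_op)
  \<comment> \<open>Elementary tensors are used three times: here for the argument of the operators,
    then for the inner tensor product of the duals, and last for the outer one.\<close>
  have 1: "adj U (z \<otimes> (bra x \<otimes> bra y)) = theta_inv (z \<otimes> (bra x \<otimes> bra y))" for x y z
    by (rule hs_eqI, rule tensor_ext[OF hs_apply_bounded_clinear hs_apply_bounded_clinear])
      (simp add: U theta_inv_tensor)
  have 2: "adj U (z \<otimes> k) = theta_inv (z \<otimes> k)" for z k
  proof -
    have "(adj U \<circ> (\<lambda>k. z \<otimes> k)) k = (theta_inv \<circ> (\<lambda>k. z \<otimes> k)) k"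
    proof (rule tensor_ext)
      fix p :: "'a dual" and q :: "'b dual"
      obtain x y where "p = bra x" "q = bra y" by (metis bra_cases)
      then show "(adj U \<circ> (\<lambda>k. z \<otimes> k)) (p \<otimes> q) = (theta_inv \<circ> (\<lambda>k. z \<otimes> k)) (p \<otimes> q)"
        by (simp add: 1)
    qed (intro bounded_clinear_compose adj_bounded_clinear bU bI bounded_clinear_tensor_right)+
    then show ?thesis by simp
  qed
  have "adj U = theta_inv"
  proof
    show "adj U t = theta_inv t" for t by (rule tensor_ext[OF adj_bounded_clinear[OF bU] bI 2])
  qed
  then have "adj U = adj theta_op" by (simp add: adj_theta_op)
  then show "U = theta_op" by (metis adj_adj bU bounded_clinear_theta_op)
qed

section \<open>The map \<open>\<Psi>\<close>\<close>

lemma partial_trace_eqI: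
  assumes "trace_class t" "\<And>a. bounded_clinear a \<Longrightarrow> trace (t \<circ> a) = trace (s \<circ> hs_lcomp a)"
  shows "partial_trace s = t"
  unfolding partial_trace_def
proof (rule the_equality)
  show "trace_class t \<and> (\<forall>a. bounded_clinear a \<longrightarrow> trace (t \<circ> a) = trace (s \<circ> tensor_op a id))"
    using assms by (simp add: tensor_op_id)
  show "u = t" if "trace_class u \<and> (\<forall>a. bounded_clinear a \<longrightarrow> trace (u \<circ> a) = trace (s \<circ> tensor_op a id))" for u
    by (rule trace_class_eqI)
      (use that assms in \<open>auto simp: tensor_op_id intro: trace_class_bounded_clinear\<close>)
qed

text \<open>\<open>theta_op\<close> composes on the right and \<open>hs_lcomp a\<close> on the left,
  so they commute; under the trace theta then cancels against its inverse, and the partial trace is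
  decided by traces on the original space.\<close>

lemma Psi_eqI:
  fixes Y Z :: "('c::chilbert_space, ('a::chilbert_space, 'b::chilbert_space) hspace) hs"
  assumes t: "trace_class t" and eq: "\<And>a. bounded_clinear a \<Longrightarrow> trace (t \<circ> a) = trace (hs_prod Y Z \<circ> hs_lcomp a)"
  shows "Psi (hs_prod Y Z) = t"
proof -
  have *: "trace (Ad theta_op (hs_prod Y Z) \<circ> hs_lcomp a) = trace (hs_prod Y Z \<circ> hs_lcomp a)"
    if a: "bounded_clinear a" for a
  proof -
    let ?L = "hs_lcomp a :: ('b, ('a dual, 'b dual) tensor) tensor \<Rightarrow> ('b, ('a dual, 'b dual) tensor) tensor"
    let ?X = "theta_inv \<circ> ?L :: _ \<Rightarrow> ('a, 'b) hspace"
    have bI: "bounded_clinear (theta_inv :: _ \<Rightarrow> ('a, 'b) hspace)"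
      using adj_bounded_clinear[OF bounded_clinear_theta_op] by (simp add: adj_theta_op)
    have bX: "bounded_clinear ?X" by (intro bounded_clinear_compose bI bounded_clinear_hs_lcomp a)
    have X\<theta>: "?X \<circ> theta_op = hs_lcomp a"
      by (intro ext hs_eqI) (simp add: hs_apply_theta_inv hs_apply_theta_op hs_apply_lcomp a)
    have "trace (Ad theta_op (hs_prod Y Z) \<circ> ?L) = trace (theta_op \<circ> hs_prod Y Z \<circ> ?X)"
      by (simp add: Ad_def adj_theta_op comp_assoc)
    also have "\<dots> = cinner (hs_lcomp (adj ?X) Z) (hs_lcomp theta_op Y)"
      by (simp only: comp_hs_prod[OF bounded_clinear_theta_op] hs_prod_comp[OF bX] trace_hs_prod)
    also have "\<dots> = cinner Z (hs_lcomp (?X \<circ> theta_op) Y)"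
      by (simp only: cinner_hs_lcomp[OF adj_bounded_clinear[OF bX]] adj_adj[OF bX] hs_lcomp_comp[OF bX bounded_clinear_theta_op])
    also have "\<dots> = trace (hs_prod Y Z \<circ> hs_lcomp a)"
      unfolding X\<theta> hs_prod_comp[OF bounded_clinear_hs_lcomp[OF a]] trace_hs_prod
        cinner_hs_lcomp[OF adj_bounded_clinear[OF bounded_clinear_hs_lcomp[OF a]]] adj_adj[OF bounded_clinear_hs_lcomp[OF a]] ..
    finally show ?thesis .
  qed
  show ?thesis
    unfolding Psi_def comp_apply theta_eq by (rule partial_trace_eqI[OF t]) (simp only: eq *)
qed

lemma Psi_hs_prod: "Psi (hs_prod Y Z) = hs_prod (kraus_vec Y) (kraus_vec Z)"
  by (rule Psi_eqI[OF trace_class_hs_prod trace_kraus_vec])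

lemma hs_lcomp_ketbra: "bounded_clinear a \<Longrightarrow> hs_lcomp a (ketbra x y) = ketbra (a x) y"
  by (rule hs_eqI) (simp add: hs_apply_lcomp ketbra_apply bounded_clinear_scaleC)

text \<open>The value of Psi at <g, h> |v><w|, without Kraus vectors. The vectors g and h are kept
  because the later comparison uses factors |e><g| and |f><h|.\<close>

lemma Psi_ketbra:
  fixes v w :: "('a::chilbert_space, 'b::chilbert_space) hspace"
  shows "Psi (hs_prod (ketbra v g) (ketbra w h)) = hs_prod (cinner g h *\<^sub>C v) w"
proof (rule Psi_eqI[OF trace_class_hs_prod])
  fix a :: "'b \<Rightarrow> 'b" assume a: "bounded_clinear a"
  show "trace (hs_prod (cinner g h *\<^sub>C v) w \<circ> a) = trace (hs_prod (ketbra v g) (ketbra w h) \<circ> hs_lcomp a)"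
    unfolding hs_prod_comp[OF a] hs_prod_comp[OF bounded_clinear_hs_lcomp[OF a]] trace_hs_prod adj_hs_lcomp[OF a]
    by (simp add: hs_lcomp_ketbra bounded_clinear_hs_lcomp adj_bounded_clinear a cinner_ketbra_left ketbra_apply)
qed

lemma Ad_hs_prod:
  assumes "bounded_clinear V"
  shows "Ad V (hs_prod A B) = hs_prod (hs_lcomp V A) (hs_lcomp V B)"
  by (simp add: Ad_def comp_hs_prod hs_prod_comp assms adj_bounded_clinear adj_adj)

lemma Psi_Ad_hs_prod:
  assumes "bounded_clinear V"
  shows "(Psi \<circ> Ad V) (hs_prod A B) = hs_prod (kraus_vec (hs_lcomp V A)) (kraus_vec (hs_lcomp V B))"
  by (simp add: Ad_hs_prod assms Psi_hs_prod)

section \<open>The maps \<open>\<Psi> \<circ> Ad V\<close>\<close>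

lemma hs_prod_zero_left: "hs_prod 0 B x = 0"
  by (simp add: hs_prod_def hs_apply_zero)

lemma hs_prod_zero_right: "hs_prod A 0 x = 0"
  using hs_prod_scaleC_right[of A 0 0 x] by simp

lemma hs_prod_sum_left: "hs_prod (\<Sum>i\<in>F. A i) B x = (\<Sum>i\<in>F. hs_prod (A i) B x)"
  by (induction F rule: infinite_finite_induct) (simp_all add: hs_prod_zero_left hs_prod_add_left)

lemma hs_prod_sum_right: "hs_prod A (\<Sum>i\<in>F. B i) x = (\<Sum>i\<in>F. hs_prod A (B i) x)"
  by (induction F rule: infinite_finite_induct) (simp_all add: hs_prod_zero_right hs_prod_add_right)

section \<open>Ampliations as products of Hilbert-Schmidt operators\<close>

lemma block_hs_prod: "block (hs_prod A B) i j = hs_prod (hs_nth i A) (hs_nth j B)"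
proof -
  have "block (hs_prod A B) i j = (\<lambda>f. ell2_nth f i) \<circ> hs_prod A B \<circ> ell2_single j"
    by (simp add: fun_eq_iff block_def)
  then show ?thesis
    by (simp only: comp_hs_prod[OF bounded_clinear_ell2_nth] hs_prod_comp[OF bounded_clinear_ell2_single] adj_ell2_single)
qed

text \<open>The Kraus vectors of the first n components of A, stacked as rows, so that the double
  sum over blocks becomes one product.\<close>

definition amp_kraus :: "nat \<Rightarrow> ('a::chilbert_space \<Rightarrow> ('x::chilbert_space, 'y::chilbert_space) hs)
    \<Rightarrow> ('c::chilbert_space, (nat, 'a) ell2) hs \<Rightarrow> (('x, 'c) ell2, (nat, 'y) ell2) hs"
  where "amp_kraus n V A = (\<Sum>i<n. hs_lcomp (ell2_single i) (kraus_vec (hs_lcomp V (hs_nth i A))))"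

lemma ampliation_hs_prod:
  fixes \<Phi> :: "('a::chilbert_space \<Rightarrow> 'a) \<Rightarrow> ('b::chilbert_space \<Rightarrow> 'b)" and V :: "'a \<Rightarrow> ('a, 'b) hspace"
  assumes V: "bounded_clinear V" and \<Phi>: "\<And>s. trace_class s \<Longrightarrow> \<Phi> s = (Psi \<circ> Ad V) s"
  shows "ampliation n \<Phi> (hs_prod A B) = hs_prod (amp_kraus n V A) (amp_kraus n V B)"
proof
  fix f
  let ?K = "\<lambda>A i. kraus_vec (hs_lcomp V (hs_nth i A))"
  have "ell2_single i (\<Phi> (block (hs_prod A B) i j) (ell2_nth f j))
      = hs_prod (hs_lcomp (ell2_single i) (?K A i)) (hs_lcomp (ell2_single j) (?K B j)) f" for i j
  proof -
    have "\<Phi> (block (hs_prod A B) i j) = hs_prod (?K A i) (?K B j)"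
      unfolding block_hs_prod \<Phi>[OF trace_class_hs_prod] by (rule Psi_Ad_hs_prod[OF V])
    moreover have "hs_prod (hs_lcomp (ell2_single i) (?K A i)) (hs_lcomp (ell2_single j) (?K B j))
        = ell2_single i \<circ> hs_prod (?K A i) (?K B j) \<circ> (\<lambda>f. ell2_nth f j)"
      by (simp only: comp_hs_prod[OF bounded_clinear_ell2_single] hs_prod_comp[OF bounded_clinear_ell2_nth] adj_ell2_nth)
    ultimately show ?thesis by simp
  qed
  then show "ampliation n \<Phi> (hs_prod A B) f = hs_prod (amp_kraus n V A) (amp_kraus n V B) f"
    by (simp add: ampliation_def amp_kraus_def hs_prod_sum_left hs_prod_sum_right) (rule sum.swap)
qed

text \<open>Rows are orthogonal, so their squared norms add up to at most K^2 |A|^2 with no factor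
  n; this uniformity is complete boundedness.\<close>

lemma norm_amp_kraus_le:
  assumes V: "bounded_clinear V" and K: "K \<ge> 0" "\<And>x. norm (V x) \<le> K * norm x"
  shows "norm (amp_kraus n V A) \<le> K * norm A"
proof -
  have nth: "hs_nth k (amp_kraus n V A) = (if k < n then kraus_vec (hs_lcomp V (hs_nth k A)) else 0)" for k
  proof (rule hs_eqI)
    fix f
    have "hs_apply (hs_nth k (amp_kraus n V A)) f
        = (\<Sum>i<n. if i = k then hs_apply (kraus_vec (hs_lcomp V (hs_nth i A))) f else 0)"
      unfolding hs_nth_apply amp_kraus_def hs_apply_sum ell2_nth_sum
      by (rule sum.cong) (simp_all add: hs_apply_lcomp bounded_clinear_ell2_single ell2_nth_single)
    then show "hs_apply (hs_nth k (amp_kraus n V A)) f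
        = hs_apply (if k < n then kraus_vec (hs_lcomp V (hs_nth k A)) else 0) f"
      by (simp add: hs_apply_zero)
  qed
  have le: "(norm (hs_nth k (amp_kraus n V A)))\<^sup>2 \<le> K\<^sup>2 * (norm (hs_nth k A))\<^sup>2" for k
    using power_mono[OF norm_hs_lcomp_le[OF V K, of "hs_nth k A"], of 2]
    by (simp add: nth norm_kraus_vec power_mult_distrib)
  have "(norm (amp_kraus n V A))\<^sup>2 \<le> K\<^sup>2 * (norm A)\<^sup>2"
    by (rule has_sum_mono[OF hs_nth_norm_has_sum has_sum_cmult_right[OF hs_nth_norm_has_sum] le])
  then have "(norm (amp_kraus n V A))\<^sup>2 \<le> (K * norm A)\<^sup>2" by (simp add: power_mult_distrib)
  then show ?thesis by (rule power2_le_imp_le) (simp add: K)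
qed

lemma
  fixes \<Phi> :: "('a::chilbert_space \<Rightarrow> 'a) \<Rightarrow> ('b::chilbert_space \<Rightarrow> 'b)" and V :: "'a \<Rightarrow> ('a, 'b) hspace"
  assumes V: "bounded_clinear V" and \<Phi>: "\<And>s. trace_class s \<Longrightarrow> \<Phi> s = (Psi \<circ> Ad V) s"
  shows completely_positive_Psi_Ad: "completely_positive \<Phi>"
    and cb_norm_Psi_Ad_le: "K \<ge> 0 \<Longrightarrow> (\<And>x. norm (V x) \<le> K * norm x) \<Longrightarrow> cb_norm \<Phi> \<le> ennreal (K\<^sup>2)"
    and trace_preserving_Psi_Ad: "(\<And>x. norm (V x) = norm x) \<Longrightarrow> trace_preserving \<Phi>"
proof -
  show "completely_positive \<Phi>"
    unfolding completely_positive_def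
  proof (intro allI impI)
    fix n and S :: "(nat, 'a) ell2 \<Rightarrow> (nat, 'a) ell2"
    assume "amp_trace_class n S" "positive_op S"
    \<comment> \<open>Positivity gives S two equal factors, and they stay equal under
      ampliation.\<close>
    then obtain R :: "((nat, 'a) ell2, (nat, 'a) ell2) hs" where "S = hs_prod R R"
      using positive_trace_class_sqrt[of S] unfolding amp_trace_class_def by blast
    then show "positive_op (ampliation n \<Phi> S)"
      by (simp add: ampliation_hs_prod[OF V \<Phi>] positive_op_hs_prod)
  qed
  show "cb_norm \<Phi> \<le> ennreal (K\<^sup>2)" if K: "K \<ge> 0" "\<And>x. norm (V x) \<le> K * norm x"
    unfolding cb_norm_def
  proof (intro SUP_least ennreal_leI)
    fix n and S :: "(nat, 'a) ell2 \<Rightarrow> (nat, 'a) ell2"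
    assume "S \<in> {S. amp_trace_class n S \<and> trace_norm S \<le> 1}"
    then have S: "trace_class S" "trace_norm S \<le> 1" by (auto simp: amp_trace_class_def)
    obtain A B :: "((nat, 'a) ell2, (nat, 'a) ell2) hs" where AB: "S = hs_prod A B" "norm A * norm B \<le> trace_norm S"
      using trace_class_obtain[OF S(1)] .
    have "trace_norm (ampliation n \<Phi> S) \<le> norm (amp_kraus n V A) * norm (amp_kraus n V B)"
      by (simp add: AB(1) ampliation_hs_prod[OF V \<Phi>] trace_norm_hs_prod_le)
    also have "\<dots> \<le> (K * norm A) * (K * norm B)"
      by (intro mult_mono norm_amp_kraus_le V K mult_nonneg_nonneg norm_ge_zero)
    also have "\<dots> = K\<^sup>2 * (norm A * norm B)" by (simp add: power2_eq_square mult_ac)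
    also have "\<dots> \<le> K\<^sup>2 * 1" using AB(2) S(2) by (intro mult_left_mono) auto
    finally show "trace_norm (ampliation n \<Phi> S) \<le> K\<^sup>2" by simp
  qed
  show "trace_preserving \<Phi>" if iso: "\<And>x. norm (V x) = norm x"
    unfolding trace_preserving_def
  proof (intro allI impI)
    fix s :: "'a \<Rightarrow> 'a" assume s: "trace_class s"
    then obtain A B :: "('a, 'a) hs" where AB: "s = hs_prod A B" using trace_class_factor by blast
    show "trace (\<Phi> s) = trace s"
      unfolding \<Phi>[OF s] unfolding AB Psi_Ad_hs_prod[OF V] trace_hs_prod cinner_kraus_vec
      by (rule isometry_cinner_hs_lcomp[OF V iso])
  qed
qed

section \<open>Bounded sesquilinear forms\<close>

text \<open>Polarisation over 1, -1, i, -i. For unit vectors each a + c b has norm at most 2, so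
  each diagonal value is at most 4 K, and so is a quarter of their sum.\<close>

lemma sesquilinear_bound:
  fixes F :: "'x::complex_inner \<Rightarrow> 'x \<Rightarrow> complex"
  assumes al: "\<And>a a' b. F (a + a') b = F a b + F a' b" and sl: "\<And>c a b. F (c *\<^sub>C a) b = c * F a b"
    and ar: "\<And>a b b'. F a (b + b') = F a b + F a b'" and sr: "\<And>c a b. F a (c *\<^sub>C b) = cnj c * F a b"
    and diag: "\<And>a. cmod (F a a) \<le> K * (norm a)\<^sup>2" and K: "K \<ge> 0"
  shows "cmod (F a b) \<le> 4 * K * (norm a * norm b)"
proof -
  have unit: "cmod (F a b) \<le> 4 * K" if n: "norm a = 1" "norm b = 1" for a b
  proof -
    define G where "G c = F (a + c *\<^sub>C b) (a + c *\<^sub>C b)" for c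
    have G: "G c = F a a + cnj c * F a b + c * F b a + c * cnj c * F b b" for c
      by (simp add: G_def al sl ar sr algebra_simps)
    have Gn: "cmod (G c) \<le> 4 * K" if "cmod c = 1" for c
    proof -
      have "norm (a + c *\<^sub>C b) \<le> 2"
        using norm_triangle_ineq[of a "c *\<^sub>C b"] that n by (simp add: norm_scaleC)
      then have "(norm (a + c *\<^sub>C b))\<^sup>2 \<le> 2\<^sup>2" by (rule power_mono) simp
      then have "K * (norm (a + c *\<^sub>C b))\<^sup>2 \<le> K * 2\<^sup>2" by (rule mult_left_mono[OF _ K])
      then show ?thesis using diag[of "a + c *\<^sub>C b"] by (simp add: G_def)
    qed
    have "4 * F a b = G 1 - G (- 1) + \<i> * G \<i> - \<i> * G (- \<i>)"
      by (simp add: G algebra_simps)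
    then have "4 * cmod (F a b) = cmod (G 1 - G (- 1) + \<i> * G \<i> - \<i> * G (- \<i>))"
      by (metis norm_mult norm_numeral)
    also have "\<dots> \<le> cmod (G 1) + cmod (G (- 1)) + cmod (\<i> * G \<i>) + cmod (\<i> * G (- \<i>))"
      by (intro order_trans[OF norm_triangle_ineq4] add_mono order_trans[OF norm_triangle_ineq] order_refl)
    also have "\<dots> \<le> 4 * K + 4 * K + 4 * K + 4 * K"
      by (intro add_mono) (simp_all add: Gn norm_mult)
    finally show ?thesis by simp
  qed
  have z: "F 0 b = 0" "F a 0 = 0" for a b using sl[of 0 0 b] sr[of a 0 0] by simp_all
  show ?thesis
  proof (cases "a = 0 \<or> b = 0")
    case False
    define a' where "a' = complex_of_real (1 / norm a) *\<^sub>C a"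
    define b' where "b' = complex_of_real (1 / norm b) *\<^sub>C b"
    have "cmod (F a' b') \<le> 4 * K"
      using False by (intro unit) (simp_all add: a'_def b'_def norm_scaleC norm_divide)
    moreover have "cmod (F a' b') = cmod (F a b) / (norm a * norm b)"
      by (simp add: a'_def b'_def sl sr norm_mult norm_divide)
    ultimately show ?thesis using False by (simp add: pos_divide_le_eq)
  qed (use z in auto)
qed

text \<open>The Riesz vector X of f satisfies <e, X g> = 0 for basis vectors e and all g, hence X =
  0. This replaces an approximation of T by finite-rank operators.\<close>

lemma hs_functional_zero:
  fixes f :: "('c::chilbert_space, 'a::chilbert_space) hs \<Rightarrow> complex"
  assumes add: "\<And>S T. f (S + T) = f S + f T" and scale: "\<And>c T. f (c *\<^sub>C T) = c * f T"
    and bound: "\<And>T. cmod (f T) \<le> norm T * K" and B: "is_onb B"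
    and zero: "\<And>e g. e \<in> B \<Longrightarrow> f (ketbra e g) = 0"
  shows "f T = 0"
proof -
  have "bounded_linear f"
    by (rule bounded_linear_intro[where K=K]) (simp_all add: add bound scaleR_scaleC scale scaleR_conv_of_real)
  then obtain X where X: "\<And>T. f T = cinner X T" using riesz_representation scale by blast
  have "hs_apply X g = 0" for g
  proof -
    have "cinner e (hs_apply X g) = 0" if "e \<in> B" for e
      using zero[OF that, of g] unfolding X by (metis cinner_ketbra_left cinner_commute complex_cnj_zero)
    then have "((\<lambda>e. cinner e (hs_apply X g) *\<^sub>C e) has_sum 0) B" by (intro has_sum_0) simp
    from has_sum_unique[OF onb_has_sum[OF B] this] show ?thesis .
  qed
  then have "X = 0" by (intro hs_eqI) (simp add: hs_apply_zero)
  then show ?thesis by (simp add: X)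
qed

text \<open>One variable at a time; in the second the form is antilinear, so its conjugate is the
  linear functional.\<close>

lemma hs_sesquilinear_zero:
  fixes F :: "('c::chilbert_space, 'a::chilbert_space) hs \<Rightarrow> ('c, 'a) hs \<Rightarrow> complex"
  assumes al: "\<And>a a' b. F (a + a') b = F a b + F a' b" and sl: "\<And>c a b. F (c *\<^sub>C a) b = c * F a b"
    and ar: "\<And>a b b'. F a (b + b') = F a b + F a b'" and sr: "\<And>c a b. F a (c *\<^sub>C b) = cnj c * F a b"
    and bound: "\<And>a b. cmod (F a b) \<le> K * (norm a * norm b)" and B: "is_onb B"
    and zero: "\<And>e f g h. e \<in> B \<Longrightarrow> f \<in> B \<Longrightarrow> F (ketbra e g) (ketbra f h) = 0"
  shows "F S T = 0"
proof -
  have 1: "F S (ketbra f h) = 0" if "f \<in> B" for f h S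
    by (rule hs_functional_zero[OF al sl _ B zero[OF _ that], where K="K * norm (ketbra f h)"])
      (use bound in \<open>simp add: mult_ac\<close>)
  have "cnj (F S T) = 0"
    by (rule hs_functional_zero[OF _ _ _ B, where K="K * norm S"])
      (use bound[of S] 1 in \<open>simp_all add: ar sr mult_ac\<close>)
  then show ?thesis by simp
qed

section \<open>Operators defined by series and by their values on a basis\<close>

lemma bounded_clinear_infsum:
  fixes T :: "'p \<Rightarrow> 'a::chilbert_space \<Rightarrow> 'b::chilbert_space"
  assumes T: "\<And>p. bounded_clinear (T p)" and bound: "\<And>p x. norm (T p x) \<le> k p * norm x"
    and k: "k summable_on A"
  shows "((\<lambda>p. T p x) has_sum (\<Sum>\<^sub>\<infinity>p\<in>A. T p x)) A" and "bounded_clinear (\<lambda>x. \<Sum>\<^sub>\<infinity>p\<in>A. T p x)"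
proof -
  have abs: "(\<lambda>p. norm (T p x)) summable_on A" for x
    by (rule summable_on_comparison_test[OF summable_on_cmult_left[OF k, of "norm x"]]) (use bound in auto)
  then have s: "(\<lambda>p. T p x) summable_on A" for x by (rule abs_summable_summable)
  show "((\<lambda>p. T p x) has_sum (\<Sum>\<^sub>\<infinity>p\<in>A. T p x)) A" for x by (rule has_sum_infsum[OF s])
  show "bounded_clinear (\<lambda>x. \<Sum>\<^sub>\<infinity>p\<in>A. T p x)"
  proof (rule bounded_clinear_intro[where K="infsum k A"])
    show "(\<Sum>\<^sub>\<infinity>p\<in>A. T p (x + y)) = (\<Sum>\<^sub>\<infinity>p\<in>A. T p x) + (\<Sum>\<^sub>\<infinity>p\<in>A. T p y)" for x y
      by (simp add: bounded_clinear_add[OF T] infsum_add s)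
    show "(\<Sum>\<^sub>\<infinity>p\<in>A. T p (c *\<^sub>C x)) = c *\<^sub>C (\<Sum>\<^sub>\<infinity>p\<in>A. T p x)" for c x
      using has_sum_bounded_linear[OF bounded_linear_scaleC_right has_sum_infsum[OF s]]
      by (simp add: bounded_clinear_scaleC[OF T] infsumI)
    show "norm (\<Sum>\<^sub>\<infinity>p\<in>A. T p x) \<le> norm x * infsum k A" for x
    proof -
      have "norm (\<Sum>\<^sub>\<infinity>p\<in>A. T p x) \<le> (\<Sum>\<^sub>\<infinity>p\<in>A. norm (T p x))" by (rule norm_infsum_bound[OF abs])
      also have "\<dots> \<le> (\<Sum>\<^sub>\<infinity>p\<in>A. k p * norm x)"
        by (rule infsum_mono[OF abs summable_on_cmult_left[OF k]]) (rule bound)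
      also have "\<dots> = norm x * infsum k A" by (subst infsum_cmult_left') (rule mult.commute)
      finally show ?thesis .
    qed
  qed
qed

text \<open>Squares are cofinal among finite sets of index pairs. Complete positivity speaks of n by
  n blocks, so positivity of an infinite double sum has to be a limit along squares.\<close>

lemma has_sum_squares:
  assumes "(f has_sum s) (UNIV :: (nat \<times> nat) set)"
  shows "(\<lambda>n. \<Sum>p\<in>{..<n} \<times> {..<n}. f p) \<longlonglongrightarrow> s"
proof -
  have "filterlim (\<lambda>n. {..<n} \<times> {..<n}) (finite_subsets_at_top (UNIV :: (nat \<times> nat) set)) sequentially"
    unfolding filterlim_finite_subsets_at_top
  proof (intro allI impI)
    fix X :: "(nat \<times> nat) set" assume "finite X \<and> X \<subseteq> UNIV"
    then have fin: "finite (fst ` X \<union> snd ` X)" by simp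
    then obtain N where N: "\<And>i. i \<in> fst ` X \<union> snd ` X \<Longrightarrow> i < N"
      using finite_nat_bounded[OF fin] by blast
    have "X \<subseteq> {..<n} \<times> {..<n}" if "n \<ge> N" for n
      using N that by (force simp: image_iff)
    then show "\<forall>\<^sub>F n in sequentially. finite ({..<n} \<times> {..<n}) \<and> X \<subseteq> {..<n} \<times> {..<n} \<and> {..<n} \<times> {..<n} \<subseteq> (UNIV :: (nat \<times> nat) set)"
      by (intro eventually_sequentiallyI[of N]) auto
  qed
  from filterlim_compose[OF assms[unfolded has_sum_def] this] show ?thesis .
qed

text \<open>The adjoint is built first: the coefficients <w_i, z> are square summable for every z,
  so the series U z = sum of <w_i, z> e_i converges everywhere, and V is
  \<open>adj U\<close>.\<close>

lemma bounded_clinear_onb_extension: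
  fixes w :: "'i \<Rightarrow> 'b::chilbert_space" and e :: "'i \<Rightarrow> 'a::chilbert_space"
  assumes e: "is_onb (e ` I)" "inj_on e I" and K: "K \<ge> 0"
    and bound: "\<And>J c. finite J \<Longrightarrow> J \<subseteq> I \<Longrightarrow> (norm (\<Sum>i\<in>J. c i *\<^sub>C w i))\<^sup>2 \<le> K\<^sup>2 * (\<Sum>i\<in>J. (cmod (c i))\<^sup>2)"
  shows "\<exists>V. bounded_clinear V \<and> (\<forall>i\<in>I. V (e i) = w i) \<and> (\<forall>x. norm (V x) \<le> K * norm x)"
proof -
  let ?B = "e ` I"
  define v where "v b = w (inv_into I e b)" for b
  have ortho: "orthonormal ?B" using e by (simp add: is_onb_def)
  have S: "(\<Sum>b\<in>F. (cmod (cinner (v b) z))\<^sup>2) \<le> K\<^sup>2 * (norm z)\<^sup>2" if F: "finite F" "F \<subseteq> ?B" for F z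
  proof -
    \<comment> \<open>Duality: S = <u, z>, while the hypothesis with coefficients <v b, z> bounds
      |u|^2 by K^2 S; dividing by S leaves the claim.\<close>
    define S where "S = (\<Sum>b\<in>F. (cmod (cinner (v b) z))\<^sup>2)"
    define u where "u = (\<Sum>b\<in>F. cinner (v b) z *\<^sub>C v b)"
    have S0: "S \<ge> 0" by (simp add: S_def sum_nonneg)
    have "cinner u z = complex_of_real S"
      by (simp add: u_def S_def cinner_sum_left cinner_scaleC_left of_real_cmod_power2 mult.commute)
    then have "S = cmod (cinner u z)" using S0 by simp
    also have "\<dots> \<le> norm u * norm z" by (rule cinner_bound)
    finally have "S\<^sup>2 \<le> (norm u * norm z)\<^sup>2" by (rule power_mono) (rule S0)
    also have "\<dots> \<le> (K\<^sup>2 * S) * (norm z)\<^sup>2"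
    proof -
      let ?J = "inv_into I e ` F"
      have inj: "inj_on (inv_into I e) F" by (rule inj_on_inv_into[OF F(2)])
      have "(norm (\<Sum>i\<in>?J. cinner (w i) z *\<^sub>C w i))\<^sup>2 \<le> K\<^sup>2 * (\<Sum>i\<in>?J. (cmod (cinner (w i) z))\<^sup>2)"
        using F by (intro bound) (auto intro: inv_into_into)
      then have "(norm u)\<^sup>2 \<le> K\<^sup>2 * S"
        by (simp add: sum.reindex[OF inj] u_def S_def v_def)
      then show ?thesis unfolding power_mult_distrib by (rule mult_right_mono) simp
    qed
    finally have "S * S \<le> S * (K\<^sup>2 * (norm z)\<^sup>2)" by (simp add: power2_eq_square mult_ac)
    then show ?thesis
      using S0 by (cases "S = 0") (auto simp: S_def[symmetric] mult_le_cancel_left)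
  qed
  have summ: "(\<lambda>b. (cmod (cinner (v b) z))\<^sup>2) summable_on ?B" for z
    by (rule nonneg_bdd_above_summable_on) (auto intro!: bdd_aboveI2[where M="K\<^sup>2 * (norm z)\<^sup>2"] S)
  define U where "U z = (\<Sum>\<^sub>\<infinity>b\<in>?B. cinner (v b) z *\<^sub>C b)" for z
  have sU: "(\<lambda>b. cinner (v b) z *\<^sub>C b) summable_on ?B" for z
    by (rule orthonormal_summable[OF ortho summ])
  have bU: "cinner b (U z) = cinner (v b) z" if b: "b \<in> ?B" for b z
  proof -
    have "((\<lambda>f. cinner b (cinner (v f) z *\<^sub>C f)) has_sum cinner b (U z)) ?B"
      unfolding U_def by (rule has_sum_bounded_linear[OF bounded_linear_cinner_right has_sum_infsum[OF sU]])
    moreover have "((\<lambda>f. cinner b (cinner (v f) z *\<^sub>C f)) has_sum cinner (v b) z) ?B"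
      by (rule has_sum_finite_neutralI[where B="{b}"])
        (use b ortho in \<open>auto simp: orthonormal_def cinner_scaleC_right\<close>)
    ultimately show ?thesis by (rule has_sum_unique)
  qed
  have Un: "norm (U z) \<le> K * norm z" for z
  proof (rule power2_le_imp_le)
    have "((\<lambda>b. (cmod (cinner (v b) z))\<^sup>2) has_sum (norm (U z))\<^sup>2) ?B"
      using parseval[OF e(1), of "U z"] by (simp add: bU cong: has_sum_cong)
    then have "(norm (U z))\<^sup>2 = (\<Sum>\<^sub>\<infinity>b\<in>?B. (cmod (cinner (v b) z))\<^sup>2)" by (simp add: infsumI)
    also have "\<dots> \<le> K\<^sup>2 * (norm z)\<^sup>2" by (rule infsum_le_finite_sums[OF summ S])
    finally show "(norm (U z))\<^sup>2 \<le> (K * norm z)\<^sup>2" by (simp add: power_mult_distrib)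
  qed (simp add: K)
  have U: "bounded_clinear U"
  proof (rule bounded_clinear_intro[where K=K])
    show "U (x + y) = U x + U y" for x y
      unfolding U_def cinner_add_right scaleC_add_left by (rule infsum_add[OF sU sU])
    show "U (c *\<^sub>C x) = c *\<^sub>C U x" for c x
      using has_sum_bounded_linear[OF bounded_linear_scaleC_right has_sum_infsum[OF sU[of x]], of c]
      by (simp add: U_def cinner_scaleC_right scaleC_scaleC infsumI)
  qed (simp add: Un mult.commute)
  have "norm (adj U x) \<le> K * norm x" for x by (rule adj_norm_le[OF U K Un])
  moreover have "adj U (e i) = w i" if i: "i \<in> I" for i
  proof -
    have "cinner (adj U (e i)) z = cinner (w i) z" for z
      using i e(2) by (simp add: cinner_adj_left[OF U] bU v_def)
    then show ?thesis by (intro cinner_eqI) (metis cinner_commute)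
  qed
  ultimately show ?thesis using adj_bounded_clinear[OF U] by blast
qed

section \<open>A square root of the weighted Choi operator\<close>

lemma has_sum_half_power: "((\<lambda>n. (1 / 2) ^ n) has_sum (2::real)) UNIV"
  by (rule norm_summable_imp_has_sum) (use geometric_sums[of "1/2::real"] in \<open>simp_all add: summable_geometric\<close>)

text \<open>The weights \<open>2\<^sup>-\<^sup>i\<close> are what makes the block operator with entries \<open>F i j\<close> bounded.\<close>

lemma block_sqrt_exists:
  fixes e :: "nat \<Rightarrow> 'a::chilbert_space" and F :: "nat \<Rightarrow> nat \<Rightarrow> 'b::chilbert_space \<Rightarrow> 'b"
  defines "M \<equiv> \<lambda>i (y::'b). e i \<otimes> y"
  assumes ortho: "\<And>i j. cinner (e i) (e j) = (if i = j \<and> i \<in> I then 1 else 0)"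
    and F: "\<And>i j. bounded_clinear (F i j)" and D: "\<And>i j y. norm (F i j y) \<le> D * norm y"
    and pos: "\<And>n y. \<exists>r\<ge>0. (\<Sum>i<n. \<Sum>j<n. cinner (y i) (F i j (y j))) = complex_of_real r"
  shows "\<exists>R. positive_op R \<and> (\<forall>k\<in>I. \<forall>l\<in>I. \<forall>y. adj (M k) (R (R (M l y))) = complex_of_real ((1/2) ^ k * (1/2) ^ l) *\<^sub>C F k l y)"
proof -
  let ?c = "\<lambda>i j. complex_of_real ((1/2) ^ i * (1/2) ^ j)"
  have bM: "bounded_clinear (M i)" for i unfolding M_def by (rule bounded_clinear_tensor_right)
  \<comment> \<open>Indices outside I have e i = 0, which treats finite and infinite bases
    alike.\<close>
  have en: "norm (e i) \<le> 1" for i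
  proof -
    have "complex_of_real ((norm (e i))\<^sup>2) = complex_of_real (if i \<in> I then 1 else 0)"
      using ortho[of i i] by (simp add: cinner_self)
    then have "(norm (e i))\<^sup>2 \<le> 1\<^sup>2" unfolding of_real_eq_iff by simp
    then show ?thesis by (rule power2_le_imp_le) simp
  qed
  have Mn: "norm (M i y) \<le> 1 * norm y" for i y
    unfolding M_def norm_tensor by (rule mult_right_mono[OF en]) simp
  have Nn: "norm (adj (M i) t) \<le> norm t" for i t
    using adj_norm_le[where T="M i" and K=1 and y=t, OF bM _ Mn] by simp
  \<comment> \<open>For p = (i, j), the weighted block in row i and column j.\<close>
  define T where "T p t = ?c (fst p) (snd p) *\<^sub>C M (fst p) (F (fst p) (snd p) (adj (M (snd p)) t))" for p t
  have bT: "bounded_clinear (T p)" for p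
    unfolding T_def
    using bounded_clinear_scale[OF bounded_clinear_compose[OF bM bounded_clinear_compose[OF F adj_bounded_clinear[OF bM]]], of "?c (fst p) (snd p)" "fst p" "fst p" "snd p" "snd p"]
    by (simp add: o_def)
  \<comment> \<open>D itself may be negative when the space of the y is trivial.\<close>
  define D' where "D' = max D 0"
  have Tn: "norm (T p t) \<le> ((1/2) ^ fst p * (1/2) ^ snd p * D') * norm t" for p t
  proof -
    have "norm (M (fst p) (F (fst p) (snd p) (adj (M (snd p)) t))) \<le> D' * norm t"
    proof -
      have "norm (M (fst p) (F (fst p) (snd p) (adj (M (snd p)) t))) \<le> D * norm (adj (M (snd p)) t)"
        using Mn D by (metis mult_1 order_trans)
      also have "\<dots> \<le> D' * norm t" by (rule mult_mono[OF _ Nn]) (auto simp: D'_def)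
      finally show ?thesis .
    qed
    from mult_left_mono[OF this, of "(1/2) ^ fst p * (1/2) ^ snd p"] show ?thesis
      unfolding T_def norm_scaleC norm_of_real by (simp add: mult_ac)
  qed
  have ksum: "(\<lambda>p. (1/2) ^ fst p * (1/2) ^ snd p * D') summable_on (UNIV :: (nat \<times> nat) set)"
  proof -
    have "(\<lambda>(i, j). (1/2) ^ i * (1/2) ^ j * D') summable_on (SIGMA i:(UNIV::nat set). (UNIV::nat set))"
    proof (rule summable_on_SigmaI)
      show "((\<lambda>j. case (i, j) of (i, j) \<Rightarrow> (1/2) ^ i * (1/2) ^ j * D') has_sum (1/2) ^ i * 2 * D') UNIV" for i :: nat
        using has_sum_cmult_left[OF has_sum_cmult_right[OF has_sum_half_power, of "(1/2) ^ i"], of D'] by simp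
      show "(\<lambda>i. (1/2) ^ i * 2 * D') summable_on (UNIV::nat set)"
        by (intro summable_on_cmult_left has_sum_imp_summable[OF has_sum_half_power])
    qed (auto simp: D'_def)
    then show ?thesis by (simp add: case_prod_unfold)
  qed
  define G where "G t = (\<Sum>\<^sub>\<infinity>p. T p t)" for t
  have GT: "((\<lambda>p. T p t) has_sum G t) UNIV" for t
    unfolding G_def by (rule bounded_clinear_infsum(1)[OF bT Tn ksum])
  have bG: "bounded_clinear G"
    unfolding G_def by (rule bounded_clinear_infsum(2)[OF bT Tn ksum])
  have "positive_op G"
  proof (rule positive_opI[OF bG])
    fix t
    \<comment> \<open>The weights are absorbed into the vectors, so each square partial sum is an
      instance of \<open>pos\<close>.\<close>
    define y where "y i = complex_of_real ((1/2) ^ i) *\<^sub>C adj (M i) t" for i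
    define s where "s n = (\<Sum>p\<in>{..<n} \<times> {..<n}. cinner t (T p t))" for n
    have lim: "s \<longlonglongrightarrow> cinner t (G t)"
      unfolding s_def by (rule has_sum_squares[OF has_sum_bounded_linear[OF bounded_linear_cinner_right GT]])
    have "s n = (\<Sum>i<n. \<Sum>j<n. cinner (y i) (F i j (y j)))" for n
      unfolding s_def sum.cartesian_product
      by (rule sum.cong)
        (auto simp: T_def y_def cinner_scaleC_right cinner_scaleC_left bounded_clinear_scaleC[OF F] cinner_adj_left[OF bM])
    then have r: "\<exists>r\<ge>0. s n = complex_of_real r" for n using pos by simp
    have "Im (cinner t (G t)) = 0"
    proof -
      have "Im (s n) = 0" for n using r[of n] by auto
      then show ?thesis using tendsto_Im[OF lim] by (simp add: LIMSEQ_const_iff)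
    qed
    moreover have "Re (cinner t (G t)) \<ge> 0"
    proof (rule tendsto_lowerbound[OF tendsto_Re[OF lim]])
      show "\<forall>\<^sub>F n in sequentially. 0 \<le> Re (s n)" using r by (metis Re_complex_of_real always_eventually)
    qed simp
    ultimately show "\<exists>r\<ge>0. cinner t (G t) = complex_of_real r"
      by (intro exI[of _ "Re (cinner t (G t))"]) (simp add: complex_eq_iff)
  qed
  then obtain R where R: "positive_op R" "R \<circ> R = G" by (rule positive_sqrt_exists)
  \<comment> \<open>The M_i are isometries with orthogonal ranges for i in I and zero otherwise, so
    compressing G isolates one block.\<close>
  have NM: "adj (M k) (M i y) = (if i = k \<and> k \<in> I then y else 0)" for k i y
    by (rule cinner_eqI) (simp add: cinner_adj_right[OF bM], auto simp add: M_def cinner_tensor ortho)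
  have "adj (M k) (R (R (M l y))) = ?c k l *\<^sub>C F k l y" if kl: "k \<in> I" "l \<in> I" for k l y
  proof -
    have bl: "bounded_linear (adj (M k))" by (rule bounded_clinear_bounded_linear[OF adj_bounded_clinear[OF bM]])
    have "((\<lambda>p. adj (M k) (T p (M l y))) has_sum adj (M k) (G (M l y))) UNIV"
      by (rule has_sum_bounded_linear[OF bl GT])
    moreover have "((\<lambda>p. adj (M k) (T p (M l y))) has_sum ?c k l *\<^sub>C F k l y) UNIV"
      by (rule has_sum_finite_neutralI[where B="{(k, l)}"])
        (use kl in \<open>auto simp: T_def NM bounded_clinear_scaleC[OF adj_bounded_clinear[OF bM]] bounded_clinear_zero[OF F]\<close>)
    ultimately have "adj (M k) (G (M l y)) = ?c k l *\<^sub>C F k l y" by (rule has_sum_unique)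
    then show ?thesis by (simp flip: R(2))
  qed
  then show ?thesis using R(1) by blast
qed

section \<open>Completely positive maps\<close>

lemma trace_ketbra: "trace (hs_apply (ketbra x y)) = cinner y x"
  using trace_comp_ketbra[OF bounded_clinear_id, of x y] by (simp add: id_def o_def)

text \<open>The middle vector is x itself, with the second factor rescaled to compensate; the norms
  of the factors multiply to |x| |y|.\<close>

lemma ketbra_hs_prod:
  assumes "x \<noteq> 0"
  shows "hs_apply (ketbra x y) = hs_prod (ketbra x x) (ketbra (complex_of_real (1 / (norm x)\<^sup>2) *\<^sub>C y) x)"
  unfolding hs_prod_ketbra cinner_self using assms
  by (simp add: fun_eq_iff hs_apply_scaleC ketbra_apply cinner_scaleC_left scaleC_scaleC)

lemma trace_class_ketbra: "trace_class (hs_apply (ketbra x y :: ('a::chilbert_space, 'a) hs))"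
proof (cases "x = 0")
  case True
  then have "hs_apply (ketbra x y) = (\<lambda>_. 0)" by (simp add: fun_eq_iff ketbra_apply)
  then show ?thesis by (simp only: trace_class_zero)
next
  case False
  show ?thesis by (subst ketbra_hs_prod[OF False]) (rule trace_class_hs_prod)
qed

lemma positive_op_ketbra: "positive_op (hs_apply (ketbra x x))"
proof (rule positive_opI[OF hs_apply_bounded_clinear])
  show "\<exists>r\<ge>0. cinner y (hs_apply (ketbra x x) y) = complex_of_real r" for y
  proof (intro exI conjI)
    show "cinner y (hs_apply (ketbra x x) y) = complex_of_real ((cmod (cinner x y))\<^sup>2)"
      unfolding ketbra_apply cinner_scaleC_right complex_norm_square by (simp add: mult.commute flip: cinner_commute)
  qed simp
qed

lemma ketbra_sum:
  "hs_apply (ketbra (\<Sum>i\<in>J. c i *\<^sub>C x i) (\<Sum>j\<in>J. c j *\<^sub>C x j)) z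
    = (\<Sum>(i, j)\<in>J \<times> J. (c i * cnj (c j)) *\<^sub>C hs_apply (ketbra (x i) (x j)) z)"
  unfolding ketbra_apply cinner_sum_left cvec.scale_sum_right cvec.scale_sum_left sum.cartesian_product[symmetric]
  by (simp add: cinner_scaleC_left scaleC_scaleC mult_ac)

lemma hs_prod_sum_sum:
  "hs_prod (\<Sum>i\<in>J. c i *\<^sub>C w i) (\<Sum>j\<in>J. c j *\<^sub>C w j) z
    = (\<Sum>(i, j)\<in>J \<times> J. (c i * cnj (c j)) *\<^sub>C hs_prod (w i) (w j) z)"
  unfolding hs_prod_sum_left unfolding hs_prod_sum_right sum.cartesian_product[symmetric]
  by (simp add: hs_prod_scaleC_left hs_prod_scaleC_right scaleC_scaleC mult.commute)

lemma ell2_nth_trunc: "ell2_nth (ell2_trunc n f) i = (if i < n then ell2_nth f i else 0)"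
  by (simp add: ell2_trunc_def ell2_nth_sum ell2_nth_single)

lemma cinner_ell2_single_right: "cinner f (ell2_single i x) = cinner (ell2_nth f i) x"
  by (metis cinner_commute cinner_ell2_single)

lemma cinner_sum_single: "cinner (\<Sum>i<n. ell2_single i (x i)) f = (\<Sum>i<n. cinner (x i) (ell2_nth f i))"
  by (simp add: cinner_sum_left cinner_ell2_single)

lemma ell2_nth_sum_single:
  "ell2_nth (\<Sum>j<n. ell2_single j (x j)) i = (if i < (n::nat) then x i else 0)"
proof -
  have "ell2_nth (\<Sum>j<n. ell2_single j (x j)) i = (\<Sum>j<n. if j = i then x j else 0)"
    unfolding ell2_nth_sum by (rule sum.cong) (auto simp: ell2_nth_single)
  then show ?thesis by simp
qed

text \<open>Complete positivity is tested on |X><X| for the family X of the x i, whose blocks are |x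
  i><x j|, at the family Y of the y i. For basis vectors this is positivity of finite sections of
  the Choi operator.\<close>

lemma completely_positive_ketbra:
  fixes \<Phi> :: "('a::chilbert_space \<Rightarrow> 'a) \<Rightarrow> ('b::chilbert_space \<Rightarrow> 'b)"
  assumes CP: "completely_positive \<Phi>"
  shows "\<exists>r\<ge>0. (\<Sum>i<(n::nat). \<Sum>j<n. cinner (y i) (\<Phi> (hs_apply (ketbra (x i) (x j))) (y j))) = complex_of_real r"
proof -
  define X where "X = (\<Sum>i<n. ell2_single i (x i))"
  define Y where "Y = (\<Sum>i<n. ell2_single i (y i))"
  let ?S = "hs_apply (ketbra X X)"
  have Xi: "ell2_nth X i = (if i < n then x i else 0)" and Yi: "ell2_nth Y i = (if i < n then y i else 0)" for i
    by (simp_all add: X_def Y_def ell2_nth_sum_single)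
  have "ell2_trunc n X = X" by (rule ell2_eqI) (simp add: ell2_nth_trunc Xi)
  moreover have "cinner X (ell2_trunc n f) = cinner X f" for f
    unfolding X_def cinner_sum_single by (rule sum.cong) (simp_all add: ell2_nth_trunc)
  moreover have "bounded_clinear (ell2_trunc n :: (nat, 'a) ell2 \<Rightarrow> _)"
    unfolding ell2_trunc_def
    by (intro bounded_clinear_sum_fun) (use bounded_clinear_compose[OF bounded_clinear_ell2_single bounded_clinear_ell2_nth] in \<open>simp add: o_def\<close>)
  ultimately have "?S = ell2_trunc n \<circ> ?S \<circ> ell2_trunc n"
    by (simp add: fun_eq_iff ketbra_apply bounded_clinear_scaleC)
  then have "positive_op (ampliation n \<Phi> ?S)"
    using CP positive_op_ketbra[of X] trace_class_ketbra[of X X]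
    unfolding completely_positive_def amp_trace_class_def by blast
  then have "\<exists>r\<ge>0. cinner Y (ampliation n \<Phi> ?S Y) = complex_of_real r"
    by (metis positive_op_Re_nonneg positive_op_cinner_of_real)
  moreover have "block ?S i j = hs_apply (ketbra (x i) (x j))" if "i < n" "j < n" for i j
    using that by (simp add: fun_eq_iff block_def ketbra_apply ell2_nth_scaleC cinner_ell2_single_right Xi)
  then have "cinner Y (ampliation n \<Phi> ?S Y) = (\<Sum>i<n. \<Sum>j<n. cinner (y i) (\<Phi> (hs_apply (ketbra (x i) (x j))) (y j)))"
    unfolding ampliation_def cinner_sum_right cinner_ell2_single_right Yi
    by (intro sum.cong refl) simp
  ultimately show ?thesis by simp
qed

section \<open>Consequences of the ampliation of order one\<close>

lemma ampliation_1:
  fixes \<Phi> :: "('a::chilbert_space \<Rightarrow> 'a) \<Rightarrow> ('b::chilbert_space \<Rightarrow> 'b)"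
  shows "ampliation 1 \<Phi> (ell2_single 0 \<circ> s \<circ> (\<lambda>f. ell2_nth f 0)) = ell2_single 0 \<circ> \<Phi> s \<circ> (\<lambda>f. ell2_nth f 0)"
proof -
  have "block (ell2_single 0 \<circ> s \<circ> (\<lambda>f. ell2_nth f 0)) 0 (0::nat) = s"
    by (simp add: block_def ell2_nth_single)
  then show ?thesis by (intro ext) (simp add: ampliation_def)
qed

lemma amp_trace_class_1:
  assumes s: "trace_class (s :: 'a::chilbert_space \<Rightarrow> 'a)"
  shows "amp_trace_class 1 (ell2_single 0 \<circ> s \<circ> (\<lambda>f. ell2_nth f 0))"
  unfolding amp_trace_class_def
proof
  show "trace_class (ell2_single (0::nat) \<circ> s \<circ> (\<lambda>f. ell2_nth f 0))"
    by (rule trace_class_comp[OF s bounded_clinear_ell2_single bounded_clinear_ell2_nth])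
  show "ell2_single (0::nat) \<circ> s \<circ> (\<lambda>f. ell2_nth f 0)
      = ell2_trunc 1 \<circ> (ell2_single 0 \<circ> s \<circ> (\<lambda>f. ell2_nth f 0)) \<circ> ell2_trunc 1"
    by (intro ext ell2_eqI) (simp add: ell2_nth_trunc ell2_nth_single)
qed

lemma completely_positive_positive:
  fixes \<Phi> :: "('a::chilbert_space \<Rightarrow> 'a) \<Rightarrow> ('b::chilbert_space \<Rightarrow> 'b)"
  assumes CP: "completely_positive \<Phi>" and L: "tc_linear \<Phi>" and s: "positive_op s" "trace_class s"
  shows "positive_op (\<Phi> s)"
proof (rule positive_opI)
  show "bounded_clinear (\<Phi> s)"
    using L s(2) by (simp add: tc_linear_def trace_class_bounded_clinear)
  let ?S = "ell2_single (0::nat) \<circ> s \<circ> (\<lambda>f. ell2_nth f 0)"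
  have "positive_op ?S"
  proof (rule positive_opI)
    show "bounded_clinear ?S"
      by (intro bounded_clinear_compose bounded_clinear_ell2_single bounded_clinear_ell2_nth trace_class_bounded_clinear s)
    show "\<exists>r\<ge>0. cinner f (?S f) = complex_of_real r" for f
      using positive_op_Re_nonneg[OF s(1)] positive_op_cinner_of_real[OF s(1)]
      by (auto simp: cinner_ell2_single_right)
  qed
  then have "positive_op (ampliation 1 \<Phi> ?S)"
    using CP amp_trace_class_1[OF s(2)] unfolding completely_positive_def by blast
  then have p: "positive_op (ell2_single (0::nat) \<circ> \<Phi> s \<circ> (\<lambda>f. ell2_nth f 0))"
    unfolding ampliation_1 .
  show "\<exists>r\<ge>0. cinner x (\<Phi> s x) = complex_of_real r" for x
    using positive_op_Re_nonneg[OF p, of "ell2_single 0 x"] positive_op_cinner_of_real[OF p, of "ell2_single 0 x"]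
    by (auto simp: cinner_ell2_single ell2_nth_single)
qed

lemma cb_norm_trace_norm_le:
  fixes \<Phi> :: "('a::chilbert_space \<Rightarrow> 'a) \<Rightarrow> ('b::chilbert_space \<Rightarrow> 'b)"
  assumes L: "tc_linear \<Phi>" and cb: "cb_norm \<Phi> \<le> ennreal C" and C: "C \<ge> 0" and s: "trace_class s"
  shows "trace_norm (\<Phi> s) \<le> C * trace_norm s"
proof -
  have \<Phi>s: "trace_class (\<Phi> s)" using L s by (simp add: tc_linear_def)
  \<comment> \<open>Normalising divides by some r > 0 because \<open>trace_norm s\<close> may be 0;
    r is brought close to it at the end.\<close>
  have main: "trace_norm (\<Phi> s) \<le> C * r" if r: "r > 0" "trace_norm s \<le> r" for r
  proof -
    define u where "u = (\<lambda>x. complex_of_real (1 / r) *\<^sub>C s x)"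
    let ?J = "ell2_single (0::nat) :: 'a \<Rightarrow> _" and ?N = "\<lambda>f::(nat, 'a) ell2. ell2_nth f 0"
    let ?J' = "ell2_single (0::nat) :: 'b \<Rightarrow> _" and ?N' = "\<lambda>f::(nat, 'b) ell2. ell2_nth f 0"
    have u: "trace_class u" unfolding u_def by (rule trace_class_scaleC[OF s])
    have "trace_norm u \<le> (1 / r) * trace_norm s"
      using trace_norm_scaleC_le[OF s, of "complex_of_real (1 / r)"] r(1) by (simp add: u_def norm_divide)
    also have "\<dots> \<le> 1" using r by (simp add: pos_divide_le_eq)
    finally have u1: "trace_norm u \<le> 1" .
    have "trace_norm (?J \<circ> u \<circ> ?N) \<le> 1"
      by (rule order_trans[OF trace_norm_comp_contraction u1])
        (simp_all add: u bounded_clinear_ell2_single bounded_clinear_ell2_nth norm_ell2_single ell2_nth_norm_le)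
    then have "ennreal (trace_norm (ampliation 1 \<Phi> (?J \<circ> u \<circ> ?N))) \<le> cb_norm \<Phi>"
      unfolding cb_norm_def using amp_trace_class_1[OF u] by (intro SUP_upper2[of 1] SUP_upper2[of "?J \<circ> u \<circ> ?N"]) auto
    then have "trace_norm (?J' \<circ> \<Phi> u \<circ> ?N') \<le> C"
      using cb C unfolding ampliation_1 by (metis ennreal_le_iff order_trans)
    moreover have tc: "trace_class (?J' \<circ> \<Phi> u \<circ> ?N')"
      using L u by (intro trace_class_comp bounded_clinear_ell2_single bounded_clinear_ell2_nth) (simp add: tc_linear_def)
    then have "trace_norm (?N' \<circ> (?J' \<circ> \<Phi> u \<circ> ?N') \<circ> ?J') \<le> trace_norm (?J' \<circ> \<Phi> u \<circ> ?N')"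
      by (rule trace_norm_comp_contraction)
        (simp_all add: bounded_clinear_ell2_single bounded_clinear_ell2_nth norm_ell2_single ell2_nth_norm_le)
    moreover have "?N' \<circ> (?J' \<circ> \<Phi> u \<circ> ?N') \<circ> ?J' = \<Phi> u" by (simp add: fun_eq_iff ell2_nth_single)
    ultimately have "trace_norm (\<Phi> u) \<le> C" by simp
    moreover have "\<Phi> s = (\<lambda>x. complex_of_real r *\<^sub>C \<Phi> u x)"
    proof -
      have "\<Phi> u = (\<lambda>x. complex_of_real (1 / r) *\<^sub>C \<Phi> s x)" unfolding u_def using L s by (simp only: tc_linear_def)
      then show ?thesis using r(1) by (simp add: scaleC_scaleC)
    qed
    moreover have "trace_class (\<Phi> u)" using L u by (simp add: tc_linear_def)
    ultimately have "trace_norm (\<Phi> s) \<le> r * trace_norm (\<Phi> u)"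
      using trace_norm_scaleC_le[of "\<Phi> u" "complex_of_real r"] r(1) by simp
    also have "\<dots> \<le> r * C" using r(1) \<open>trace_norm (\<Phi> u) \<le> C\<close> by simp
    finally show ?thesis by (simp add: mult.commute)
  qed
  show ?thesis
  proof (rule field_le_epsilon)
    fix \<epsilon> :: real assume \<epsilon>: "\<epsilon> > 0"
    have "trace_norm (\<Phi> s) \<le> C * (trace_norm s + \<epsilon> / (C + 1))"
      using \<epsilon> C trace_norm_nonneg[OF s] by (intro main) (auto intro: add_nonneg_pos)
    also have "\<dots> \<le> C * trace_norm s + \<epsilon>"
      using \<epsilon> C by (simp add: distrib_left pos_divide_le_eq) 
    finally show "trace_norm (\<Phi> s) \<le> C * trace_norm s + \<epsilon>" .
  qed
qed

section \<open>Boundedness of a completely positive map from the trace inequality\<close>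

context
  fixes \<Phi> :: "('a::chilbert_space \<Rightarrow> 'a) \<Rightarrow> ('b::chilbert_space \<Rightarrow> 'b)" and C :: real
  assumes L: "tc_linear \<Phi>" and CP: "completely_positive \<Phi>" and C: "C \<ge> 0"
    and tr: "\<And>s. positive_op s \<Longrightarrow> trace_class s \<Longrightarrow> Re (trace (\<Phi> s)) \<le> C * Re (trace s)"
begin

lemma Phi_trace_class: "trace_class s \<Longrightarrow> trace_class (\<Phi> s)"
  and Phi_add: "trace_class s \<Longrightarrow> trace_class t \<Longrightarrow> \<Phi> (\<lambda>x. s x + t x) = (\<lambda>x. \<Phi> s x + \<Phi> t x)"
  and Phi_scaleC: "trace_class s \<Longrightarrow> \<Phi> (\<lambda>x. c *\<^sub>C s x) = (\<lambda>x. c *\<^sub>C \<Phi> s x)"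
  using L by (auto simp: tc_linear_def)

lemma Phi_zero: "\<Phi> (\<lambda>_. 0) = (\<lambda>_. 0)"
  using Phi_scaleC[OF trace_class_zero, of 0] by simp

lemma Phi_sum:
  assumes "\<And>p. p \<in> P \<Longrightarrow> trace_class (f p)"
  shows "\<Phi> (\<lambda>x. \<Sum>p\<in>P. c p *\<^sub>C f p x) = (\<lambda>x. \<Sum>p\<in>P. c p *\<^sub>C \<Phi> (f p) x)"
  using assms
proof (induction P rule: infinite_finite_induct)
  case (insert p P)
  then show ?case
    by (simp add: Phi_add Phi_scaleC trace_class_scaleC trace_class_sum)
qed (simp_all add: Phi_zero)

lemma Phi_hs_prod_add_left: "\<Phi> (hs_prod (A + A') B) x = \<Phi> (hs_prod A B) x + \<Phi> (hs_prod A' B) x"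
  using fun_cong[OF Phi_add[OF trace_class_hs_prod[of A B] trace_class_hs_prod[of A' B]]]
  by (simp flip: hs_prod_add_left)

lemma Phi_hs_prod_add_right: "\<Phi> (hs_prod A (B + B')) x = \<Phi> (hs_prod A B) x + \<Phi> (hs_prod A B') x"
  using fun_cong[OF Phi_add[OF trace_class_hs_prod[of A B] trace_class_hs_prod[of A B']]]
  by (simp flip: hs_prod_add_right)

lemma Phi_hs_prod_scaleC_left: "\<Phi> (hs_prod (c *\<^sub>C A) B) x = c *\<^sub>C \<Phi> (hs_prod A B) x"
  using fun_cong[OF Phi_scaleC[OF trace_class_hs_prod[of A B]]] by (simp flip: hs_prod_scaleC_left)

lemma Phi_hs_prod_scaleC_right: "\<Phi> (hs_prod A (c *\<^sub>C B)) x = cnj c *\<^sub>C \<Phi> (hs_prod A B) x"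
  using fun_cong[OF Phi_scaleC[OF trace_class_hs_prod[of A B], of "cnj c"]] by (simp flip: hs_prod_scaleC_right)

text \<open>On the diagonal the image of A A^* is positive, so its trace norm is its trace, at most
  C |A|^2. Polarisation costs the factor 4.\<close>

lemma Phi_hs_prod_bound:
  "cmod (cinner y (\<Phi> (hs_prod A B) z)) \<le> 4 * (C * (norm y * norm z)) * (norm A * norm B)"
proof (rule sesquilinear_bound[where F="\<lambda>A B. cinner y (\<Phi> (hs_prod A B) z)"])
  note tc = trace_class_hs_prod
  fix A :: "('c::chilbert_space, 'a) hs"
  have "trace_norm (\<Phi> (hs_prod A A)) = Re (trace (\<Phi> (hs_prod A A)))"
    by (rule positive_trace[OF completely_positive_positive[OF CP L positive_op_hs_prod tc]])
  also have "\<dots> \<le> C * Re (trace (hs_prod A A))" by (rule tr[OF positive_op_hs_prod tc])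
  also have "\<dots> = C * (norm A)\<^sup>2" by (simp add: trace_hs_prod cinner_self)
  finally have "trace_norm (\<Phi> (hs_prod A A)) * (norm y * norm z) \<le> C * (norm A)\<^sup>2 * (norm y * norm z)"
    by (rule mult_right_mono) simp
  with trace_class_cinner_bound[OF Phi_trace_class[OF tc[of A A]], of y z]
  show "cmod (cinner y (\<Phi> (hs_prod A A) z)) \<le> C * (norm y * norm z) * (norm A)\<^sup>2" by (simp add: mult_ac)
qed (simp_all add: C Phi_hs_prod_add_left Phi_hs_prod_add_right Phi_hs_prod_scaleC_left Phi_hs_prod_scaleC_right
    cinner_add_right cinner_scaleC_right)

text \<open>The image vector is paired with itself in the previous bound. The case x = 0 is separate
  because the factorisation divides by |x|^2.\<close>

lemma Phi_ketbra_bound: 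
  assumes "norm x \<le> 1" "norm x' \<le> 1"
  shows "norm (\<Phi> (hs_apply (ketbra x x')) z) \<le> 4 * C * norm z"
proof (cases "x = 0")
  case True
  then have "hs_apply (ketbra x x') = (\<lambda>_. 0)" by (simp add: fun_eq_iff ketbra_apply)
  then show ?thesis using C by (simp add: Phi_zero)
next
  case False
  let ?F = "\<Phi> (hs_apply (ketbra x x')) z"
  have "(norm ?F)\<^sup>2 = cmod (cinner ?F ?F)" by (simp add: cinner_self del: of_real_power)
  also have "\<dots> \<le> 4 * (C * (norm ?F * norm z)) * (norm (ketbra x x) * norm (ketbra (complex_of_real (1 / (norm x)\<^sup>2) *\<^sub>C x') x))"
    by (simp only: ketbra_hs_prod[OF False] Phi_hs_prod_bound)
  also have "norm (ketbra x x) * norm (ketbra (complex_of_real (1 / (norm x)\<^sup>2) *\<^sub>C x') x) = norm x * norm x'"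
    using False by (simp add: norm_ketbra norm_scaleC norm_divide norm_mult power2_eq_square)
  also have "4 * (C * (norm ?F * norm z)) * (norm x * norm x') \<le> 4 * (C * (norm ?F * norm z)) * (1 * 1)"
    using assms C by (intro mult_left_mono mult_mono) auto
  finally have "norm ?F * norm ?F \<le> norm ?F * (4 * C * norm z)" by (simp add: power2_eq_square mult_ac)
  then show ?thesis using C by (cases "norm ?F = 0") (auto simp: mult_le_cancel_left)
qed

end

section \<open>Stinespring representation\<close>

text \<open>An arbitrary trace constant C covers all three equivalences at once. It controls the
  square of the norm of V, hence the root.\<close>

theorem stinespring_representation:
  fixes e :: "nat \<Rightarrow> 'a::chilbert_space" and \<Phi> :: "('a \<Rightarrow> 'a) \<Rightarrow> ('b::chilbert_space \<Rightarrow> 'b)"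
  assumes onb: "is_onb (e ` I)" "inj_on e I"
    and L: "tc_linear \<Phi>" and CP: "completely_positive \<Phi>" and C: "C \<ge> 0"
    and tr: "\<And>s. positive_op s \<Longrightarrow> trace_class s \<Longrightarrow> Re (trace (\<Phi> s)) \<le> C * Re (trace s)"
  shows "\<exists>V :: 'a \<Rightarrow> ('a, 'b) hspace. bounded_clinear V \<and> (\<forall>x. norm (V x) \<le> sqrt C * norm x) \<and>
    (\<forall>s. trace_class s \<longrightarrow> \<Phi> s = (Psi \<circ> Ad V) s)"
proof -
  note \<Phi> = L CP C tr
  have eI: "cinner (e i) (e j) = (if i = j then 1 else 0)" if "i \<in> I" "j \<in> I" for i j
    using onb that unfolding is_onb_def orthonormal_def by (auto simp: inj_on_eq_iff)
  \<comment> \<open>Padding by zero lets the block operator be indexed by all natural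
    numbers.\<close>
  define u where "u i = (if i \<in> I then e i else 0)" for i
  define F where "F i j = \<Phi> (hs_apply (ketbra (u i) (u j)))" for i j
  let ?c = "\<lambda>i. complex_of_real ((1/2) ^ i)"
  let ?M = "\<lambda>i (y::'b). u i \<otimes> y"
  have tcF: "trace_class (F i j)" for i j
    unfolding F_def by (rule Phi_trace_class[OF \<Phi> trace_class_ketbra])
  have bM: "bounded_clinear (?M i)" for i by (rule bounded_clinear_tensor_right)
  have u1: "norm (u i) \<le> 1" for i
    using onb orthonormal_norm[of "e ` I" "e i"] by (simp add: u_def is_onb_def)
  have "\<exists>R. positive_op R \<and> (\<forall>k\<in>I. \<forall>l\<in>I. \<forall>y. adj (?M k) (R (R (?M l y))) = complex_of_real ((1/2) ^ k * (1/2) ^ l) *\<^sub>C F k l y)"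
  proof (rule block_sqrt_exists)
    show "cinner (u i) (u j) = (if i = j \<and> i \<in> I then 1 else 0)" for i j
      by (simp add: u_def eI)
    show "bounded_clinear (F i j)" for i j by (rule trace_class_bounded_clinear[OF tcF])
    show "norm (F i j y) \<le> 4 * C * norm y" for i j y
      unfolding F_def by (rule Phi_ketbra_bound[OF \<Phi> u1 u1])
    show "\<exists>r\<ge>0. (\<Sum>i<n. \<Sum>j<n. cinner (y i) (F i j (y j))) = complex_of_real r" for n y
      unfolding F_def by (rule completely_positive_ketbra[OF CP])
  qed
  then obtain R where R: "positive_op R"
    and RF: "\<And>k l y. k \<in> I \<Longrightarrow> l \<in> I \<Longrightarrow> adj (?M k) (R (R (?M l y))) = (?c k * ?c l) *\<^sub>C F k l y"
    by (auto simp del: power_divide power_one)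
  have bR: "bounded_clinear R" by (rule positive_op_bounded_clinear[OF R])
  have adjRM: "adj (R \<circ> ?M k) = adj (?M k) \<circ> R" for k
    by (simp add: adj_compose bR bM positive_op_adj[OF R])
  \<comment> \<open>|R M_k y|^2 is 4^-k <y, F_kk y>, and F_kk is trace class, so its diagonal is
    summable.\<close>
  have hsRM: "hilbert_schmidt (R \<circ> ?M k)" if k: "k \<in> I" for k
  proof (rule hilbert_schmidtI[OF bounded_clinear_compose[OF bR bM]])
    have "((\<lambda>y. (?c k * ?c k) * cinner y (F k k y)) has_sum (?c k * ?c k) * trace (F k k)) some_onb"
      by (rule has_sum_cmult_right[OF trace_has_sum[OF tcF some_onb_is_onb]])
    then have "(\<lambda>y. Re ((?c k * ?c k) * cinner y (F k k y))) summable_on some_onb"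
      by (intro summable_on_Re has_sum_imp_summable)
    moreover have "Re ((?c k * ?c k) * cinner y (F k k y)) = (norm ((R \<circ> ?M k) y))\<^sup>2" for y
    proof -
      have "(?c k * ?c k) * cinner y (F k k y) = cinner y (adj (?M k) (R (R (?M k y))))"
        by (simp only: RF[OF k k] cinner_scaleC_right)
      also have "\<dots> = cinner (R (?M k y)) (R (?M k y))"
        by (simp add: cinner_adj_right[OF bM] positive_op_cinner[OF R])
      finally show ?thesis by (simp add: cinner_self)
    qed
    ultimately show "(\<lambda>y. (norm ((R \<circ> ?M k) y))\<^sup>2) summable_on some_onb" by simp
  qed
  \<comment> \<open>The adjoint points from the tensor product to H_2, as an element of
    \<open>hspace\<close> must; the scalar 2^k removes the weight of index k.\<close>
  define w :: "nat \<Rightarrow> ('a, 'b) hspace" where "w k = (1 / ?c k) *\<^sub>C hs_adj (Abs_hs (R \<circ> ?M k))" for k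
  have wF: "hs_prod (w k) (w l) = F k l" if "k \<in> I" "l \<in> I" for k l
  proof
    fix y
    have "hs_prod (hs_adj (Abs_hs (R \<circ> ?M k))) (hs_adj (Abs_hs (R \<circ> ?M l))) y = (?c k * ?c l) *\<^sub>C F k l y"
      using that RF[OF that]
      by (simp add: hs_prod_def hs_adj.rep_eq hs_apply_Abs_hs hsRM adjRM[symmetric] adj_adj bounded_clinear_compose bR bM)
        (simp add: adjRM)
    then show "hs_prod (w k) (w l) y = F k l y"
      by (simp add: w_def hs_prod_scaleC_left hs_prod_scaleC_right scaleC_scaleC)
  qed
  \<comment> \<open>For x = sum c_i e_i, the image of |x><x| and the product of sum c_i w_i with its
    own adjoint have the same expansion; taking traces leaves the trace inequality at
    |x><x|.\<close>
  have wbound: "(norm (\<Sum>i\<in>J. c i *\<^sub>C w i))\<^sup>2 \<le> (sqrt C)\<^sup>2 * (\<Sum>i\<in>J. (cmod (c i))\<^sup>2)"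
    if J: "finite J" "J \<subseteq> I" for J c
  proof -
    let ?w = "\<Sum>i\<in>J. c i *\<^sub>C w i" and ?x = "\<Sum>i\<in>J. c i *\<^sub>C e i"
    have "\<Phi> (hs_apply (ketbra ?x ?x)) = \<Phi> (\<lambda>z. \<Sum>p\<in>J \<times> J. (c (fst p) * cnj (c (snd p))) *\<^sub>C hs_apply (ketbra (e (fst p)) (e (snd p))) z)"
      by (rule arg_cong[where f=\<Phi>], rule ext) (simp only: ketbra_sum case_prod_unfold)
    also have "\<dots> = (\<lambda>z. \<Sum>p\<in>J \<times> J. (c (fst p) * cnj (c (snd p))) *\<^sub>C \<Phi> (hs_apply (ketbra (e (fst p)) (e (snd p)))) z)"
      by (rule Phi_sum[OF \<Phi> trace_class_ketbra])
    also have "\<dots> = hs_prod ?w ?w"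
    proof
      fix z
      show "(\<Sum>p\<in>J \<times> J. (c (fst p) * cnj (c (snd p))) *\<^sub>C \<Phi> (hs_apply (ketbra (e (fst p)) (e (snd p)))) z) = hs_prod ?w ?w z"
        unfolding hs_prod_sum_sum case_prod_unfold
      proof (rule sum.cong[OF refl])
        fix p assume "p \<in> J \<times> J"
        then have p: "fst p \<in> I" "snd p \<in> I" using J by auto
        then show "(c (fst p) * cnj (c (snd p))) *\<^sub>C \<Phi> (hs_apply (ketbra (e (fst p)) (e (snd p)))) z
            = (c (fst p) * cnj (c (snd p))) *\<^sub>C hs_prod (w (fst p)) (w (snd p)) z"
          by (simp add: wF F_def u_def)
      qed
    qed
    finally have eq: "\<Phi> (hs_apply (ketbra ?x ?x)) = hs_prod ?w ?w" .
    have "Re (trace (\<Phi> (hs_apply (ketbra ?x ?x)))) \<le> C * Re (trace (hs_apply (ketbra ?x ?x)))"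
      by (rule tr[OF positive_op_ketbra trace_class_ketbra])
    then have "(norm ?w)\<^sup>2 \<le> C * (norm ?x)\<^sup>2"
      by (simp only: eq trace_hs_prod trace_ketbra cinner_self Re_complex_of_real)
    moreover have "(norm ?x)\<^sup>2 = (\<Sum>i\<in>J. (cmod (c i))\<^sup>2)"
    proof -
      have inj: "inj_on e J" using onb(2) J(2) by (rule inj_on_subset)
      have "(norm (\<Sum>f\<in>e ` J. c (inv_into J e f) *\<^sub>C f))\<^sup>2 = (\<Sum>f\<in>e ` J. (cmod (c (inv_into J e f)))\<^sup>2)"
        using onb(1) J by (intro orthonormal_norm_sum[of "e ` I"]) (auto simp: is_onb_def)
      then show ?thesis by (simp add: sum.reindex[OF inj] inj)
    qed
    ultimately show ?thesis using C by simp
  qed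
  obtain V where V: "bounded_clinear V" "\<And>i. i \<in> I \<Longrightarrow> V (e i) = w i" "\<And>x. norm (V x) \<le> sqrt C * norm x"
    using bounded_clinear_onb_extension[OF onb real_sqrt_ge_zero[OF C] wbound] by blast
  have "\<Phi> (hs_prod A B) = (Psi \<circ> Ad V) (hs_prod A B)" for A B :: "('a, 'a) hs"
  proof
    fix z
    show "\<Phi> (hs_prod A B) z = (Psi \<circ> Ad V) (hs_prod A B) z"
    proof (rule cinner_eqI)
      fix y
      note add = bounded_clinear_add[OF bounded_clinear_hs_lcomp[OF V(1)]]
      note scale = bounded_clinear_scaleC[OF bounded_clinear_hs_lcomp[OF V(1)]]
      let ?k = "\<lambda>A. kraus_vec (hs_lcomp V A)"
      \<comment> \<open>The gap between the two sides, as a bounded sesquilinear form in the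
        factors; it need only vanish on rank-one factors with left vector in the basis.\<close>
      define G where "G A B = cinner y (\<Phi> (hs_prod A B) z) - cinner y (hs_prod (?k A) (?k B) z)" for A B :: "('a, 'a) hs"
      have "G A B = 0"
      \<comment> \<open>The constant adds 4 C from polarisation to C from the two factors
        \<open>sqrt C\<close> of the Kraus product.\<close>
      proof (rule hs_sesquilinear_zero[where B="e ` I" and F=G and K="4 * (C * (norm y * norm z)) + C * (norm y * norm z)", OF _ _ _ _ _ onb(1)])
        fix A A' B B' :: "('a, 'a) hs" and c
        show "G (A + A') B = G A B + G A' B"
          by (simp add: G_def add kraus_vec_add hs_prod_add_left Phi_hs_prod_add_left[OF \<Phi>] cinner_add_right)
        show "G A (B + B') = G A B + G A B'"
          by (simp add: G_def add kraus_vec_add hs_prod_add_right Phi_hs_prod_add_right[OF \<Phi>] cinner_add_right)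
        show "G (c *\<^sub>C A) B = c * G A B"
          by (simp add: G_def scale kraus_vec_scaleC hs_prod_scaleC_left Phi_hs_prod_scaleC_left[OF \<Phi>]
              cinner_scaleC_right right_diff_distrib)
        show "G A (c *\<^sub>C B) = cnj c * G A B"
          by (simp add: G_def scale kraus_vec_scaleC hs_prod_scaleC_right Phi_hs_prod_scaleC_right[OF \<Phi>]
              cinner_scaleC_right right_diff_distrib)
        have "cmod (cinner y (hs_prod (?k A) (?k B) z)) \<le> (sqrt C * norm A) * (sqrt C * norm B) * (norm y * norm z)"
          using C
          by (intro order_trans[OF cinner_hs_prod_bound] mult_right_mono mult_mono)
            (auto simp: norm_kraus_vec intro: norm_hs_lcomp_le[OF V(1) _ V(3)])
        also have "(sqrt C * norm A) * (sqrt C * norm B) * (norm y * norm z)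
            = (sqrt C * sqrt C) * (norm y * norm z) * (norm A * norm B)" by (simp only: mult_ac)
        finally have "cmod (cinner y (hs_prod (?k A) (?k B) z)) \<le> C * (norm y * norm z) * (norm A * norm B)"
          using C by simp
        with Phi_hs_prod_bound[OF \<Phi>, of y A B z]
        show "cmod (G A B) \<le> (4 * (C * (norm y * norm z)) + C * (norm y * norm z)) * (norm A * norm B)"
          unfolding G_def by (intro order_trans[OF norm_triangle_ineq4]) (simp add: distrib_right)
      next
        fix f f' g h :: 'a assume "f \<in> e ` I" "f' \<in> e ` I"
        then obtain i j where ij: "i \<in> I" "j \<in> I" "f = e i" "f' = e j" by blast
        have "\<Phi> (hs_prod (ketbra f g) (ketbra f' h)) = (\<lambda>x. cinner g h *\<^sub>C F i j x)"
          using Phi_scaleC[OF \<Phi> trace_class_ketbra[of f f'], of "cinner g h"] ij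
          by (simp add: hs_prod_ketbra F_def u_def fun_eq_iff scaleC_hs.rep_eq)
        moreover have "hs_prod (?k (ketbra f g)) (?k (ketbra f' h)) = (\<lambda>x. cinner g h *\<^sub>C F i j x)"
          using ij
          by (intro ext) (simp only: Psi_hs_prod[symmetric] hs_lcomp_ketbra[OF V(1)] Psi_ketbra V(2) hs_prod_scaleC_left wF)
        ultimately show "G (ketbra f g) (ketbra f' h) = 0" by (simp add: G_def)
      qed
      then show "cinner y (\<Phi> (hs_prod A B) z) = cinner y ((Psi \<circ> Ad V) (hs_prod A B) z)"
        unfolding Psi_Ad_hs_prod[OF V(1)] by (simp add: G_def)
    qed
  qed
  then have "\<Phi> s = (Psi \<circ> Ad V) s" if "trace_class s" for s
    using trace_class_factor[OF that] by metis
  then show ?thesis using V by blast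
qed

section \<open>The three equivalences\<close>

lemma onorm_le_imp_norm_le:
  assumes "bounded_clinear V" "onorm V \<le> K"
  shows "norm (V x) \<le> K * norm x"
  using bounded_clinear_norm_le[OF assms(1), of x] mult_right_mono[OF assms(2) norm_ge_zero[of x]] by linarith

lemma cb_norm_trace_le:
  fixes \<Phi> :: "('a::chilbert_space \<Rightarrow> 'a) \<Rightarrow> ('b::chilbert_space \<Rightarrow> 'b)"
  assumes "tc_linear \<Phi>" "completely_positive \<Phi>" "cb_norm \<Phi> \<le> ennreal C" "C \<ge> 0" "positive_op s" "trace_class s"
  shows "Re (trace (\<Phi> s)) \<le> C * Re (trace s)"
  using cb_norm_trace_norm_le[OF assms(1,3,4,6)]
    positive_trace[OF completely_positive_positive[OF assms(2,1,5,6)]] positive_trace[OF assms(5)] by simp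

theorem theorem1p1:
  fixes e :: "nat \<Rightarrow> 'a::chilbert_space"
    and I :: "nat set"
    and \<Phi> :: "('a \<Rightarrow> 'a) \<Rightarrow> ('b::chilbert_space \<Rightarrow> 'b)"
  assumes "separable_space (euclidean :: 'a topology)"
    and "I = UNIV \<or> (\<exists>N. I = {1..N})"
    and "inj_on e I" and "is_onb (e ` I)"
    and "tc_linear \<Phi>" and "finite_rank_preserving \<Phi>"
  shows "(completely_positive \<Phi> \<and> completely_bounded \<Phi> \<longleftrightarrow>
           (\<exists>V :: 'a \<Rightarrow> ('a, 'b) hspace. bounded_clinear V \<and>
              (\<forall>s. trace_class s \<longrightarrow> \<Phi> s = (Psi \<circ> Ad V) s))) \<and>
         (completely_positive \<Phi> \<and> completely_contractive \<Phi> \<longleftrightarrow>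
           (\<exists>V :: 'a \<Rightarrow> ('a, 'b) hspace. bounded_clinear V \<and> onorm V \<le> 1 \<and>
              (\<forall>s. trace_class s \<longrightarrow> \<Phi> s = (Psi \<circ> Ad V) s))) \<and>
         (completely_positive \<Phi> \<and> trace_preserving \<Phi> \<longleftrightarrow>
           (\<exists>V :: 'a \<Rightarrow> ('a, 'b) hspace. bounded_clinear V \<and> (\<forall>x. norm (V x) = norm x) \<and>
              (\<forall>s. trace_class s \<longrightarrow> \<Phi> s = (Psi \<circ> Ad V) s)))"
proof (intro conjI iffI)
  note repr = stinespring_representation[OF assms(4,3,5)]
  show "\<exists>V :: 'a \<Rightarrow> ('a, 'b) hspace. bounded_clinear V \<and> (\<forall>s. trace_class s \<longrightarrow> \<Phi> s = (Psi \<circ> Ad V) s)"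
    if *: "completely_positive \<Phi> \<and> completely_bounded \<Phi>"
  proof -
    \<comment> \<open>Finiteness turns the extended real into a real constant C.\<close>
    have "cb_norm \<Phi> \<le> ennreal (enn2real (cb_norm \<Phi>))"
      using * by (simp add: completely_bounded_def)
    then show ?thesis
      using repr[of "enn2real (cb_norm \<Phi>)"] cb_norm_trace_le[OF assms(5), of "enn2real (cb_norm \<Phi>)"] * by auto
  qed
  show "\<exists>V :: 'a \<Rightarrow> ('a, 'b) hspace. bounded_clinear V \<and> onorm V \<le> 1 \<and> (\<forall>s. trace_class s \<longrightarrow> \<Phi> s = (Psi \<circ> Ad V) s)"
    if *: "completely_positive \<Phi> \<and> completely_contractive \<Phi>"
  proof -
    have "cb_norm \<Phi> \<le> ennreal 1" using * by (simp add: completely_contractive_def)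
    then obtain V :: "'a \<Rightarrow> ('a, 'b) hspace" where V: "bounded_clinear V" "\<And>x. norm (V x) \<le> sqrt 1 * norm x"
      "\<forall>s. trace_class s \<longrightarrow> \<Phi> s = (Psi \<circ> Ad V) s"
      using repr[of 1] cb_norm_trace_le[OF assms(5), of 1] * by auto
    have "onorm V \<le> 1" using V(2) by (intro onorm_bound) simp_all
    then show ?thesis using V by blast
  qed
  show "\<exists>V :: 'a \<Rightarrow> ('a, 'b) hspace. bounded_clinear V \<and> (\<forall>x. norm (V x) = norm x) \<and> (\<forall>s. trace_class s \<longrightarrow> \<Phi> s = (Psi \<circ> Ad V) s)"
    if *: "completely_positive \<Phi> \<and> trace_preserving \<Phi>"
  proof -
    \<comment> \<open>Trace preservation is the trace inequality for C = 1, with equality.\<close>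
    obtain V :: "'a \<Rightarrow> ('a, 'b) hspace" where V: "bounded_clinear V"
      "\<And>s. trace_class s \<Longrightarrow> \<Phi> s = (Psi \<circ> Ad V) s"
      using repr[of 1] * by (auto simp: trace_preserving_def)
    have "norm (V x) = norm x" for x
    proof (cases "x = 0")
      case False
      have "cinner (V x) (V x) * cinner x x = cinner x x * cinner x x"
      proof -
        \<comment> \<open>This operator is |x|^2 |x><x|, so comparing traces gives |V x|^2 |x|^2 =
          |x|^4, and x is nonzero.\<close>
        let ?s = "hs_prod (ketbra x x) (ketbra x x)"
        have "trace ((Psi \<circ> Ad V) ?s) = trace ?s"
          using * trace_class_hs_prod[of "ketbra x x" "ketbra x x"] unfolding trace_preserving_def by (metis V(2))
        then show ?thesis
          unfolding Psi_Ad_hs_prod[OF V(1)] trace_hs_prod cinner_kraus_vec hs_lcomp_ketbra[OF V(1)] cinner_ketbra_left ketbra_apply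
          by (simp add: cinner_scaleC_right mult.commute)
      qed
      then have "complex_of_real ((norm (V x))\<^sup>2) = complex_of_real ((norm x)\<^sup>2)"
        using False unfolding cinner_self[symmetric] by simp
      then have "(norm (V x))\<^sup>2 = (norm x)\<^sup>2" unfolding of_real_eq_iff .
      then show ?thesis by simp
    qed (simp add: bounded_clinear_zero[OF V(1)])
    then show ?thesis using V by blast
  qed
next
  assume "\<exists>V :: 'a \<Rightarrow> ('a, 'b) hspace. bounded_clinear V \<and> (\<forall>s. trace_class s \<longrightarrow> \<Phi> s = (Psi \<circ> Ad V) s)"
  then obtain V :: "'a \<Rightarrow> ('a, 'b) hspace" where V: "bounded_clinear V" "\<And>s. trace_class s \<Longrightarrow> \<Phi> s = (Psi \<circ> Ad V) s" by blast
  show "completely_positive \<Phi>" by (rule completely_positive_Psi_Ad[OF V])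
  have "cb_norm \<Phi> \<le> ennreal ((onorm V)\<^sup>2)"
    by (rule cb_norm_Psi_Ad_le[OF V bounded_clinear_onorm_pos_le[OF V(1)] bounded_clinear_norm_le[OF V(1)]])
  then show "completely_bounded \<Phi>"
    unfolding completely_bounded_def by (metis ennreal_less_top infinity_ennreal_def order_le_less_trans)
next
  assume "\<exists>V :: 'a \<Rightarrow> ('a, 'b) hspace. bounded_clinear V \<and> onorm V \<le> 1 \<and> (\<forall>s. trace_class s \<longrightarrow> \<Phi> s = (Psi \<circ> Ad V) s)"
  then obtain V :: "'a \<Rightarrow> ('a, 'b) hspace" where V: "bounded_clinear V" "\<And>s. trace_class s \<Longrightarrow> \<Phi> s = (Psi \<circ> Ad V) s"
    and 1: "onorm V \<le> 1" by blast
  show "completely_positive \<Phi>" by (rule completely_positive_Psi_Ad[OF V])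
  have "cb_norm \<Phi> \<le> ennreal (1\<^sup>2)"
    by (rule cb_norm_Psi_Ad_le[OF V]) (simp_all add: onorm_le_imp_norm_le[OF V(1) 1, simplified])
  then show "completely_contractive \<Phi>" by (simp add: completely_contractive_def)
next
  assume "\<exists>V :: 'a \<Rightarrow> ('a, 'b) hspace. bounded_clinear V \<and> (\<forall>x. norm (V x) = norm x) \<and> (\<forall>s. trace_class s \<longrightarrow> \<Phi> s = (Psi \<circ> Ad V) s)"
  then obtain V :: "'a \<Rightarrow> ('a, 'b) hspace" where V: "bounded_clinear V" "\<And>s. trace_class s \<Longrightarrow> \<Phi> s = (Psi \<circ> Ad V) s"
    and iso: "\<And>x. norm (V x) = norm x" by blast
  show "completely_positive \<Phi>" by (rule completely_positive_Psi_Ad[OF V])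
  show "trace_preserving \<Phi>" by (rule trace_preserving_Psi_Ad[OF V iso])
qed

end
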